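(* Let $d \geq 3$, let $T_d$ be the $d$-regular tree, and let $H$ be a non-compact, closed subgroup of $\mathrm{Aut}(T_d)$ acting transitively on (the vertices of) $T_d$ and on the boundary $\partial T_d$, and satisfying Tits' independence property. Let $\mathcal{F}(H)$ be the group of $H$-honest almost automorphisms of $T_d$ with its locally compact group topology in which $H$ is an open subgroup. Let $$\mathcal{P} = \left[0,\tfrac12\right) + i\left\{0,\tfrac{\pi}{\log(d-1)}\right\} \subset \mathbb{C},$$ and for $z \in \mathcal{P}$ let $\pi_{\gamma_o(z)}$ be the irreducible spherical unitary representation of $H$ with positive-definite spherical function $\varphi_{\gamma_o(z)}$. (i) Let $p \in (2,\infty)$ and $p' \in (1,2)$ be such that $\frac1p+\frac1{p'}=1$, and let $z \in \mathcal{P}$. Then the unitary representation of $\mathcal{F}(H)$ induced from $\pi_{\gamma_o(z)}$ is an $L^{p+}$-representation if and only if $\mathrm{Re}\, z \in \left[\frac1p,\frac1{p'}\right]$. (ii) Consequently, for every $p \in (2,\infty)$, the group $\mathcal{F}(H)$ has a unitary $L^{p+}$-representation that is not an $L^{q+}$-representation for any $q \in [1,p)$. This gives an uncountable family (indexed by $p\in(2,\infty)$) of pairwise inequivalent non-tempered unitary representations of $\mathcal{F}(H)$.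
   Context: Trees. $\mathrm{Aut}(T_d)$ carries its usual totally disconnected locally compact topology (pointwise convergence on vertices). $\partial T_d$ is the space of ends of $T_d$ with its usual compact topology; $\mathrm{Aut}(T_d)$ acts on it faithfully by homeomorphisms. Tits' independence property. For a (finite or infinite) geodesic path $C$ in $T_d$, let $\mathrm{Fix}_H(C)$ be the pointwise stabiliser of $C$ in $H$, and let $\mathrm{pr}_C$ be the nearest-point projection from the vertices of $T_d$ to those of $C$. For each vertex $x$ of $C$, $\mathrm{Fix}_H(C)$ preserves $\mathrm{pr}_C^{-1}(x)$; let $F_x$ be the group of permutations of $\mathrm{pr}_C^{-1}(x)$ induced by $\mathrm{Fix}_H(C)$. $H$ satisfies Tits' independence property if for every such $C$ the natural injective map $\mathrm{Fix}_H(C) \to \prod_{x \in C} F_x$ is an isomorphism. The group $\mathcal{F}(H)$. An $H$-honest almost automorphism of $T_d$ is represented by an isomorphism of forests $\phi \colon T_d \setminus T_1 \to T_d \setminus T_2$, where $T_1,T_2$ are finite non-empty subtrees, such that for each connected component $T'$ of $T_d \setminus T_1$ there is $h \in H$ with $\phi|_{T'} = h|_{T'}$. Two such isomorphisms are identified if they agree outside some finite subtree, and composition (after enlarging the finite subtrees) makes the set of classes into a group $\mathcal{F}(H)$. Equivalently, $\mathcal{F}(H)$ is the topological full group of $H$ acting on $\partial T_d$: the group of homeomorphisms $g$ of $\partial T_d$ such that each $\xi \in \partial T_d$ has a neighbourhood $U$ and an $h \in H$ with $g|_U = h|_U$. $H$ is naturally a subgroup of $\mathcal{F}(H)$. It is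 known that, for $H$ as in the claim, $\mathcal{F}(H)$ carries a unique totally disconnected locally compact group topology such that $H$ (with its own topology) is an open subgroup; $\mathcal{F}(H)$ is equipped with this topology. Spherical representations of $H$. Fix a vertex $o$ of $T_d$ and let $K$ be its stabiliser in $H$, a compact open subgroup. A spherical representation of $H$ is an irreducible unitary representation with a non-zero $K$-invariant vector; irreducible spherical unitary representations correspond bijectively (up to equivalence) to positive-definite spherical functions $\varphi$ on $H$, via $\varphi(h) = \langle \pi(h)\xi,\xi\rangle$ with $\xi$ a $K$-invariant unit vector. Write $q_0=d-1$ and $\gamma_o(z) = \frac{q_0^{z}+q_0^{1-z}}{q_0+1}$. For $z \in \mathcal{P}$, the spherical function $\varphi_{\gamma_o(z)}$ is given by $\varphi_{\gamma_o(z)}(h) = \Phi(\mathrm{dist}(o,ho))$, where $\Phi\colon \mathbb{Z}_{\ge 0}\to\mathbb{C}$ is determined by $\Phi(0)=1$, $\Phi(1)=\gamma$ and $\gamma\,\Phi(n) = \frac{1}{q_0+1}\Phi(n-1) + \frac{q_0}{q_0+1}\Phi(n+1)$ for $n\ge1$, with $\gamma=\gamma_o(z)$. It is known that $z \mapsto \varphi_{\gamma_o(z)}$ is a bijection from $\mathcal{P}$ onto the set of positive-definite spherical functions on $H$ associated with non-tempered spherical representations. Matrix coefficients and $L^{p+}$-representations. Unitary representations are strongly continuous. For a unitary representation $(\pi,V)$ of a locally compact group $G$ and $v,w\in V$, put $\pi_{v,w}(g)=\langle \pi(g)v,w\rangle$. For $p\in[1,\infty)$, $\pi$ is an $L^p$-representation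 if there is a dense linear subspace $V_0\subset V$ with $\pi_{v,w}\in L^p(G)$ (Haar measure) for all $v,w\in V_0$; it is an $L^{p+}$-representation if it is an $L^{p+\varepsilon}$-representation for all $\varepsilon>0$. A unitary representation is tempered if it is an $L^{2+}$-representation. Induced representation. For an open subgroup $H$ of $G$, a complete set $\{t_i\}_{i\in I}$ of representatives of the left cosets of $H$ in $G$, and a unitary representation $(\pi,V)$ of $H$, let $\widetilde V$ be the Hilbert space of functions $f\colon G\to V$ with $f(gh)=\pi(h^{-1})f(g)$ for all $g\in G$, $h\in H$, and $\sum_{i}\|f(t_i)\|^2<\infty$, with inner product $\langle f,f'\rangle=\sum_i\langle f(t_i),f'(t_i)\rangle$. The representation induced from $\pi$ is $(\widetilde\pi(g)f)(g')=f(g^{-1}g')$. *)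

theory Defs
  imports
    "HOL-Analysis.Analysis"
    "HOL-Algebra.Coset"
    "HOL-Library.Function_Algebras"
begin

section \<open>The regular tree and its automorphism group\<close>

text \<open>A graph is given by its adjacency relation; its vertices are all elements of the type.\<close>

definition graph_cycle :: "('a \<Rightarrow> 'a \<Rightarrow> bool) \<Rightarrow> 'a list \<Rightarrow> bool" where
  "graph_cycle adj xs \<longleftrightarrow>
     3 \<le> length xs \<and> distinct xs \<and> successively adj xs \<and> adj (last xs) (hd xs)"

definition regular_tree :: "nat \<Rightarrow> ('a \<Rightarrow> 'a \<Rightarrow> bool) \<Rightarrow> bool" where
  "regular_tree d adj \<longleftrightarrow>
     symp adj \<and> irreflp adj \<and>
     (\<forall>x y. adj\<^sup>*\<^sup>* x y) \<and>
     (\<nexists>xs. graph_cycle adj xs) \<and>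
     (\<forall>x. finite {y. adj x y} \<and> card {y. adj x y} = d)"

definition graph_dist :: "('a \<Rightarrow> 'a \<Rightarrow> bool) \<Rightarrow> 'a \<Rightarrow> 'a \<Rightarrow> nat" where
  "graph_dist adj x y = (LEAST n. (adj ^^ n) x y)"

definition tree_auts :: "('a \<Rightarrow> 'a \<Rightarrow> bool) \<Rightarrow> ('a \<Rightarrow> 'a) set" where
  "tree_auts adj = {h. bij h \<and> (\<forall>x y. adj (h x) (h y) \<longleftrightarrow> adj x y)}"

definition aut_group :: "('a \<Rightarrow> 'a \<Rightarrow> bool) \<Rightarrow> ('a \<Rightarrow> 'a) monoid" where
  "aut_group adj = \<lparr>carrier = tree_auts adj, mult = (\<circ>), one = id\<rparr>"

definition aut_topology :: "('a \<Rightarrow> 'a \<Rightarrow> bool) \<Rightarrow> ('a \<Rightarrow> 'a) topology" where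
  "aut_topology adj =
     subtopology (product_topology (\<lambda>_. discrete_topology UNIV) UNIV) (tree_auts adj)"

abbreviation subgroup_group :: "('a \<Rightarrow> 'a \<Rightarrow> bool) \<Rightarrow> ('a \<Rightarrow> 'a) set \<Rightarrow> ('a \<Rightarrow> 'a) monoid" where
  "subgroup_group adj H \<equiv> (aut_group adj)\<lparr>carrier := H\<rparr>"

abbreviation subgroup_topology :: "('a \<Rightarrow> 'a \<Rightarrow> bool) \<Rightarrow> ('a \<Rightarrow> 'a) set \<Rightarrow> ('a \<Rightarrow> 'a) topology" where
  "subgroup_topology adj H \<equiv> subtopology (aut_topology adj) H"

definition vertex_transitive :: "('a \<Rightarrow> 'a) set \<Rightarrow> bool" where
  "vertex_transitive H \<longleftrightarrow> (\<forall>x y. \<exists>h\<in>H. h x = y)"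

definition geodesic_rays :: "('a \<Rightarrow> 'a \<Rightarrow> bool) \<Rightarrow> (nat \<Rightarrow> 'a) set" where
  "geodesic_rays adj = {r. \<forall>i j. i \<le> j \<longrightarrow> graph_dist adj (r i) (r j) = j - i}"

definition end_rel :: "('a \<Rightarrow> 'a \<Rightarrow> bool) \<Rightarrow> ((nat \<Rightarrow> 'a) \<times> (nat \<Rightarrow> 'a)) set" where
  "end_rel adj = {(r, s). r \<in> geodesic_rays adj \<and> s \<in> geodesic_rays adj \<and>
                          (\<exists>m n. \<forall>k. r (m + k) = s (n + k))}"

definition tree_boundary :: "('a \<Rightarrow> 'a \<Rightarrow> bool) \<Rightarrow> (nat \<Rightarrow> 'a) set set" where
  "tree_boundary adj = geodesic_rays adj // end_rel adj"

definition boundary_transitive :: "('a \<Rightarrow> 'a \<Rightarrow> bool) \<Rightarrow> ('a \<Rightarrow> 'a) set \<Rightarrow> bool" where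
  "boundary_transitive adj H \<longleftrightarrow>
     (\<forall>\<xi>\<in>tree_boundary adj. \<forall>\<eta>\<in>tree_boundary adj. \<exists>h\<in>H. (\<lambda>r. h \<circ> r) ` \<xi> = \<eta>)"


section \<open>Tits' independence property\<close>

text \<open>
  Vertex sets of finite, one-sided infinite and two-sided infinite geodesic paths, including the
  one-vertex paths: \<open>I\<close> ranges over all non-empty intervals of integers.
\<close>

definition geodesic_path :: "('a \<Rightarrow> 'a \<Rightarrow> bool) \<Rightarrow> 'a set \<Rightarrow> bool" where
  "geodesic_path adj C \<longleftrightarrow>
     (\<exists>(I :: int set) \<gamma>. I \<noteq> {} \<and> (\<forall>i\<in>I. \<forall>j\<in>I. {i..j} \<subseteq> I) \<and>
        (\<forall>i\<in>I. \<forall>j\<in>I. int (graph_dist adj (\<gamma> i) (\<gamma> j)) = \<bar>i - j\<bar>) \<and> C = \<gamma> ` I)"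

definition fixator :: "('a \<Rightarrow> 'a) set \<Rightarrow> 'a set \<Rightarrow> ('a \<Rightarrow> 'a) set" where
  "fixator H C = {h\<in>H. \<forall>x\<in>C. h x = x}"

definition nearest_point :: "('a \<Rightarrow> 'a \<Rightarrow> bool) \<Rightarrow> 'a set \<Rightarrow> 'a \<Rightarrow> 'a" where
  "nearest_point adj C y = (THE x. x \<in> C \<and> (\<forall>c\<in>C. graph_dist adj y x \<le> graph_dist adj y c))"

definition proj_fibre :: "('a \<Rightarrow> 'a \<Rightarrow> bool) \<Rightarrow> 'a set \<Rightarrow> 'a \<Rightarrow> 'a set" where
  "proj_fibre adj C x = {y. nearest_point adj C y = x}"

definition fibre_group :: "('a \<Rightarrow> 'a \<Rightarrow> bool) \<Rightarrow> ('a \<Rightarrow> 'a) set \<Rightarrow> 'a set \<Rightarrow> 'a \<Rightarrow> ('a \<Rightarrow> 'a) set" where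
  "fibre_group adj H C x = (\<lambda>h. restrict h (proj_fibre adj C x)) ` fixator H C"

text \<open>
  The natural map \<open>Fix\<^sub>H(C) \<rightarrow> \<Prod>x\<in>C. F\<^sub>x\<close> is by construction a homomorphism, so that it is an
  isomorphism if and only if it is bijective.
\<close>

definition tits_independence :: "('a \<Rightarrow> 'a \<Rightarrow> bool) \<Rightarrow> ('a \<Rightarrow> 'a) set \<Rightarrow> bool" where
  "tits_independence adj H \<longleftrightarrow>
     (\<forall>C. geodesic_path adj C \<longrightarrow>
        bij_betw (\<lambda>h. \<lambda>x\<in>C. restrict h (proj_fibre adj C x))
          (fixator H C) (\<Pi>\<^sub>E x\<in>C. fibre_group adj H C x))"


section \<open>The group of honest almost automorphisms\<close>

definition graph_component :: "('a \<Rightarrow> 'a \<Rightarrow> bool) \<Rightarrow> 'a set \<Rightarrow> 'a \<Rightarrow> 'a set" where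
  "graph_component adj A x = {y. (\<lambda>u v. adj u v \<and> u \<in> A \<and> v \<in> A)\<^sup>*\<^sup>* x y}"

definition finite_subtree :: "('a \<Rightarrow> 'a \<Rightarrow> bool) \<Rightarrow> 'a set \<Rightarrow> bool" where
  "finite_subtree adj A \<longleftrightarrow> finite A \<and> A \<noteq> {} \<and> (\<forall>x\<in>A. A \<subseteq> graph_component adj A x)"

text \<open>
  A forest isomorphism \<open>T \<setminus> T\<^sub>1 \<rightarrow> T \<setminus> T\<^sub>2\<close> is represented by a total function whose
  values on the finite set \<open>T\<^sub>1\<close> are irrelevant. This makes composition of representatives
  ordinary composition of functions.
\<close>

definition honest_reps :: "('a \<Rightarrow> 'a \<Rightarrow> bool) \<Rightarrow> ('a \<Rightarrow> 'a) set \<Rightarrow> ('a \<Rightarrow> 'a) set" where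
  "honest_reps adj H =
     {f. \<exists>T\<^sub>1 T\<^sub>2. finite_subtree adj T\<^sub>1 \<and> finite_subtree adj T\<^sub>2 \<and>
           bij_betw f (- T\<^sub>1) (- T\<^sub>2) \<and>
           (\<forall>x\<in>- T\<^sub>1. \<forall>y\<in>- T\<^sub>1. adj (f x) (f y) \<longleftrightarrow> adj x y) \<and>
           (\<forall>x\<in>- T\<^sub>1. \<exists>h\<in>H. \<forall>y\<in>graph_component adj (- T\<^sub>1) x. f y = h y)}"

definition honest_rel :: "('a \<Rightarrow> 'a \<Rightarrow> bool) \<Rightarrow> ('a \<Rightarrow> 'a) set \<Rightarrow> (('a \<Rightarrow> 'a) \<times> ('a \<Rightarrow> 'a)) set" where
  "honest_rel adj H =
     {(f, g). f \<in> honest_reps adj H \<and> g \<in> honest_reps adj H \<and>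
              (\<exists>A. finite_subtree adj A \<and> (\<forall>x\<in>- A. f x = g x))}"

definition honest_group :: "('a \<Rightarrow> 'a \<Rightarrow> bool) \<Rightarrow> ('a \<Rightarrow> 'a) set \<Rightarrow> ('a \<Rightarrow> 'a) set monoid" where
  "honest_group adj H =
     \<lparr>carrier = honest_reps adj H // honest_rel adj H,
      mult = (\<lambda>X Y. \<Union>f\<in>X. \<Union>g\<in>Y. honest_rel adj H `` {f \<circ> g}),
      one = honest_rel adj H `` {id}\<rparr>"

definition honest_embed :: "('a \<Rightarrow> 'a \<Rightarrow> bool) \<Rightarrow> ('a \<Rightarrow> 'a) set \<Rightarrow> ('a \<Rightarrow> 'a) \<Rightarrow> ('a \<Rightarrow> 'a) set" where
  "honest_embed adj H h = honest_rel adj H `` {h}"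

definition topological_group :: "('g, 'm) monoid_scheme \<Rightarrow> 'g topology \<Rightarrow> bool" where
  "topological_group G T \<longleftrightarrow>
     group G \<and> topspace T = carrier G \<and>
     continuous_map (prod_topology T T) T (\<lambda>(x, y). x \<otimes>\<^bsub>G\<^esub> y) \<and>
     continuous_map T T (\<lambda>x. inv\<^bsub>G\<^esub> x)"

definition tdlc_group :: "('g, 'm) monoid_scheme \<Rightarrow> 'g topology \<Rightarrow> bool" where
  "tdlc_group G T \<longleftrightarrow>
     topological_group G T \<and> Hausdorff_space T \<and> locally_compact_space T \<and>
     (\<forall>C. connectedin T C \<longrightarrow> (\<exists>x. C \<subseteq> {x}))"

text \<open>
  For \<open>H\<close> as in the theorem exactly one topology \<open>T\<close> satisfies this predicate.
\<close>

definition honest_topology ::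
    "('a \<Rightarrow> 'a \<Rightarrow> bool) \<Rightarrow> ('a \<Rightarrow> 'a) set \<Rightarrow> ('a \<Rightarrow> 'a) set topology \<Rightarrow> bool" where
  "honest_topology adj H T \<longleftrightarrow>
     tdlc_group (honest_group adj H) T \<and>
     openin T (honest_embed adj H ` H) \<and>
     homeomorphic_map (subgroup_topology adj H) (subtopology T (honest_embed adj H ` H))
       (honest_embed adj H)"


section \<open>Complex Hilbert spaces\<close>

class complex_vector = ab_group_add +
  fixes scaleC :: "complex \<Rightarrow> 'a \<Rightarrow> 'a"  (infixr "*\<^sub>C" 75)
  assumes scaleC_add_right: "a *\<^sub>C (x + y) = a *\<^sub>C x + a *\<^sub>C y"
    and scaleC_add_left: "(a + b) *\<^sub>C x = a *\<^sub>C x + b *\<^sub>C x"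
    and scaleC_scaleC: "a *\<^sub>C (b *\<^sub>C x) = (a * b) *\<^sub>C x"
    and scaleC_one: "1 *\<^sub>C x = x"

instantiation complex :: complex_vector
begin
definition scaleC_complex :: "complex \<Rightarrow> complex \<Rightarrow> complex" where
  "scaleC_complex a x = a * x"
instance
  by standard (simp_all add: scaleC_complex_def algebra_simps)
end

instantiation "fun" :: (type, complex_vector) complex_vector
begin
definition scaleC_fun :: "complex \<Rightarrow> ('a \<Rightarrow> 'b) \<Rightarrow> 'a \<Rightarrow> 'b" where
  "scaleC_fun a f = (\<lambda>x. a *\<^sub>C f x)"
instance
  by standard
    (simp_all add: scaleC_fun_def fun_eq_iff scaleC_add_right scaleC_add_left
      scaleC_scaleC scaleC_one)
end

text \<open>
  A Hilbert space is a linear subspace of an ambient complex vector space together with an inner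
  product on it, linear in the first argument. No topology on the ambient space is involved.
\<close>

record 'v hspace =
  hcarrier :: "'v set"
  hinner :: "'v \<Rightarrow> 'v \<Rightarrow> complex"

definition csubspace :: "'v::complex_vector set \<Rightarrow> bool" where
  "csubspace W \<longleftrightarrow>
     0 \<in> W \<and> (\<forall>x\<in>W. \<forall>y\<in>W. x + y \<in> W) \<and> (\<forall>a. \<forall>x\<in>W. a *\<^sub>C x \<in> W)"

definition hnorm :: "'v hspace \<Rightarrow> 'v \<Rightarrow> real" where
  "hnorm V v = sqrt (Re (hinner V v v))"

text \<open>
  The distance is set to 0 off the carrier because the locale \<open>Metric_space\<close> requires
  non-negativity and symmetry everywhere.
\<close>

definition hdist :: "'v::complex_vector hspace \<Rightarrow> 'v \<Rightarrow> 'v \<Rightarrow> real" where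
  "hdist V v w = (if v \<in> hcarrier V \<and> w \<in> hcarrier V then hnorm V (v - w) else 0)"

definition htopology :: "'v::complex_vector hspace \<Rightarrow> 'v topology" where
  "htopology V = Metric_space.mtopology (hcarrier V) (hdist V)"

definition hilbert_space :: "'v::complex_vector hspace \<Rightarrow> bool" where
  "hilbert_space V \<longleftrightarrow>
     csubspace (hcarrier V) \<and>
     (\<forall>u\<in>hcarrier V. \<forall>v\<in>hcarrier V. \<forall>w\<in>hcarrier V.
        hinner V (u + v) w = hinner V u w + hinner V v w) \<and>
     (\<forall>a. \<forall>v\<in>hcarrier V. \<forall>w\<in>hcarrier V. hinner V (a *\<^sub>C v) w = a * hinner V v w) \<and>
     (\<forall>v\<in>hcarrier V. \<forall>w\<in>hcarrier V. hinner V w v = cnj (hinner V v w)) \<and>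
     (\<forall>v\<in>hcarrier V. v \<noteq> 0 \<longrightarrow> 0 < Re (hinner V v v)) \<and>
     Metric_space.mcomplete (hcarrier V) (hdist V)"

definition unitary_map ::
    "'v::complex_vector hspace \<Rightarrow> 'w::complex_vector hspace \<Rightarrow> ('v \<Rightarrow> 'w) \<Rightarrow> bool" where
  "unitary_map V W U \<longleftrightarrow>
     bij_betw U (hcarrier V) (hcarrier W) \<and>
     (\<forall>u\<in>hcarrier V. \<forall>v\<in>hcarrier V. U (u + v) = U u + U v) \<and>
     (\<forall>a. \<forall>v\<in>hcarrier V. U (a *\<^sub>C v) = a *\<^sub>C U v) \<and>
     (\<forall>u\<in>hcarrier V. \<forall>v\<in>hcarrier V. hinner W (U u) (U v) = hinner V u v)"


section \<open>Unitary representations\<close>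

definition unitary_rep ::
    "('g, 'm) monoid_scheme \<Rightarrow> 'g topology \<Rightarrow> 'v::complex_vector hspace \<Rightarrow> ('g \<Rightarrow> 'v \<Rightarrow> 'v) \<Rightarrow> bool" where
  "unitary_rep G T V \<pi> \<longleftrightarrow>
     hilbert_space V \<and>
     (\<forall>g\<in>carrier G. unitary_map V V (\<pi> g)) \<and>
     (\<forall>g\<in>carrier G. \<forall>h\<in>carrier G. \<forall>v\<in>hcarrier V. \<pi> (g \<otimes>\<^bsub>G\<^esub> h) v = \<pi> g (\<pi> h v)) \<and>
     (\<forall>v\<in>hcarrier V. continuous_map T (htopology V) (\<lambda>g. \<pi> g v))"

definition irreducible_rep ::
    "('g, 'm) monoid_scheme \<Rightarrow> 'v::complex_vector hspace \<Rightarrow> ('g \<Rightarrow> 'v \<Rightarrow> 'v) \<Rightarrow> bool" where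
  "irreducible_rep G V \<pi> \<longleftrightarrow>
     hcarrier V \<noteq> {0} \<and>
     (\<forall>W. csubspace W \<and> closedin (htopology V) W \<and>
          (\<forall>g\<in>carrier G. \<pi> g ` W \<subseteq> W) \<longrightarrow> W = {0} \<or> W = hcarrier V)"

definition equivalent_reps ::
    "('g, 'm) monoid_scheme \<Rightarrow> 'v::complex_vector hspace \<Rightarrow> ('g \<Rightarrow> 'v \<Rightarrow> 'v) \<Rightarrow>
     'w::complex_vector hspace \<Rightarrow> ('g \<Rightarrow> 'w \<Rightarrow> 'w) \<Rightarrow> bool" where
  "equivalent_reps G V \<pi> W \<rho> \<longleftrightarrow>
     (\<exists>U. unitary_map V W U \<and> (\<forall>g\<in>carrier G. \<forall>v\<in>hcarrier V. U (\<pi> g v) = \<rho> g (U v)))"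

definition left_haar_measure :: "('g, 'm) monoid_scheme \<Rightarrow> 'g topology \<Rightarrow> 'g measure \<Rightarrow> bool" where
  "left_haar_measure G T \<mu> \<longleftrightarrow>
     space \<mu> = carrier G \<and>
     sets \<mu> = sigma_sets (carrier G) {U. openin T U} \<and>
     (\<forall>g\<in>carrier G. \<forall>A\<in>sets \<mu>. emeasure \<mu> ((\<lambda>x. g \<otimes>\<^bsub>G\<^esub> x) ` A) = emeasure \<mu> A) \<and>
     emeasure \<mu> (carrier G) \<noteq> 0 \<and>
     (\<forall>K. compactin T K \<longrightarrow> emeasure \<mu> K < \<infinity>) \<and>
     (\<forall>A\<in>sets \<mu>. emeasure \<mu> A = (INF U\<in>{U. openin T U \<and> A \<subseteq> U}. emeasure \<mu> U)) \<and>
     (\<forall>U. openin T U \<longrightarrow> emeasure \<mu> U = (SUP K\<in>{K. compactin T K \<and> K \<subseteq> U}. emeasure \<mu> K))"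

definition Lp_function :: "'g measure \<Rightarrow> real \<Rightarrow> ('g \<Rightarrow> complex) \<Rightarrow> bool" where
  "Lp_function \<mu> p f \<longleftrightarrow> f \<in> borel_measurable \<mu> \<and> integrable \<mu> (\<lambda>g. norm (f g) powr p)"

definition Lp_rep ::
    "'g measure \<Rightarrow> real \<Rightarrow> 'v::complex_vector hspace \<Rightarrow> ('g \<Rightarrow> 'v \<Rightarrow> 'v) \<Rightarrow> bool" where
  "Lp_rep \<mu> p V \<pi> \<longleftrightarrow>
     (\<exists>V\<^sub>0. csubspace V\<^sub>0 \<and> V\<^sub>0 \<subseteq> hcarrier V \<and> htopology V closure_of V\<^sub>0 = hcarrier V \<and>
        (\<forall>v\<in>V\<^sub>0. \<forall>w\<in>V\<^sub>0. Lp_function \<mu> p (\<lambda>g. hinner V (\<pi> g v) w)))"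

definition Lp_plus_rep ::
    "'g measure \<Rightarrow> real \<Rightarrow> 'v::complex_vector hspace \<Rightarrow> ('g \<Rightarrow> 'v \<Rightarrow> 'v) \<Rightarrow> bool" where
  "Lp_plus_rep \<mu> p V \<pi> \<longleftrightarrow> (\<forall>\<epsilon>>0. Lp_rep \<mu> (p + \<epsilon>) V \<pi>)"

definition tempered_rep ::
    "'g measure \<Rightarrow> 'v::complex_vector hspace \<Rightarrow> ('g \<Rightarrow> 'v \<Rightarrow> 'v) \<Rightarrow> bool" where
  "tempered_rep \<mu> V \<pi> \<longleftrightarrow> Lp_plus_rep \<mu> 2 V \<pi>"


section \<open>Induced representations\<close>

definition left_transversal :: "('g, 'm) monoid_scheme \<Rightarrow> 'g set \<Rightarrow> 'g set \<Rightarrow> bool" where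
  "left_transversal G L R \<longleftrightarrow> R \<subseteq> carrier G \<and> (\<forall>g\<in>carrier G. \<exists>!t. t \<in> R \<and> g \<in> t <#\<^bsub>G\<^esub> L)"

text \<open>
  Functions on the group are extended by 0 off its carrier, so that they are determined by their
  values on the group and form a linear subspace of the function type.
\<close>

definition induced_space ::
    "('g, 'm) monoid_scheme \<Rightarrow> 'g set \<Rightarrow> 'g set \<Rightarrow> 'v::complex_vector hspace \<Rightarrow> ('g \<Rightarrow> 'v \<Rightarrow> 'v) \<Rightarrow>
     ('g \<Rightarrow> 'v) hspace" where
  "induced_space G L R V \<pi> =
     \<lparr>hcarrier = {f. (\<forall>g\<in>carrier G. f g \<in> hcarrier V) \<and> (\<forall>g. g \<notin> carrier G \<longrightarrow> f g = 0) \<and>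
                     (\<forall>g\<in>carrier G. \<forall>h\<in>L. f (g \<otimes>\<^bsub>G\<^esub> h) = \<pi> (inv\<^bsub>G\<^esub> h) (f g)) \<and>
                     (\<lambda>t. (hnorm V (f t))\<^sup>2) summable_on R},
      hinner = (\<lambda>f f'. \<Sum>\<^sub>\<infinity>t\<in>R. hinner V (f t) (f' t))\<rparr>"

definition induced_rep ::
    "('g, 'm) monoid_scheme \<Rightarrow> 'g \<Rightarrow> ('g \<Rightarrow> 'v::zero) \<Rightarrow> 'g \<Rightarrow> 'v" where
  "induced_rep G g f = (\<lambda>g'. if g' \<in> carrier G then f (inv\<^bsub>G\<^esub> g \<otimes>\<^bsub>G\<^esub> g') else 0)"

text \<open>
  A representation of \<open>H\<close> viewed as a representation of its copy inside the group of honest almost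
  automorphisms.
\<close>

definition transported_rep ::
    "('a \<Rightarrow> 'a \<Rightarrow> bool) \<Rightarrow> ('a \<Rightarrow> 'a) set \<Rightarrow> (('a \<Rightarrow> 'a) \<Rightarrow> 'v \<Rightarrow> 'v) \<Rightarrow> ('a \<Rightarrow> 'a) set \<Rightarrow> 'v \<Rightarrow> 'v" where
  "transported_rep adj H \<pi> X = \<pi> (inv_into H (honest_embed adj H) X)"


section \<open>Spherical representations\<close>

definition spherical_gamma :: "nat \<Rightarrow> complex \<Rightarrow> complex" where
  "spherical_gamma q z = (of_nat q powr z + of_nat q powr (1 - z)) / (of_nat q + 1)"

fun spherical_seq :: "nat \<Rightarrow> complex \<Rightarrow> nat \<Rightarrow> complex" where
  "spherical_seq q \<gamma> 0 = 1"
| "spherical_seq q \<gamma> (Suc 0) = \<gamma>"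
| "spherical_seq q \<gamma> (Suc (Suc n)) =
     (of_nat q + 1) / of_nat q *
       (\<gamma> * spherical_seq q \<gamma> (Suc n) - spherical_seq q \<gamma> n / (of_nat q + 1))"

lemma spherical_seq_recurrence:
  assumes "0 < q" "1 \<le> n"
  shows "\<gamma> * spherical_seq q \<gamma> n =
           1 / (of_nat q + 1) * spherical_seq q \<gamma> (n - 1) +
           of_nat q / (of_nat q + 1) * spherical_seq q \<gamma> (n + 1)"
proof -
  obtain m where n: "n = Suc m"
    using assms by (cases n) auto
  have "(of_nat q :: complex) \<noteq> 0" "of_nat q + 1 \<noteq> (0::complex)"
    using assms by (simp, metis add.commute of_nat_Suc of_nat_neq_0)
  moreover have "c * x = 1 / e * y + a / e * (e / a * (c * x - y / e))"
    if "a \<noteq> 0" "e \<noteq> 0" for a c e x y :: complex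
    using that by (simp add: right_diff_distrib)
  ultimately show ?thesis
    by (simp add: n)
qed

definition spherical_function ::
    "nat \<Rightarrow> ('a \<Rightarrow> 'a \<Rightarrow> bool) \<Rightarrow> 'a \<Rightarrow> complex \<Rightarrow> ('a \<Rightarrow> 'a) \<Rightarrow> complex" where
  "spherical_function d adj v\<^sub>0 \<gamma> h = spherical_seq (d - 1) \<gamma> (graph_dist adj v\<^sub>0 (h v\<^sub>0))"

definition spherical_params :: "nat \<Rightarrow> complex set" where
  "spherical_params d = {z. 0 \<le> Re z \<and> Re z < 1/2 \<and> Im z \<in> {0, pi / ln (real (d - 1))}}"

definition spherical_rep_with ::
    "('a \<Rightarrow> 'a \<Rightarrow> bool) \<Rightarrow> ('a \<Rightarrow> 'a) set \<Rightarrow> 'a \<Rightarrow> (('a \<Rightarrow> 'a) \<Rightarrow> complex) \<Rightarrow>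
     'v::complex_vector hspace \<Rightarrow> (('a \<Rightarrow> 'a) \<Rightarrow> 'v \<Rightarrow> 'v) \<Rightarrow> bool" where
  "spherical_rep_with adj H v\<^sub>0 \<phi> V \<pi> \<longleftrightarrow>
     unitary_rep (subgroup_group adj H) (subgroup_topology adj H) V \<pi> \<and>
     irreducible_rep (subgroup_group adj H) V \<pi> \<and>
     (\<exists>\<xi>\<in>hcarrier V. hnorm V \<xi> = 1 \<and> (\<forall>k\<in>fixator H {v\<^sub>0}. \<pi> k \<xi> = \<xi>) \<and>
        (\<forall>h\<in>H. hinner V (\<pi> h \<xi>) \<xi> = \<phi> h))"

end

theory Submission
  imports Defs
begin

text \<open>
  Write \<open>q = d - 1\<close> and \<open>L\<close> for the copy of \<open>H\<close> in the group \<open>G\<close> of almost automorphisms, let \<open>K\<close> be the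
  stabiliser of the base vertex, and let \<open>\<xi>\<close> be a \<open>K\<close>-invariant unit vector of a representation of \<open>H\<close> whose matrix
  coefficient is \<open>\<Phi>(n)\<close> on the elements moving the base vertex by \<open>n\<close>. Extended by zero to \<open>G\<close>, the vector \<open>\<xi>\<close> becomes a
  \<open>K\<close>-invariant unit vector \<open>u\<close> of the induced representation, with coefficient \<open>\<Phi>(n)\<close> on \<open>L\<close> and \<open>0\<close> outside \<open>L\<close>; if \<open>\<xi>\<close> is
  cyclic, then so is \<open>u\<close>. The question is therefore one about the decay of \<open>\<Phi>\<close> on the tree.

  Fast decay suffices (\<open>cyclic_Lp_rep\<close>). A coefficient of two translates of \<open>u\<close> is constant on sets that are permuted
  like the vertices of the tree and all have the same finite measure, so the integral of its \<open>s\<close>-th power is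
  at most a multiple of \<open>\<Sum>\<^sub>n |S\<^sub>n| |\<Phi>(n)|\<^sup>s\<close>, where \<open>S\<^sub>n\<close> is the sphere of radius \<open>n\<close>. Since \<open>|S\<^sub>n|\<close> is about \<open>q\<^sup>n\<close> and the spherical function of
  parameter \<open>z\<close> satisfies \<open>|\<Phi>(n)| \<le> C q\<^sup>-\<^sup>n\<^sup>x\<close> with \<open>x = Re z\<close>, the sum converges for \<open>s x > 1\<close>. Translates of \<open>u\<close> span a dense
  subspace.

  Fast decay is also necessary, and this has to be seen without knowing which dense subspace witnesses integrability
  (\<open>Lp_rep_hecke_norm_bound\<close>). Transitivity on the boundary makes \<open>K\<close> transitive on the neighbours of the base
  vertex (\<open>stabiliser_transitive_on_nbrs\<close>). Hence the Hecke operator \<open>A\<close>, which averages an invariant vector over the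
  neighbouring vertices, is self-adjoint. If \<open>v\<close> has an \<open>L\<^sup>s\<close> coefficient, then the sums of the coefficient over spheres,
  taken after averaging over \<open>K\<close>, are \<open>O(|S\<^sub>n| q\<^sup>-\<^sup>n\<^sup>/\<^sup>s)\<close> by Hoelder's inequality. Functions with this bound grow at most
  like \<open>\<gamma>(1/s)\<^sup>m\<close> under \<open>m\<close> steps of averaging on the tree, where \<open>\<gamma>(x) = (q\<^sup>x + q\<^sup>1\<^sup>-\<^sup>x) / (q + 1)\<close> is \<open>growth (q\<^sup>-\<^sup>x)\<close> in the
  formal text. For the average \<open>w\<close> of \<open>v\<close> over \<open>K\<close> this bounds \<open>\<parallel>A\<^sup>m w\<parallel>\<^sup>2 = \<langle>A\<^sup>2\<^sup>m w, v\<rangle>\<close>, and the spectral radius argument for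
  self-adjoint operators gives \<open>\<parallel>A w\<parallel> \<le> \<gamma>(1/s) \<parallel>w\<parallel>\<close>. This inequality has no constant, so it passes to all invariant
  vectors by density, in particular to \<open>u\<close>. For a spherical representation \<open>\<langle>A u, u\<rangle>\<close> is the
  eigenvalue \<open>\<plusminus>\<gamma>(Re z)\<close>, and since \<open>\<gamma>\<close> is strictly decreasing on \<open>[0, 1/2]\<close>, the bound \<open>\<gamma>(Re z) \<le> \<gamma>(1/s)\<close> for all \<open>s > p\<close>
  means \<open>Re z \<ge> 1/p\<close>. The other bound \<open>Re z \<le> 1/p'\<close> holds throughout the parameter set.

  The second part only asks for some representation of each exponent, and so it needs a function with the decay
  of the spherical function of parameter \<open>1/p\<close> that is visibly positive definite. The function \<open>r\<^sup>n\<close> with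
  \<open>r = q\<^sup>-\<^sup>1\<^sup>/\<^sup>p\<close> is the reproducing kernel of a Dirichlet space of functions on the vertices
  (\<open>dform_change_base\<close>, \<open>inner_kern_base\<close>), on which \<open>H\<close> acts unitarily because its norm does not depend on the base vertex.
  It is not an eigenfunction of averaging, but its iterated averages still grow like \<open>\<gamma>(1/p)\<^sup>m\<close>
  (\<open>avg_power_exponential_lower\<close>), and the two arguments above apply to the induced representation. Finally, equivalent
  representations are integrable with the same exponents, so different values of \<open>p\<close> give inequivalent representations.
\<close>

section \<open>Hilbert spaces given by a carrier and an inner product\<close>

lemma scaleC_zero_left [simp]: "0 *\<^sub>C x = (0 :: 'v::complex_vector)"
proof -
  have "0 *\<^sub>C x = 0 *\<^sub>C x + 0 *\<^sub>C x"
    using scaleC_add_left[of 0 0 x] by simp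
  then show ?thesis by simp
qed

lemma scaleC_zero_right [simp]: "a *\<^sub>C (0 :: 'v::complex_vector) = 0"
proof -
  have "a *\<^sub>C (0 :: 'v) = a *\<^sub>C 0 + a *\<^sub>C 0"
    using scaleC_add_right[of a "0 :: 'v" 0] by simp
  then show ?thesis by simp
qed

lemma scaleC_minus_one: "(-1) *\<^sub>C x = - (x :: 'v::complex_vector)"
proof -
  have "(-1) *\<^sub>C x + x = 0"
    using scaleC_add_left[of "-1" 1 x] by (simp add: scaleC_one)
  then show ?thesis by (simp add: eq_neg_iff_add_eq_0)
qed

lemma csubspace_diff: "csubspace W \<Longrightarrow> x \<in> W \<Longrightarrow> y \<in> W \<Longrightarrow> x - y \<in> W"
  unfolding csubspace_def by (metis scaleC_minus_one diff_conv_add_uminus)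

lemma csubspace_sum:
  assumes "csubspace W" "\<And>i. i \<in> I \<Longrightarrow> x i \<in> W"
  shows "sum x I \<in> W"
  using assms by (induction I rule: infinite_finite_induct) (auto simp: csubspace_def)

definition cspan :: "'v::complex_vector set \<Rightarrow> 'v set" where
  "cspan S = \<Inter>{W. csubspace W \<and> S \<subseteq> W}"

lemma csubspace_cspan: "csubspace (cspan S)"
  unfolding cspan_def csubspace_def by blast

lemma cspan_superset: "S \<subseteq> cspan S"
  unfolding cspan_def by blast

lemma cspan_minimal: "csubspace W \<Longrightarrow> S \<subseteq> W \<Longrightarrow> cspan S \<subseteq> W"
  unfolding cspan_def by blast

locale prehilbert =
  fixes V :: "'v::complex_vector hspace"
  assumes csubspace_carrier: "csubspace (hcarrier V)"
    and inner_add_left: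
      "u \<in> hcarrier V \<Longrightarrow> v \<in> hcarrier V \<Longrightarrow> w \<in> hcarrier V \<Longrightarrow>
        hinner V (u + v) w = hinner V u w + hinner V v w"
    and inner_scale_left:
      "v \<in> hcarrier V \<Longrightarrow> w \<in> hcarrier V \<Longrightarrow> hinner V (a *\<^sub>C v) w = a * hinner V v w"
    and inner_commute:
      "v \<in> hcarrier V \<Longrightarrow> w \<in> hcarrier V \<Longrightarrow> hinner V w v = cnj (hinner V v w)"
    and inner_pos: "v \<in> hcarrier V \<Longrightarrow> v \<noteq> 0 \<Longrightarrow> 0 < Re (hinner V v v)"
begin

lemma zero_mem [simp]: "0 \<in> hcarrier V"
  and add_mem [simp]: "u \<in> hcarrier V \<Longrightarrow> v \<in> hcarrier V \<Longrightarrow> u + v \<in> hcarrier V"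
  and scale_mem [simp]: "u \<in> hcarrier V \<Longrightarrow> a *\<^sub>C u \<in> hcarrier V"
  using csubspace_carrier by (auto simp: csubspace_def)

lemma diff_mem [simp]: "u \<in> hcarrier V \<Longrightarrow> v \<in> hcarrier V \<Longrightarrow> u - v \<in> hcarrier V"
  using csubspace_diff[OF csubspace_carrier] .

lemma sum_mem [simp]: "(\<And>i. i \<in> I \<Longrightarrow> x i \<in> hcarrier V) \<Longrightarrow> sum x I \<in> hcarrier V"
  using csubspace_sum[OF csubspace_carrier] .

lemma inner_zero_left [simp]: "w \<in> hcarrier V \<Longrightarrow> hinner V 0 w = 0"
  using inner_scale_left[of 0 w 0] by simp

lemma inner_zero_right [simp]: "w \<in> hcarrier V \<Longrightarrow> hinner V w 0 = 0"
  using inner_commute[of 0 w] by simp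

lemma inner_diff_left:
  "u \<in> hcarrier V \<Longrightarrow> v \<in> hcarrier V \<Longrightarrow> w \<in> hcarrier V \<Longrightarrow>
    hinner V (u - v) w = hinner V u w - hinner V v w"
  using inner_add_left[of "u - v" v w] by simp

lemma inner_add_right:
  "u \<in> hcarrier V \<Longrightarrow> v \<in> hcarrier V \<Longrightarrow> w \<in> hcarrier V \<Longrightarrow>
    hinner V w (u + v) = hinner V w u + hinner V w v"
  by (simp add: inner_commute[of _ w] inner_add_left)

lemma inner_diff_right:
  "u \<in> hcarrier V \<Longrightarrow> v \<in> hcarrier V \<Longrightarrow> w \<in> hcarrier V \<Longrightarrow>
    hinner V w (u - v) = hinner V w u - hinner V w v"
  by (simp add: inner_commute[of _ w] inner_diff_left)

lemma inner_scale_right: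
  "v \<in> hcarrier V \<Longrightarrow> w \<in> hcarrier V \<Longrightarrow> hinner V w (a *\<^sub>C v) = cnj a * hinner V w v"
  by (simp add: inner_commute[of _ w] inner_scale_left)

lemma inner_sum_left:
  "(\<And>i. i \<in> I \<Longrightarrow> x i \<in> hcarrier V) \<Longrightarrow> w \<in> hcarrier V \<Longrightarrow>
    hinner V (sum x I) w = (\<Sum>i\<in>I. hinner V (x i) w)"
  by (induction I rule: infinite_finite_induct) (auto simp: inner_add_left)

lemma Re_inner_nonneg: "v \<in> hcarrier V \<Longrightarrow> 0 \<le> Re (hinner V v v)"
  by (cases "v = 0") (auto dest: inner_pos)

lemma norm_nonneg [simp]: "v \<in> hcarrier V \<Longrightarrow> 0 \<le> hnorm V v"
  by (simp add: hnorm_def Re_inner_nonneg)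

lemma norm_zero [simp]: "hnorm V 0 = 0"
  by (simp add: hnorm_def)

lemma norm_square: "v \<in> hcarrier V \<Longrightarrow> (hnorm V v)\<^sup>2 = Re (hinner V v v)"
  by (simp add: hnorm_def Re_inner_nonneg)

lemma inner_self: "v \<in> hcarrier V \<Longrightarrow> hinner V v v = complex_of_real ((hnorm V v)\<^sup>2)"
proof -
  assume v: "v \<in> hcarrier V"
  have "Im (hinner V v v) = - Im (hinner V v v)"
    using arg_cong[OF inner_commute[OF v v], of Im] by (simp only: cnj.sel)
  then show ?thesis using v by (simp add: norm_square complex_eq_iff)
qed

lemma norm_eq_zero [simp]: "v \<in> hcarrier V \<Longrightarrow> hnorm V v = 0 \<longleftrightarrow> v = 0"
  using inner_pos[of v] norm_square[of v] by fastforce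

lemma norm_pos: "v \<in> hcarrier V \<Longrightarrow> v \<noteq> 0 \<Longrightarrow> 0 < hnorm V v"
  using norm_eq_zero[of v] norm_nonneg[of v] by linarith

lemma norm_scale: "v \<in> hcarrier V \<Longrightarrow> hnorm V (a *\<^sub>C v) = cmod a * hnorm V v"
proof -
  assume v: "v \<in> hcarrier V"
  have "(hnorm V (a *\<^sub>C v))\<^sup>2 = Re (a * cnj a * hinner V v v)"
    using v by (simp add: norm_square inner_scale_left inner_scale_right algebra_simps)
  also have "\<dots> = (cmod a * hnorm V v)\<^sup>2"
    using v by (simp add: inner_self complex_norm_square[symmetric] power_mult_distrib)
  finally show ?thesis
    using v by (intro power2_eq_imp_eq[of "hnorm V (a *\<^sub>C v)"]) simp_all
qed

lemma Cauchy_Schwarz: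
  assumes v: "v \<in> hcarrier V" and w: "w \<in> hcarrier V"
  shows "cmod (hinner V v w) \<le> hnorm V v * hnorm V w"
proof (cases "w = 0")
  case True
  then show ?thesis using v by simp
next
  case False
  define b where "b = (hnorm V w)\<^sup>2"
  have b: "b > 0" "hinner V w w = complex_of_real b"
    using False w norm_pos[of w] by (simp_all add: b_def inner_self)
  define a where "a = hinner V v w"
  have ba: "hinner V w v = cnj a"
    using v w by (simp add: a_def inner_commute[of v w])
  define x where "x = of_real b *\<^sub>C v - a *\<^sub>C w"
  have x: "x \<in> hcarrier V" using v w by (simp add: x_def)
  have "hinner V x x =
      of_real b * of_real b * hinner V v v - of_real b * (a * cnj a)"
    using v w unfolding x_def
    by (simp add: inner_diff_left inner_diff_right inner_scale_left inner_scale_right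
        ba a_def[symmetric] b(2) algebra_simps)
  also have "\<dots> = of_real (b * (b * (hnorm V v)\<^sup>2 - (cmod a)\<^sup>2))"
    using v by (simp add: inner_self complex_norm_square[symmetric] algebra_simps)
  finally have "0 \<le> b * (b * (hnorm V v)\<^sup>2 - (cmod a)\<^sup>2)"
    using Re_inner_nonneg[OF x] by simp
  then have "(cmod a)\<^sup>2 \<le> (hnorm V v * hnorm V w)\<^sup>2"
    using b(1) by (simp add: zero_le_mult_iff b_def power_mult_distrib mult.commute)
  then show ?thesis
    unfolding a_def using v w by (intro power2_le_imp_le[of "cmod (hinner V v w)"]) simp_all
qed

lemma norm_triangle:
  assumes v: "v \<in> hcarrier V" and w: "w \<in> hcarrier V"
  shows "hnorm V (v + w) \<le> hnorm V v + hnorm V w"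
proof -
  have "(hnorm V (v + w))\<^sup>2 = (hnorm V v)\<^sup>2 + (hnorm V w)\<^sup>2 + 2 * Re (hinner V v w)"
    using v w inner_commute[of v w]
    by (simp add: norm_square inner_add_left inner_add_right)
  also have "\<dots> \<le> (hnorm V v + hnorm V w)\<^sup>2"
    using Cauchy_Schwarz[OF v w] complex_Re_le_cmod[of "hinner V v w"]
    by (simp add: power2_sum)
  finally show ?thesis
    using v w by (intro power2_le_imp_le[of "hnorm V (v + w)"]) simp_all
qed

lemma norm_minus_commute:
  "v \<in> hcarrier V \<Longrightarrow> w \<in> hcarrier V \<Longrightarrow> hnorm V (v - w) = hnorm V (w - v)"
  using norm_scale[of "w - v" "-1"] by (simp add: scaleC_minus_one)

lemma norm_diff_triangle:
  "u \<in> hcarrier V \<Longrightarrow> v \<in> hcarrier V \<Longrightarrow> w \<in> hcarrier V \<Longrightarrow>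
    hnorm V (u - w) \<le> hnorm V (u - v) + hnorm V (v - w)"
  using norm_triangle[of "u - v" "v - w"] by simp

lemma norm_sum_le:
  "(\<And>i. i \<in> I \<Longrightarrow> x i \<in> hcarrier V) \<Longrightarrow> hnorm V (sum x I) \<le> (\<Sum>i\<in>I. hnorm V (x i))"
proof (induction I rule: infinite_finite_induct)
  case (insert i I)
  then have "hnorm V (x i + sum x I) \<le> hnorm V (x i) + hnorm V (sum x I)"
    by (intro norm_triangle) auto
  with insert show ?case by force
qed auto

lemma norm_le_of_inner_le:
  assumes v: "v \<in> hcarrier V" and c: "0 \<le> c"
    and le: "\<And>w. w \<in> hcarrier V \<Longrightarrow> cmod (hinner V v w) \<le> c * hnorm V w"
  shows "hnorm V v \<le> c"
proof (cases "v = 0")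
  case False
  then have pos: "0 < hnorm V v" using norm_pos v by blast
  have "(hnorm V v)\<^sup>2 \<le> c * hnorm V v"
    using le[OF v] v by (simp add: inner_self norm_power)
  then show ?thesis using pos by (simp add: power2_eq_square)
qed (use c in simp)

lemma vector_eqI:
  assumes "u \<in> hcarrier V" "v \<in> hcarrier V" "\<And>w. w \<in> hcarrier V \<Longrightarrow> hinner V u w = hinner V v w"
  shows "u = v"
proof -
  have "hnorm V (u - v) \<le> 0"
    using assms by (intro norm_le_of_inner_le) (auto simp: inner_diff_left)
  then have "hnorm V (u - v) = 0" using assms norm_nonneg[of "u - v"] by (simp add: antisym)
  then show ?thesis using assms by simp
qed

text \<open>The metric and topological notions of the carrier, in terms of the norm.\<close>

lemma Metric_space_hdist: "Metric_space (hcarrier V) (hdist V)"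
proof
  show "0 \<le> hdist V x y" "hdist V x y = hdist V y x" for x y
    by (simp_all add: hdist_def norm_minus_commute)
qed (auto simp: hdist_def norm_diff_triangle)

text \<open>
  Completeness in terms of norms of differences, so that sequences in the carrier can be handled without the
  abstract metric.
\<close>

lemma mcomplete_iff:
  "Metric_space.mcomplete (hcarrier V) (hdist V) \<longleftrightarrow>
    (\<forall>\<sigma>. (\<forall>n::nat. \<sigma> n \<in> hcarrier V) \<and>
       (\<forall>\<epsilon>>0. \<exists>N. \<forall>m\<ge>N. \<forall>n\<ge>N. hnorm V (\<sigma> m - \<sigma> n) < \<epsilon>) \<longrightarrow>
       (\<exists>x\<in>hcarrier V. \<forall>\<epsilon>>0. \<exists>N. \<forall>n\<ge>N. hnorm V (\<sigma> n - x) < \<epsilon>))"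
proof -
  interpret Metric_space "hcarrier V" "hdist V" by (rule Metric_space_hdist)
  have C: "MCauchy \<sigma> \<longleftrightarrow> (\<forall>n. \<sigma> n \<in> hcarrier V) \<and>
       (\<forall>\<epsilon>>0. \<exists>N. \<forall>m\<ge>N. \<forall>n\<ge>N. hnorm V (\<sigma> m - \<sigma> n) < \<epsilon>)" for \<sigma>
    unfolding MCauchy_def hdist_def by (simp add: image_subset_iff) (meson order_refl)
  have L: "limitin mtopology \<sigma> x sequentially \<longleftrightarrow>
      x \<in> hcarrier V \<and> (\<forall>\<epsilon>>0. \<exists>N. \<forall>n\<ge>N. hnorm V (\<sigma> n - x) < \<epsilon>)"
    if "\<forall>n. \<sigma> n \<in> hcarrier V" for \<sigma> x
    unfolding limit_metric_sequentially using that by (auto simp: hdist_def)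
  have "(MCauchy \<sigma> \<longrightarrow> (\<exists>x. limitin mtopology \<sigma> x sequentially)) \<longleftrightarrow>
      (\<forall>n::nat. \<sigma> n \<in> hcarrier V) \<and>
       (\<forall>\<epsilon>>0. \<exists>N. \<forall>m\<ge>N. \<forall>n\<ge>N. hnorm V (\<sigma> m - \<sigma> n) < \<epsilon>) \<longrightarrow>
       (\<exists>x\<in>hcarrier V. \<forall>\<epsilon>>0. \<exists>N. \<forall>n\<ge>N. hnorm V (\<sigma> n - x) < \<epsilon>)" for \<sigma>
    by (cases "\<forall>n. \<sigma> n \<in> hcarrier V") (simp_all only: C L Bex_def simp_thms)
  then show ?thesis
    unfolding mcomplete_def by (simp only:)
qed

lemma closure_of_iff:
  assumes "W \<subseteq> hcarrier V"
  shows "htopology V closure_of W = {x \<in> hcarrier V. \<forall>\<epsilon>>0. \<exists>y\<in>W. hnorm V (x - y) < \<epsilon>}"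
proof -
  interpret Metric_space "hcarrier V" "hdist V" by (rule Metric_space_hdist)
  show ?thesis
    unfolding htopology_def metric_closure_of using assms
    by (force simp: in_mball hdist_def)
qed

lemma continuous_map_iff:
  "continuous_map T (htopology V) \<phi> \<longleftrightarrow>
    (\<forall>g\<in>topspace T. \<phi> g \<in> hcarrier V) \<and>
    (\<forall>g\<in>topspace T. \<forall>\<epsilon>>0. \<exists>U. openin T U \<and> g \<in> U \<and> (\<forall>g'\<in>U. hnorm V (\<phi> g' - \<phi> g) < \<epsilon>))"
  (is "?l \<longleftrightarrow> ?r")
proof -
  interpret Metric_space "hcarrier V" "hdist V" by (rule Metric_space_hdist)
  have top: "htopology V = mtopology" by (simp add: htopology_def)
  show ?thesis
  proof
    assume l: ?l
    then have c: "\<forall>g\<in>topspace T. \<phi> g \<in> hcarrier V"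
      using continuous_map_image_subset_topspace[OF l] by (simp add: image_subset_iff top)
    moreover have "\<exists>U. openin T U \<and> g \<in> U \<and> (\<forall>g'\<in>U. hnorm V (\<phi> g' - \<phi> g) < \<epsilon>)"
      if g: "g \<in> topspace T" "\<epsilon> > 0" for g \<epsilon>
    proof -
      obtain U where U: "openin T U" "g \<in> U" "\<forall>y\<in>U. \<phi> y \<in> mball (\<phi> g) \<epsilon>"
        using l[unfolded top continuous_map_to_metric, rule_format, OF g] by (elim exE conjE)
      have "hnorm V (\<phi> g' - \<phi> g) < \<epsilon>" if "g' \<in> U" for g'
      proof -
        have "\<phi> g' \<in> mball (\<phi> g) \<epsilon>" using U that by blast
        then show ?thesis using norm_minus_commute[of "\<phi> g" "\<phi> g'"] by (auto simp: in_mball hdist_def)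
      qed
      with U show ?thesis by blast
    qed
    ultimately show ?r by blast
  next
    assume r: ?r
    show ?l unfolding top continuous_map_to_metric
    proof (intro ballI allI impI)
      fix g and \<epsilon> :: real assume g: "g \<in> topspace T" "\<epsilon> > 0"
      obtain U where U: "openin T U" "g \<in> U" "\<forall>g'\<in>U. hnorm V (\<phi> g' - \<phi> g) < \<epsilon>"
        using r[THEN conjunct2, rule_format, OF g] by (elim exE conjE)
      have "\<phi> y \<in> mball (\<phi> g) \<epsilon>" if "y \<in> U" for y
      proof -
        have "\<phi> y \<in> hcarrier V" "\<phi> g \<in> hcarrier V" "hnorm V (\<phi> y - \<phi> g) < \<epsilon>"
          using U(3) that r[THEN conjunct1] g(1) openin_subset[OF U(1)] by auto
        then show ?thesis using norm_minus_commute[of "\<phi> g" "\<phi> y"] by (simp add: in_mball hdist_def)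
      qed
      with U show "\<exists>U. openin T U \<and> g \<in> U \<and> (\<forall>y\<in>U. \<phi> y \<in> mball (\<phi> g) \<epsilon>)" by blast
    qed
  qed
qed

lemma topspace_htopology: "topspace (htopology V) = hcarrier V"
  unfolding htopology_def by (rule Metric_space.topspace_mtopology[OF Metric_space_hdist])

lemma closure_of_eq_carrier_iff:
  assumes "W \<subseteq> hcarrier V"
  shows "htopology V closure_of W = hcarrier V \<longleftrightarrow>
    (\<forall>x\<in>hcarrier V. \<forall>\<epsilon>>0. \<exists>y\<in>W. hnorm V (x - y) < \<epsilon>)"
  unfolding closure_of_iff[OF assms] by blast

lemma closure_of_approx:
  assumes "W \<subseteq> hcarrier V" "x \<in> htopology V closure_of W" "\<epsilon> > 0"
  shows "\<exists>y\<in>W. hnorm V (x - y) < \<epsilon>"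
  using assms(2,3) unfolding closure_of_iff[OF assms(1)] by simp

text \<open>The vector space operations are continuous.\<close>

lemma closure_of_csubspace:
  assumes W: "csubspace W" "W \<subseteq> hcarrier V"
  shows "csubspace (htopology V closure_of W)"
  unfolding csubspace_def
proof (intro conjI ballI allI)
  note iff = closure_of_iff[OF W(2)]
  have W0: "0 \<in> W" and Wadd: "\<And>x y. x \<in> W \<Longrightarrow> y \<in> W \<Longrightarrow> x + y \<in> W"
    and Wsc: "\<And>a x. x \<in> W \<Longrightarrow> a *\<^sub>C x \<in> W" using W(1) by (auto simp: csubspace_def)
  show "0 \<in> htopology V closure_of W"
    unfolding iff using W0 by (auto intro!: bexI[of _ 0])
  show "x + y \<in> htopology V closure_of W"
    if xy: "x \<in> htopology V closure_of W" "y \<in> htopology V closure_of W" for x y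
    unfolding iff
  proof (intro CollectI conjI allI impI)
    fix \<epsilon> :: real assume e: "\<epsilon> > 0"
    obtain x' where x': "x' \<in> W" "hnorm V (x - x') < \<epsilon> / 2"
      using closure_of_approx[OF W(2) xy(1), of "\<epsilon> / 2"] e by auto
    obtain y' where y': "y' \<in> W" "hnorm V (y - y') < \<epsilon> / 2"
      using closure_of_approx[OF W(2) xy(2), of "\<epsilon> / 2"] e by auto
    have c: "x \<in> hcarrier V" "y \<in> hcarrier V" "x' \<in> hcarrier V" "y' \<in> hcarrier V"
      using xy x' y' W unfolding iff by auto
    have "hnorm V ((x + y) - (x' + y')) = hnorm V ((x - x') + (y - y'))"
      by (simp add: algebra_simps)
    also have "\<dots> < \<epsilon>"
      using norm_triangle[of "x - x'" "y - y'"] c x' y' by simp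
    finally show "\<exists>z\<in>W. hnorm V (x + y - z) < \<epsilon>" using x' y' Wadd by blast
  qed (use xy iff in auto)
  show "a *\<^sub>C x \<in> htopology V closure_of W" if x: "x \<in> htopology V closure_of W" for a x
    unfolding iff
  proof (intro CollectI conjI allI impI)
    fix \<epsilon> :: real assume e: "\<epsilon> > 0"
    then have e': "\<epsilon> / (cmod a + 1) > 0" by (simp add: add_nonneg_pos)
    then obtain x' where x': "x' \<in> W" "hnorm V (x - x') < \<epsilon> / (cmod a + 1)"
      using closure_of_approx[OF W(2) x e'] by blast
    have c: "x \<in> hcarrier V" "x' \<in> hcarrier V" using x x' W unfolding iff by auto
    have "a *\<^sub>C x - a *\<^sub>C x' = a *\<^sub>C (x - x')"
      using scaleC_add_right[of a "x - x'" x'] by simp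
    then have "hnorm V (a *\<^sub>C x - a *\<^sub>C x') = cmod a * hnorm V (x - x')"
      using c by (simp add: norm_scale)
    also have "\<dots> \<le> (cmod a) * (\<epsilon> / (cmod a + 1))"
      using x' by (intro mult_left_mono) auto
    also have "\<dots> < (cmod a + 1) * (\<epsilon> / (cmod a + 1))"
      using e' by (intro mult_strict_right_mono) auto
    also have "\<dots> = \<epsilon>"
      by (metis add.commute add_cancel_right_left add_nonneg_eq_0_iff nonzero_mult_div_cancel_left
          norm_ge_zero times_divide_eq_right zero_le_one zero_neq_one)
    finally show "\<exists>z\<in>W. hnorm V (a *\<^sub>C x - z) < \<epsilon>" using x' Wsc by blast
  qed (use x iff in auto)
qed

end

locale hilbert = prehilbert +
  assumes complete: "Metric_space.mcomplete (hcarrier V) (hdist V)"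
begin

lemma Cauchy_converges:
  assumes "\<And>n::nat. \<sigma> n \<in> hcarrier V"
    and "\<And>\<epsilon>. \<epsilon> > 0 \<Longrightarrow> \<exists>N. \<forall>m\<ge>N. \<forall>n\<ge>N. hnorm V (\<sigma> m - \<sigma> n) < \<epsilon>"
  obtains x where "x \<in> hcarrier V" "\<And>\<epsilon>. \<epsilon> > 0 \<Longrightarrow> \<exists>N. \<forall>n\<ge>N. hnorm V (\<sigma> n - x) < \<epsilon>"
proof -
  have "\<exists>x\<in>hcarrier V. \<forall>\<epsilon>>0. \<exists>N. \<forall>n\<ge>N. hnorm V (\<sigma> n - x) < \<epsilon>"
    by (rule complete[unfolded mcomplete_iff, THEN spec, of \<sigma>, THEN mp]) (use assms in simp)
  then show ?thesis using that by auto
qed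

end

lemma hilbert_space_iff: "hilbert_space V \<longleftrightarrow> hilbert V"
proof
  assume h: "hilbert_space V"
  show "hilbert V"
    by unfold_locales (use h[unfolded hilbert_space_def] in blast)+
next
  assume "hilbert V"
  then interpret hilbert V .
  show "hilbert_space V"
    unfolding hilbert_space_def
    by (intro conjI ballI allI impI csubspace_carrier inner_add_left inner_scale_left inner_commute
        inner_pos complete)
qed


subsection \<open>Square-summable families of coordinates\<close>

text \<open>
  Both the induced representation space and the Dirichlet space of a tree are cut out of a vector
  space of functions by square-summability of coordinates with values in a Hilbert space. Such a
  space is complete because a limit can be taken in each coordinate, provided that every family
  of coordinates comes from a vector.
\<close>

locale coordinates = V: hilbert V
  for V :: "'v::complex_vector hspace" +
  fixes X :: "'i set" and W :: "'w::complex_vector set" and c :: "'i \<Rightarrow> 'w \<Rightarrow> 'v"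
  assumes csubspace_ambient: "csubspace W"
    and coord_mem: "f \<in> W \<Longrightarrow> i \<in> X \<Longrightarrow> c i f \<in> hcarrier V"
    and coord_add: "f \<in> W \<Longrightarrow> g \<in> W \<Longrightarrow> i \<in> X \<Longrightarrow> c i (f + g) = c i f + c i g"
    and coord_scale: "f \<in> W \<Longrightarrow> i \<in> X \<Longrightarrow> c i (a *\<^sub>C f) = a *\<^sub>C c i f"
    and coord_separate: "f \<in> W \<Longrightarrow> (\<And>i. i \<in> X \<Longrightarrow> c i f = 0) \<Longrightarrow> f = 0"
    and coord_realise: "(\<And>i. i \<in> X \<Longrightarrow> x i \<in> hcarrier V) \<Longrightarrow> \<exists>f\<in>W. \<forall>i\<in>X. c i f = x i"
begin

definition E :: "'w hspace" where
  "E = \<lparr>hcarrier = {f \<in> W. (\<lambda>i. (hnorm V (c i f))\<^sup>2) summable_on X},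
        hinner = (\<lambda>f g. \<Sum>\<^sub>\<infinity>i\<in>X. hinner V (c i f) (c i g))\<rparr>"

lemma mem_E: "f \<in> hcarrier E \<longleftrightarrow> f \<in> W \<and> (\<lambda>i. (hnorm V (c i f))\<^sup>2) summable_on X"
  by (simp add: E_def)

lemma inner_E: "hinner E f g = (\<Sum>\<^sub>\<infinity>i\<in>X. hinner V (c i f) (c i g))"
  by (simp add: E_def)

lemma W_add: "f \<in> W \<Longrightarrow> g \<in> W \<Longrightarrow> f + g \<in> W"
  and W_scale: "f \<in> W \<Longrightarrow> a *\<^sub>C f \<in> W"
  and W_diff: "f \<in> W \<Longrightarrow> g \<in> W \<Longrightarrow> f - g \<in> W"
  using csubspace_ambient csubspace_diff by (auto simp: csubspace_def)

lemma coord_zero: "i \<in> X \<Longrightarrow> c i 0 = 0"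
  using coord_scale[of 0 i 0] csubspace_ambient by (simp add: csubspace_def)

lemma coord_diff: "f \<in> W \<Longrightarrow> g \<in> W \<Longrightarrow> i \<in> X \<Longrightarrow> c i (f - g) = c i f - c i g"
  using coord_add[of "f - g" g i] W_diff by simp

lemma parallelogram_bound:
  assumes "u \<in> hcarrier V" "v \<in> hcarrier V"
  shows "(hnorm V (u + v))\<^sup>2 \<le> 2 * (hnorm V u)\<^sup>2 + 2 * (hnorm V v)\<^sup>2"
proof -
  have "(hnorm V (u + v))\<^sup>2 \<le> (hnorm V u + hnorm V v)\<^sup>2"
    using assms by (intro power_mono V.norm_triangle) auto
  then show ?thesis
    using sum_squares_bound[of "hnorm V u" "hnorm V v"] by (simp add: power2_sum)
qed

lemma csubspace_E: "csubspace (hcarrier E)"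
  unfolding csubspace_def
proof (intro conjI ballI allI)
  show "0 \<in> hcarrier E"
    using csubspace_ambient summable_on_cong[of X "\<lambda>i. (hnorm V (c i 0))\<^sup>2" "\<lambda>_. 0"]
    by (auto simp: mem_E csubspace_def coord_zero)
next
  fix f g assume f: "f \<in> hcarrier E" and g: "g \<in> hcarrier E"
  have "(\<lambda>i. (hnorm V (c i (f + g)))\<^sup>2) summable_on X"
  proof (rule summable_on_comparison_test)
    show "(\<lambda>i. 2 * (hnorm V (c i f))\<^sup>2 + 2 * (hnorm V (c i g))\<^sup>2) summable_on X"
      using f g by (intro summable_on_add summable_on_cmult_right) (auto simp: mem_E)
  qed (use f g in \<open>auto simp: mem_E coord_add coord_mem parallelogram_bound\<close>)
  then show "f + g \<in> hcarrier E" using f g by (simp add: mem_E W_add)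
next
  fix a f assume f: "f \<in> hcarrier E"
  then have "(\<lambda>i. (cmod a)\<^sup>2 * (hnorm V (c i f))\<^sup>2) summable_on X"
    by (intro summable_on_cmult_right) (auto simp: mem_E)
  then have "(\<lambda>i. (hnorm V (c i (a *\<^sub>C f)))\<^sup>2) summable_on X"
    using f by (subst summable_on_cong[of X _ "\<lambda>i. (cmod a)\<^sup>2 * (hnorm V (c i f))\<^sup>2"])
      (auto simp: mem_E coord_scale coord_mem V.norm_scale power_mult_distrib)
  then show "a *\<^sub>C f \<in> hcarrier E" using f by (simp add: mem_E W_scale)
qed

lemma inner_summable:
  assumes f: "f \<in> hcarrier E" and g: "g \<in> hcarrier E"
  shows "(\<lambda>i. hinner V (c i f) (c i g)) summable_on X"
proof (rule Infinite_Sum.abs_summable_summable, rule Infinite_Sum.abs_summable_on_comparison_test')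
  show "(\<lambda>i. (hnorm V (c i f))\<^sup>2 + (hnorm V (c i g))\<^sup>2) summable_on X"
    using f g by (intro summable_on_add) (auto simp: mem_E)
  show "cmod (hinner V (c i f) (c i g)) \<le> (hnorm V (c i f))\<^sup>2 + (hnorm V (c i g))\<^sup>2" if "i \<in> X" for i
  proof -
    have "cmod (hinner V (c i f) (c i g)) \<le> hnorm V (c i f) * hnorm V (c i g)"
      using f g that by (intro V.Cauchy_Schwarz) (auto simp: mem_E coord_mem)
    moreover have "0 \<le> (hnorm V (c i f))\<^sup>2 + (hnorm V (c i g))\<^sup>2" by simp
    ultimately show ?thesis
      using sum_squares_bound[of "hnorm V (c i f)" "hnorm V (c i g)"] by linarith
  qed
qed

lemma Re_inner_self:
  assumes f: "f \<in> hcarrier E"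
  shows "Re (hinner E f f) = (\<Sum>\<^sub>\<infinity>i\<in>X. (hnorm V (c i f))\<^sup>2)"
proof -
  have "Re (hinner E f f) = (\<Sum>\<^sub>\<infinity>i\<in>X. Re (hinner V (c i f) (c i f)))"
    unfolding inner_E using infsum_Re[OF inner_summable[OF f f]] by simp
  also have "\<dots> = (\<Sum>\<^sub>\<infinity>i\<in>X. (hnorm V (c i f))\<^sup>2)"
    using f by (intro infsum_cong) (auto simp: V.norm_square coord_mem mem_E)
  finally show ?thesis .
qed

lemma prehilbert_E: "prehilbert E"
proof
  show "csubspace (hcarrier E)" by (rule csubspace_E)
next
  fix u v w assume "u \<in> hcarrier E" "v \<in> hcarrier E" "w \<in> hcarrier E"
  then show "hinner E (u + v) w = hinner E u w + hinner E v w"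
    unfolding inner_E
    by (subst infsum_add[symmetric])
      (auto intro!: infsum_cong inner_summable simp: mem_E coord_add coord_mem V.inner_add_left)
next
  fix a v w assume "v \<in> hcarrier E" "w \<in> hcarrier E"
  then show "hinner E (a *\<^sub>C v) w = a * hinner E v w"
    unfolding inner_E
    by (subst infsum_cmult_right[symmetric])
      (auto intro!: infsum_cong inner_summable simp: mem_E coord_scale coord_mem V.inner_scale_left)
next
  fix v w assume "v \<in> hcarrier E" "w \<in> hcarrier E"
  then show "hinner E w v = cnj (hinner E v w)"
    unfolding inner_E infsum_cnj[symmetric]
    by (intro infsum_cong V.inner_commute) (auto simp: mem_E coord_mem)
next
  fix v assume v: "v \<in> hcarrier E" "v \<noteq> 0"
  then obtain i where i: "i \<in> X" "c i v \<noteq> 0" using coord_separate by (auto simp: mem_E)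
  have "0 < (hnorm V (c i v))\<^sup>2"
    using i v V.norm_pos[of "c i v"] by (auto simp: mem_E coord_mem)
  also have "\<dots> = (\<Sum>i\<in>{i}. (hnorm V (c i v))\<^sup>2)" by simp
  also have "\<dots> \<le> (\<Sum>\<^sub>\<infinity>i\<in>X. (hnorm V (c i v))\<^sup>2)"
    using i v by (intro finite_sum_le_infsum) (auto simp: mem_E)
  finally show "0 < Re (hinner E v v)" using v by (simp add: Re_inner_self)
qed

sublocale E: prehilbert E by (rule prehilbert_E)

lemma norm_square_E: "f \<in> hcarrier E \<Longrightarrow> (hnorm E f)\<^sup>2 = (\<Sum>\<^sub>\<infinity>i\<in>X. (hnorm V (c i f))\<^sup>2)"
  by (simp add: E.norm_square Re_inner_self)

lemma finite_sum_le_norm_square: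
  "f \<in> hcarrier E \<Longrightarrow> finite I \<Longrightarrow> I \<subseteq> X \<Longrightarrow> (\<Sum>i\<in>I. (hnorm V (c i f))\<^sup>2) \<le> (hnorm E f)\<^sup>2"
  unfolding norm_square_E by (intro finite_sum_le_infsum) (auto simp: mem_E)

lemma coord_norm_le:
  assumes "f \<in> hcarrier E" "i \<in> X" shows "hnorm V (c i f) \<le> hnorm E f"
  using finite_sum_le_norm_square[OF assms(1), of "{i}"] assms
  by (intro power2_le_imp_le[of "hnorm V (c i f)"]) auto

lemma mem_E_if_bounded:
  assumes f: "f \<in> W" and b: "0 \<le> b"
    and le: "\<And>I. finite I \<Longrightarrow> I \<subseteq> X \<Longrightarrow> (\<Sum>i\<in>I. (hnorm V (c i f))\<^sup>2) \<le> b\<^sup>2"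
  shows "f \<in> hcarrier E" "hnorm E f \<le> b"
proof -
  have s: "(\<lambda>i. (hnorm V (c i f))\<^sup>2) summable_on X"
    by (rule nonneg_bdd_above_summable_on) (auto intro!: bdd_aboveI2[of _ _ "b\<^sup>2"] le)
  then show fE: "f \<in> hcarrier E" using f by (simp add: mem_E)
  have "(hnorm E f)\<^sup>2 \<le> b\<^sup>2"
    unfolding norm_square_E[OF fE] using s by (rule infsum_le_finite_sums) (use le in auto)
  then show "hnorm E f \<le> b" by (intro power2_le_imp_le[of "hnorm E f"]) (use b in auto)
qed

text \<open>
  A Cauchy sequence converges in each coordinate; the vector with the limits as coordinates is the limit in norm,
  because finite partial sums of the squared norm pass to the limit.
\<close>

lemma hilbert_E: "hilbert E"
proof (intro hilbert.intro prehilbert_E hilbert_axioms.intro)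
  show "Metric_space.mcomplete (hcarrier E) (hdist E)"
    unfolding E.mcomplete_iff
  proof (intro allI impI, elim conjE)
    fix \<sigma> :: "nat \<Rightarrow> 'w"
    assume mem: "\<forall>n. \<sigma> n \<in> hcarrier E"
      and C: "\<forall>\<epsilon>>0. \<exists>N. \<forall>m\<ge>N. \<forall>n\<ge>N. hnorm E (\<sigma> m - \<sigma> n) < \<epsilon>"
    have W: "\<sigma> n \<in> W" for n using mem by (simp add: mem_E)
    have "\<exists>x. x \<in> hcarrier V \<and> (\<forall>\<epsilon>>0. \<exists>N. \<forall>n\<ge>N. hnorm V (c i (\<sigma> n) - x) < \<epsilon>)" if i: "i \<in> X" for i
    proof -
      obtain x where "x \<in> hcarrier V" "\<And>\<epsilon>. \<epsilon> > 0 \<Longrightarrow> \<exists>N. \<forall>n\<ge>N. hnorm V (c i (\<sigma> n) - x) < \<epsilon>"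
      proof (rule V.Cauchy_converges[of "\<lambda>n. c i (\<sigma> n)"])
        fix \<epsilon> :: real assume "\<epsilon> > 0"
        then obtain N where N: "\<forall>m\<ge>N. \<forall>n\<ge>N. hnorm E (\<sigma> m - \<sigma> n) < \<epsilon>" using C by blast
        have "hnorm V (c i (\<sigma> m) - c i (\<sigma> n)) < \<epsilon>" if "m \<ge> N" "n \<ge> N" for m n
          using coord_norm_le[of "\<sigma> m - \<sigma> n" i] N that mem i W
          by (fastforce simp: coord_diff)
        then show "\<exists>N. \<forall>m\<ge>N. \<forall>n\<ge>N. hnorm V (c i (\<sigma> m) - c i (\<sigma> n)) < \<epsilon>" by blast
      qed (use W i coord_mem in auto)
      then show ?thesis by blast
    qed
    then obtain x where x: "\<And>i. i \<in> X \<Longrightarrow> x i \<in> hcarrier V"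
      "\<And>i \<epsilon>. i \<in> X \<Longrightarrow> \<epsilon> > 0 \<Longrightarrow> \<exists>N. \<forall>n\<ge>N. hnorm V (c i (\<sigma> n) - x i) < \<epsilon>" by metis
    obtain f where f: "f \<in> W" "\<And>i. i \<in> X \<Longrightarrow> c i f = x i" using coord_realise[of x] x(1) by blast
    have lim: "(\<lambda>n. hnorm V (c i (\<sigma> m) - c i (\<sigma> n))) \<longlonglongrightarrow> hnorm V (c i (\<sigma> m - f))" if i: "i \<in> X" for i m
      unfolding LIMSEQ_iff
    proof (intro allI impI)
      fix \<epsilon> :: real assume "\<epsilon> > 0"
      then obtain N where N: "\<forall>n\<ge>N. hnorm V (c i (\<sigma> n) - x i) < \<epsilon>" using x(2) i by blast
      have "norm (hnorm V (c i (\<sigma> m) - c i (\<sigma> n)) - hnorm V (c i (\<sigma> m - f))) < \<epsilon>" if "n \<ge> N" for n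
      proof -
        have cs: "c i (\<sigma> m) \<in> hcarrier V" "c i (\<sigma> n) \<in> hcarrier V" "x i \<in> hcarrier V"
          using W i x(1) coord_mem by auto
        have "hnorm V (c i (\<sigma> n) - x i) < \<epsilon>" using N that by blast
        then show ?thesis
          using V.norm_diff_triangle[OF cs(1,2,3)] V.norm_diff_triangle[OF cs(1,3,2)]
            V.norm_minus_commute[OF cs(2,3)] W f i by (simp add: coord_diff)
      qed
      then show "\<exists>N. \<forall>n\<ge>N. norm (hnorm V (c i (\<sigma> m) - c i (\<sigma> n)) - hnorm V (c i (\<sigma> m - f))) < \<epsilon>"
        by blast
    qed
    have key: "\<exists>N. \<forall>m\<ge>N. \<sigma> m - f \<in> hcarrier E \<and> hnorm E (\<sigma> m - f) \<le> \<epsilon>" if e: "\<epsilon> > 0" for \<epsilon>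
    proof -
      obtain N where N: "\<forall>m\<ge>N. \<forall>n\<ge>N. hnorm E (\<sigma> m - \<sigma> n) < \<epsilon>" using C e by blast
      have "(\<Sum>i\<in>I. (hnorm V (c i (\<sigma> m - f)))\<^sup>2) \<le> \<epsilon>\<^sup>2"
        if m: "m \<ge> N" and I: "finite I" "I \<subseteq> X" for m I
      proof (rule LIMSEQ_le_const2)
        show "(\<lambda>n. \<Sum>i\<in>I. (hnorm V (c i (\<sigma> m) - c i (\<sigma> n)))\<^sup>2) \<longlonglongrightarrow>
          (\<Sum>i\<in>I. (hnorm V (c i (\<sigma> m - f)))\<^sup>2)"
          using I by (intro tendsto_sum tendsto_power lim) auto
        have "(\<Sum>i\<in>I. (hnorm V (c i (\<sigma> m) - c i (\<sigma> n)))\<^sup>2) \<le> \<epsilon>\<^sup>2" if "n \<ge> N" for n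
        proof -
          have "(\<Sum>i\<in>I. (hnorm V (c i (\<sigma> m) - c i (\<sigma> n)))\<^sup>2) = (\<Sum>i\<in>I. (hnorm V (c i (\<sigma> m - \<sigma> n)))\<^sup>2)"
            using I W by (intro sum.cong) (auto simp: coord_diff)
          also have "\<dots> \<le> (hnorm E (\<sigma> m - \<sigma> n))\<^sup>2"
            using mem I by (intro finite_sum_le_norm_square) auto
          also have "\<dots> \<le> \<epsilon>\<^sup>2" using N m that mem by (intro power_mono) (auto simp: less_imp_le)
          finally show ?thesis .
        qed
        then show "\<exists>N. \<forall>n\<ge>N. (\<Sum>i\<in>I. (hnorm V (c i (\<sigma> m) - c i (\<sigma> n)))\<^sup>2) \<le> \<epsilon>\<^sup>2" by blast
      qed
      then show ?thesis
        using mem_E_if_bounded[of "\<sigma> _ - f" \<epsilon>] W f e W_diff by (metis less_imp_le)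
    qed
    obtain m where "\<sigma> m - f \<in> hcarrier E" using key[of 1] by auto
    then have "\<sigma> m - (\<sigma> m - f) \<in> hcarrier E" using mem E.diff_mem by blast
    then have fE: "f \<in> hcarrier E" by simp
    have "\<exists>N. \<forall>n\<ge>N. hnorm E (\<sigma> n - f) < \<epsilon>" if "\<epsilon> > 0" for \<epsilon>
      using key[of "\<epsilon> / 2"] that by force
    with fE show "\<exists>x\<in>hcarrier E. \<forall>\<epsilon>>0. \<exists>N. \<forall>n\<ge>N. hnorm E (\<sigma> n - x) < \<epsilon>" by blast
  qed
qed

text \<open>
  Density statements and continuity statements about such a space only have to be checked on the
  vectors with a single non-zero coordinate.
\<close>

lemma total_single_coordinates:
  assumes S: "csubspace S" "S \<subseteq> hcarrier E"
    and single: "\<And>f j. f \<in> hcarrier E \<Longrightarrow> j \<in> X \<Longrightarrow> (\<And>i. i \<in> X \<Longrightarrow> i \<noteq> j \<Longrightarrow> c i f = 0) \<Longrightarrow>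
      f \<in> htopology E closure_of S"
  shows "htopology E closure_of S = hcarrier E"
proof -
  have cl: "csubspace (htopology E closure_of S)" by (rule E.closure_of_csubspace[OF S])
  have sub: "htopology E closure_of S \<subseteq> hcarrier E"
    unfolding E.closure_of_iff[OF S(2)] by blast
  have "\<exists>y\<in>S. hnorm E (f - y) < \<epsilon>" if f: "f \<in> hcarrier E" and e: "\<epsilon> > 0" for f \<epsilon>
  proof -
    let ?q = "\<lambda>i. (hnorm V (c i f))\<^sup>2"
    have sm: "?q summable_on X" using f by (simp add: mem_E)
    have fW: "f \<in> W" using f by (simp add: mem_E)
    obtain I where I: "finite I" "I \<subseteq> X" "dist (sum ?q I) (infsum ?q X) \<le> (\<epsilon> / 4)\<^sup>2"
      using infsum_finite_approximation[OF sm, of "(\<epsilon> / 4)\<^sup>2"] e by auto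
    have "\<exists>h\<in>W. \<forall>i\<in>X. c i h = (if i = j then c j f else 0)" if "j \<in> X" for j
      using coord_realise[of "\<lambda>i. if i = j then c j f else 0"] that fW coord_mem by auto
    then obtain h where h: "\<And>j. j \<in> X \<Longrightarrow> h j \<in> W"
        "\<And>i j. j \<in> X \<Longrightarrow> i \<in> X \<Longrightarrow> c i (h j) = (if i = j then c j f else 0)" by metis
    have hE: "h j \<in> hcarrier E" if "j \<in> X" for j
    proof (rule mem_E_if_bounded(1)[of _ "hnorm V (c j f)"])
      fix I assume "finite I" "I \<subseteq> X"
      then have "(\<Sum>i\<in>I. (hnorm V (c i (h j)))\<^sup>2) = (\<Sum>i\<in>I. if i = j then (hnorm V (c j f))\<^sup>2 else 0)"
        using h that by (intro sum.cong) auto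
      also have "\<dots> \<le> (hnorm V (c j f))\<^sup>2" using \<open>finite I\<close> by (simp add: sum.delta)
      finally show "(\<Sum>i\<in>I. (hnorm V (c i (h j)))\<^sup>2) \<le> (hnorm V (c j f))\<^sup>2" .
    qed (use h that fW coord_mem in auto)
    define y where "y = sum h I"
    have y: "y \<in> htopology E closure_of S"
      unfolding y_def using I h hE by (intro csubspace_sum[OF cl] single) auto
    have yE: "y \<in> hcarrier E" using y sub by blast
    have csum: "c i (sum h J) = (\<Sum>j\<in>J. c i (h j)) \<and> sum h J \<in> W" if "i \<in> X" "J \<subseteq> X" "finite J" for i J
      using that(3,2) by (induction J) (use csubspace_ambient h that(1) in
        \<open>auto simp: coord_zero coord_add W_add csubspace_def\<close>)
    have cy: "c i y = (if i \<in> I then c i f else 0)" if i: "i \<in> X" for i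
    proof -
      have "c i y = (\<Sum>j\<in>I. c i (h j))" unfolding y_def using csum I i by blast
      also have "\<dots> = (\<Sum>j\<in>I. if j = i then c i f else 0)" using I h i by (intro sum.cong) auto
      finally show ?thesis using I by (simp add: sum.delta)
    qed
    have yW: "y \<in> W" using yE by (simp add: mem_E)
    have cd: "c i (f - y) = (if i \<in> I then 0 else c i f)" if "i \<in> X" for i
      using that fW yW by (simp add: coord_diff cy)
    have "hnorm E (f - y) \<le> \<epsilon> / 4"
    proof (rule mem_E_if_bounded(2))
      fix J assume J: "finite J" "J \<subseteq> X"
      have "(\<Sum>i\<in>J. (hnorm V (c i (f - y)))\<^sup>2) = (\<Sum>i\<in>J. if i \<in> I then 0 else ?q i)"
        using J by (intro sum.cong) (auto simp: cd)
      also have "\<dots> = sum ?q (J - I)"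
        using J by (simp add: sum.If_cases Diff_eq)
      also have "\<dots> = sum ?q (J \<union> I) - sum ?q I"
        using J I sum_diff[of "J \<union> I" I ?q] by (simp add: Un_Diff)
      also have "sum ?q (J \<union> I) \<le> infsum ?q X"
        using J I sm by (intro finite_sum_le_infsum) auto
      also have "infsum ?q X - sum ?q I \<le> (\<epsilon> / 4)\<^sup>2" using I(3) by (simp add: dist_real_def)
      finally show "(\<Sum>i\<in>J. (hnorm V (c i (f - y)))\<^sup>2) \<le> (\<epsilon> / 4)\<^sup>2" by simp
    qed (use fW yW W_diff e in auto)
    moreover obtain z where z: "z \<in> S" "hnorm E (y - z) < \<epsilon> / 4"
      using E.closure_of_approx[OF S(2) y, of "\<epsilon> / 4"] e by auto
    ultimately have "hnorm E (f - z) < \<epsilon>"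
      using E.norm_diff_triangle[of f y z] f yE S z e by fastforce
    with z show ?thesis by blast
  qed
  then show ?thesis unfolding E.closure_of_eq_carrier_iff[OF S(2)] by blast
qed

end

section \<open>Distances and spheres in a regular tree\<close>

lemma rtranclp_imp_path:
  assumes "r\<^sup>*\<^sup>* x y"
  shows "\<exists>xs. xs \<noteq> [] \<and> distinct xs \<and> successively r xs \<and> hd xs = x \<and> last xs = y \<and>
     (\<forall>z\<in>set xs. z = x \<or> (\<exists>w. r w z))"
  using assms
proof (induction rule: converse_rtranclp_induct)
  case base
  show ?case by (intro exI[of _ "[y]"]) simp
next
  case (step x u)
  then obtain xs where xs: "xs \<noteq> []" "distinct xs" "successively r xs" "hd xs = u" "last xs = y"
    "\<forall>z\<in>set xs. z = u \<or> (\<exists>w. r w z)" by blast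
  have ex: "\<forall>z\<in>set xs. \<exists>w. r w z" using xs(6) step(1) by metis
  show ?case
  proof (cases "x \<in> set xs")
    case False
    with xs(1-5) ex step(1) show ?thesis
      by (intro exI[of _ "x # xs"]) (auto simp: successively_Cons)
  next
    case True
    then obtain as bs where s: "xs = as @ x # bs" using split_list by metis
    show ?thesis
      by (intro exI[of _ "x # bs"])
        (use xs(1-5) s ex in \<open>auto simp: successively_append_iff\<close>)
  qed
qed

locale reg_tree =
  fixes d :: nat and adj :: "'a \<Rightarrow> 'a \<Rightarrow> bool"
  assumes tree: "regular_tree d adj" and degree: "3 \<le> d"
begin

abbreviation dist' :: "'a \<Rightarrow> 'a \<Rightarrow> nat" where "dist' \<equiv> graph_dist adj"
abbreviation nbrs :: "'a \<Rightarrow> 'a set" where "nbrs x \<equiv> {y. adj x y}"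

lemma adj_sym: "adj x y \<Longrightarrow> adj y x"
  and adj_irrefl: "\<not> adj x x"
  and connected: "adj\<^sup>*\<^sup>* x y"
  and acyclic: "\<not> graph_cycle adj xs"
  and finite_nbrs: "finite (nbrs x)"
  and card_nbrs: "card (nbrs x) = d"
  using tree by (auto simp: regular_tree_def symp_def irreflp_def)

lemma dist_pow: "(adj ^^ dist' x y) x y"
  unfolding graph_dist_def
  using connected[of x y] by (metis LeastI_ex rtranclp_imp_relpowp)

lemma dist_le: "(adj ^^ n) x y \<Longrightarrow> dist' x y \<le> n"
  unfolding graph_dist_def by (rule Least_le)

lemma dist_self [simp]: "dist' x x = 0"
  using dist_le[of 0 x x] by simp

lemma dist_eq_0 [simp]: "dist' x y = 0 \<longleftrightarrow> x = y"
  using dist_pow[of x y] by auto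

lemma dist_adj_le: "adj y z \<Longrightarrow> dist' x z \<le> Suc (dist' x y)"
  using dist_pow[of x y] by (intro dist_le) auto

lemma dist_sym: "dist' x y = dist' y x"
proof -
  have "(adj ^^ n) x y \<Longrightarrow> (adj ^^ n) y x" for n x y
  proof (induction n arbitrary: y)
    case (Suc n)
    then obtain z where z: "(adj ^^ n) x z" "adj z y" by auto
    then show ?case using Suc.IH[OF z(1)] adj_sym relpowp_Suc_I2 by metis
  qed auto
  then have "dist' x y \<le> dist' y x" for x y using dist_le dist_pow by blast
  then show ?thesis by (simp add: order_antisym)
qed

lemma dist_adj: "adj x y \<Longrightarrow> dist' x y = 1"
  using dist_adj_le[of x y x] dist_eq_0[of x y] adj_irrefl by (metis One_nat_def dist_self le_Suc_eq le_zero_eq)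

lemma adj_iff_dist: "adj x y \<longleftrightarrow> dist' x y = 1"
  using dist_adj dist_pow[of x y] by auto

lemma dist_triangle: "dist' x z \<le> dist' x y + dist' y z"
  using dist_le[of "dist' x y + dist' y z" x z] dist_pow[of x y] dist_pow[of y z]
  by (auto simp: relpowp_add relcompp_apply)

lemma exists_parent: "dist' c x = Suc n \<Longrightarrow> \<exists>y. adj x y \<and> dist' c y = n"
proof -
  assume d: "dist' c x = Suc n"
  then obtain y where y: "(adj ^^ n) c y" "adj y x" using dist_pow[of c x] by auto
  then have "dist' c y \<le> n" by (intro dist_le)
  moreover have "Suc n \<le> Suc (dist' c y)" using dist_adj_le[OF y(2), of c] d by simp
  ultimately show ?thesis using adj_sym y by auto
qed

text \<open>
  Two neighbours of \<open>x\<close> that are at most as far from \<open>c\<close> as \<open>x\<close> is are joined through \<open>c\<close> by a path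
  avoiding \<open>x\<close>, so that they coincide because there are no cycles.
\<close>

lemma parent_unique:
  assumes "adj x y" "adj x z" "dist' c y \<le> dist' c x" "dist' c z \<le> dist' c x"
  shows "y = z"
proof (rule ccontr)
  assume ne: "y \<noteq> z"
  define r where "r = (\<lambda>u v. adj u v \<and> u \<noteq> x \<and> v \<noteq> x)"
  have r_sym: "r\<^sup>*\<^sup>* u v \<Longrightarrow> r\<^sup>*\<^sup>* v u" for u v
    by (rule sympD[OF symp_rtranclp]) (auto simp: r_def symp_def adj_sym)
  have to_c: "r\<^sup>*\<^sup>* u c" if "u \<noteq> x" "dist' c u \<le> dist' c x" for u
    using that
  proof (induction "dist' c u" arbitrary: u)
    case 0
    then show ?case by simp
  next
    case (Suc n)
    obtain v where v: "adj u v" "dist' c v = n" using exists_parent[of c u n] Suc(2) by auto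
    then have "v \<noteq> x" "dist' c v \<le> dist' c x" using Suc(2,4) by auto
    then have "r\<^sup>*\<^sup>* v c" using Suc(1) v by simp
    moreover have "r u v" using v Suc(3) \<open>v \<noteq> x\<close> by (simp add: r_def)
    ultimately show ?case by (rule converse_rtranclp_into_rtranclp[rotated])
  qed
  have "y \<noteq> x" "z \<noteq> x" using assms adj_irrefl by auto
  then have "r\<^sup>*\<^sup>* y z" using to_c[of y] to_c[of z] assms r_sym rtranclp_trans by metis
  then obtain xs where xs: "xs \<noteq> []" "distinct xs" "successively r xs" "hd xs = y" "last xs = z"
    "\<forall>w\<in>set xs. w = y \<or> (\<exists>u. r u w)" using rtranclp_imp_path by metis
  have nx: "x \<notin> set xs" using xs \<open>y \<noteq> x\<close> by (auto simp: r_def)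
  have "length xs \<ge> 2"
    using xs(1,4,5) ne by (cases xs; cases "tl xs") auto
  moreover have "successively adj xs"
    by (rule successively_mono[OF xs(3)]) (auto simp: r_def)
  ultimately have "graph_cycle adj (x # xs)"
    using xs nx assms adj_sym by (auto simp: graph_cycle_def successively_Cons)
  then show False using acyclic by blast
qed

lemma dist_nbr_cases: "adj x y \<Longrightarrow> dist' c y = Suc (dist' c x) \<or> dist' c x = Suc (dist' c y)"
proof -
  assume xy: "adj x y"
  have le: "dist' c y \<le> Suc (dist' c x)" "dist' c x \<le> Suc (dist' c y)"
    using dist_adj_le xy adj_sym by blast+
  have "dist' c y \<noteq> dist' c x"
  proof
    assume e: "dist' c y = dist' c x"
    show False
    proof (cases "dist' c x")
      case 0
      then show False using e xy adj_irrefl by auto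
    next
      case (Suc n)
      then obtain z where z: "adj x z" "dist' c z = n" using exists_parent by blast
      then have "y = z" using parent_unique[OF xy z(1), of c] e Suc by simp
      then show False using z e Suc by simp
    qed
  qed
  then show ?thesis using le by linarith
qed

subsection \<open>Spheres\<close>

definition parent :: "'a \<Rightarrow> 'a \<Rightarrow> 'a" where
  "parent c x = (SOME y. adj x y \<and> Suc (dist' c y) = dist' c x)"

definition children :: "'a \<Rightarrow> 'a \<Rightarrow> 'a set" where
  "children c x = {y. adj x y \<and> dist' c y = Suc (dist' c x)}"

definition sphere :: "'a \<Rightarrow> nat \<Rightarrow> 'a set" where
  "sphere c n = {x. dist' c x = n}"

lemma parent:
  assumes "x \<noteq> c"
  shows "adj x (parent c x)" "Suc (dist' c (parent c x)) = dist' c x"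
proof -
  obtain n where "dist' c x = Suc n" using assms not0_implies_Suc by (metis dist_eq_0)
  then have "\<exists>y. adj x y \<and> Suc (dist' c y) = dist' c x" using exists_parent by fastforce
  then have "adj x (parent c x) \<and> Suc (dist' c (parent c x)) = dist' c x"
    unfolding parent_def by (rule someI_ex)
  then show "adj x (parent c x)" "Suc (dist' c (parent c x)) = dist' c x" by auto
qed

lemma parent_eqI: "adj x y \<Longrightarrow> dist' c x = Suc (dist' c y) \<Longrightarrow> parent c x = y"
  using parent[of x c] parent_unique[of x y "parent c x" c] by force

lemma nbrs_eq: "x \<noteq> c \<Longrightarrow> nbrs x = insert (parent c x) (children c x)"
proof (intro equalityI subsetI)
  fix y assume "x \<noteq> c" "y \<in> nbrs x"
  then show "y \<in> insert (parent c x) (children c x)"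
    using dist_nbr_cases[of x y c] parent_eqI[of x y c] by (auto simp: children_def)
next
  fix y assume "x \<noteq> c" "y \<in> insert (parent c x) (children c x)"
  then show "y \<in> nbrs x" using parent(1)[of x c] by (auto simp: children_def)
qed

lemma nbrs_root: "nbrs c = children c c"
  by (auto simp: children_def adj_iff_dist)

lemma parent_not_child: "x \<noteq> c \<Longrightarrow> parent c x \<notin> children c x"
  using parent[of x c] by (auto simp: children_def)

lemma finite_children: "finite (children c x)"
  by (rule finite_subset[OF _ finite_nbrs[of x]]) (auto simp: children_def)

lemma card_children: "card (children c x) = (if x = c then d else d - 1)"
proof (cases "x = c")
  case True
  then show ?thesis using card_nbrs nbrs_root by simp
next
  case False
  then have "d = Suc (card (children c x))"
    using card_nbrs[of x] nbrs_eq[OF False] parent_not_child[OF False] finite_children by simp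
  then show ?thesis using False by simp
qed

lemma sphere_0: "sphere c 0 = {c}"
  by (auto simp: sphere_def)

lemma mem_children_iff: "y \<in> children c x \<longleftrightarrow> y \<noteq> c \<and> parent c y = x"
proof
  assume y: "y \<in> children c x"
  then have "adj y x" "dist' c y = Suc (dist' c x)" by (auto simp: children_def adj_sym)
  then show "y \<noteq> c \<and> parent c y = x" using parent_eqI by fastforce
next
  assume "y \<noteq> c \<and> parent c y = x"
  then show "y \<in> children c x" using parent[of y c] adj_sym by (auto simp: children_def)
qed

lemma sphere_Suc: "sphere c (Suc n) = (\<Union>x\<in>sphere c n. children c x)"
proof -
  have "y \<in> (\<Union>x\<in>sphere c n. children c x)" if "y \<in> sphere c (Suc n)" for y
  proof -
    have "y \<noteq> c" using that by (auto simp: sphere_def)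
    then show ?thesis using parent[of y c] that mem_children_iff by (force simp: sphere_def)
  qed
  then show ?thesis by (auto simp: children_def sphere_def)
qed

lemma finite_sphere: "finite (sphere c n)"
  by (induction n) (simp_all add: sphere_0 sphere_Suc finite_children)

lemma sum_sphere_Suc:
  fixes F :: "'a \<Rightarrow> 'b::comm_monoid_add"
  shows "sum F (sphere c (Suc n)) = (\<Sum>x\<in>sphere c n. sum F (children c x))"
  unfolding sphere_Suc
  by (intro sum.UNION_disjoint) (auto simp: finite_sphere finite_children mem_children_iff)

lemma card_sphere: "card (sphere c (Suc n)) = d * (d - 1) ^ n"
proof (induction n)
  case 0
  show ?case using sum_sphere_Suc[of "\<lambda>_. 1::nat" c 0] by (simp add: sphere_0 card_children)
next
  case (Suc n)
  have "card (sphere c (Suc (Suc n))) = (\<Sum>x\<in>sphere c (Suc n). card (children c x))"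
    using sum_sphere_Suc[of "\<lambda>_. 1::nat" c "Suc n"] by simp
  also have "\<dots> = (\<Sum>x\<in>sphere c (Suc n). d - 1)"
    by (intro sum.cong) (auto simp: card_children sphere_def)
  finally show ?case using Suc by simp
qed

lemma sum_nbrs:
  fixes F :: "'a \<Rightarrow> 'b::comm_monoid_add"
  assumes "x \<noteq> c"
  shows "sum F (nbrs x) = F (parent c x) + sum F (children c x)"
  using nbrs_eq[OF assms] parent_not_child[OF assms] finite_children by simp

subsection \<open>The averaging operator\<close>

definition avg :: "('a \<Rightarrow> complex) \<Rightarrow> 'a \<Rightarrow> complex" where
  "avg F x = sum F (nbrs x) / of_nat d"

lemma sum_sphere_avg_0: "sum (avg F) (sphere c 0) = sum F (sphere c 1) / of_nat d"
  using sum_sphere_Suc[of F c 0] by (simp add: sphere_0 avg_def nbrs_root)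

lemma sum_sphere_avg_Suc:
  "sum (avg F) (sphere c (Suc n)) =
    ((if n = 0 then of_nat d else of_nat (d - 1)) * sum F (sphere c n) +
      sum F (sphere c (Suc (Suc n)))) / of_nat d"
proof -
  have "(\<Sum>x\<in>sphere c (Suc n). sum F (nbrs x)) =
      (\<Sum>x\<in>sphere c (Suc n). F (parent c x) + sum F (children c x))"
    by (intro sum.cong refl sum_nbrs) (auto simp: sphere_def)
  also have "\<dots> = (\<Sum>x\<in>sphere c (Suc n). F (parent c x)) + sum F (sphere c (Suc (Suc n)))"
    by (simp add: sum.distrib sum_sphere_Suc[of F c "Suc n"])
  also have "(\<Sum>x\<in>sphere c (Suc n). F (parent c x)) = (\<Sum>x\<in>sphere c n. \<Sum>y\<in>children c x. F x)"
    unfolding sum_sphere_Suc by (intro sum.cong refl) (auto simp: mem_children_iff)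
  also have "\<dots> = (\<Sum>x\<in>sphere c n. (if n = 0 then of_nat d else of_nat (d - 1)) * F x)"
    by (intro sum.cong refl) (auto simp: card_children sphere_def)
  finally show ?thesis
    by (simp add: avg_def sum_divide_distrib[symmetric] sum_distrib_left)
qed

text \<open>
  The factor by which averaging multiplies the function \<open>\<theta>\<^sup>n\<close> of the distance to a fixed centre, at all vertices other than
  the centre.
\<close>

definition growth :: "real \<Rightarrow> real" where
  "growth \<theta> = (inverse \<theta> + real (d - 1) * \<theta>) / d"

lemma growth_pos: "0 < \<theta> \<Longrightarrow> 0 < growth \<theta>"
  using degree by (auto simp: growth_def intro!: divide_pos_pos add_pos_nonneg)

text \<open>
  If the mean values over spheres decay like \<open>\<theta>\<^sup>n\<close>, then averaging multiplies the constant in this bound by at most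
  \<open>growth \<theta>\<close>: on the sphere of radius \<open>n \<ge> 1\<close> one of the \<open>d\<close> neighbours is nearer to the centre and \<open>d - 1\<close> are
  farther away. At the centre the factor is only \<open>\<theta>\<close>, which is smaller as \<open>\<theta> \<le> 1\<close>.
\<close>

lemma sphere_sum_bound_avg:
  assumes th: "0 < \<theta>" "\<theta> \<le> 1" and C: "0 \<le> C"
    and F: "\<And>n. cmod (sum F (sphere c n)) \<le> C * real (card (sphere c n)) * \<theta> ^ n"
  shows "cmod (sum (avg F) (sphere c n)) \<le>
    C * growth \<theta> * real (card (sphere c n)) * \<theta> ^ n"
proof (cases n)
  case 0
  have "\<theta> * real d \<le> inverse \<theta> + real (d - 1) * \<theta>"
  proof -
    have "\<theta> \<le> 1" "1 \<le> inverse \<theta>" using th by (auto simp: field_simps)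
    then have "\<theta> \<le> inverse \<theta>" by linarith
    then show ?thesis using degree by (simp add: of_nat_diff algebra_simps)
  qed
  then have "\<theta> \<le> (inverse \<theta> + real (d - 1) * \<theta>) / d" using degree by (simp add: field_simps)
  moreover have "cmod (sum (avg F) (sphere c 0)) \<le> C * \<theta>"
    using F[of 1] degree card_sphere[of c 0]
    by (simp add: sum_sphere_avg_0 norm_divide field_simps)
  ultimately show ?thesis
    using 0 C mult_left_mono[of \<theta> "(inverse \<theta> + real (d - 1) * \<theta>) / d" C]
    by (simp add: sphere_0 growth_def)
next
  case (Suc m)
  let ?k = "if m = 0 then d else d - 1"
  have ck: "?k * card (sphere c m) = card (sphere c (Suc m))"
    by (cases m) (simp_all add: sphere_0 card_sphere)
  have ck2: "card (sphere c (Suc (Suc m))) = (d - 1) * card (sphere c (Suc m))"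
    by (simp add: card_sphere)
  have "cmod (sum (avg F) (sphere c (Suc m))) =
      cmod (of_nat ?k * sum F (sphere c m) + sum F (sphere c (Suc (Suc m)))) / d"
    using sum_sphere_avg_Suc[of F c m] by (simp add: norm_divide)
  also have "\<dots> \<le> (real ?k * cmod (sum F (sphere c m)) + cmod (sum F (sphere c (Suc (Suc m))))) / d"
    by (intro divide_right_mono order_trans[OF norm_triangle_ineq]) (simp_all add: norm_mult)
  also have "\<dots> \<le> (real ?k * (C * real (card (sphere c m)) * \<theta> ^ m) +
      C * real (card (sphere c (Suc (Suc m)))) * \<theta> ^ Suc (Suc m)) / d"
    using F[of m] F[of "Suc (Suc m)"] by (intro divide_right_mono add_mono mult_left_mono) auto
  also have "real ?k * (C * real (card (sphere c m)) * \<theta> ^ m) =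
      C * real (?k * card (sphere c m)) * \<theta> ^ m" by simp
  also have "\<dots> = C * real (card (sphere c (Suc m))) * (inverse \<theta> * \<theta> ^ Suc m)"
    unfolding ck using th by simp
  also have "(C * real (card (sphere c (Suc m))) * (inverse \<theta> * \<theta> ^ Suc m) +
      C * real (card (sphere c (Suc (Suc m)))) * \<theta> ^ Suc (Suc m)) / d =
      (C * ((inverse \<theta> + real (d - 1) * \<theta>) / d)) * real (card (sphere c (Suc m))) * \<theta> ^ Suc m"
    unfolding ck2 by (simp add: ring_distribs add_divide_distrib mult_ac)
  finally show ?thesis using Suc by (simp add: growth_def)
qed

text \<open>
  Read off at the centre, the bound for the spheres controls the iterated averages: they grow at most like the
  powers of \<open>growth \<theta>\<close>. This is how decay of a matrix coefficient is turned into a norm bound.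
\<close>

lemma avg_power_bound:
  assumes th: "0 < \<theta>" "\<theta> \<le> 1" and C: "0 \<le> C"
    and F: "\<And>n. cmod (sum F (sphere c n)) \<le> C * real (card (sphere c n)) * \<theta> ^ n"
  shows "cmod ((avg ^^ k) F c) \<le> C * growth \<theta> ^ k"
proof -
  have "cmod (sum ((avg ^^ k) F) (sphere c n)) \<le>
    (C * growth \<theta> ^ k) * real (card (sphere c n)) * \<theta> ^ n" for n
  proof (induction k arbitrary: n)
    case (Suc k)
    have "0 \<le> C * growth \<theta> ^ k" using less_imp_le[OF growth_pos[OF th(1)]] C by simp
    from sphere_sum_bound_avg[OF th this Suc.IH] show ?case by (simp add: mult_ac)
  qed (use F in simp)
  from this[of 0] show ?thesis by (simp add: sphere_0)
qed

text \<open>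
  On functions of the distance to \<open>c\<close> the averaging operator is the recursion defining spherical functions.
\<close>

lemma avg_radial:
  "avg (\<lambda>x. \<Phi> (dist' c x)) x =
    (if x = c then \<Phi> 1
     else (\<Phi> (dist' c x - 1) + of_nat (d - 1) * \<Phi> (dist' c x + 1)) / of_nat d)"
proof (cases "x = c")
  case True
  have "sum (\<lambda>x. \<Phi> (dist' c x)) (nbrs c) = (\<Sum>x\<in>nbrs c. \<Phi> 1)"
    by (intro sum.cong) (auto simp: adj_iff_dist)
  then show ?thesis using True degree by (simp add: avg_def card_nbrs)
next
  case False
  have "sum (\<lambda>x. \<Phi> (dist' c x)) (children c x) = (\<Sum>y\<in>children c x. \<Phi> (dist' c x + 1))"
    by (intro sum.cong) (auto simp: children_def)
  moreover have "dist' c (parent c x) = dist' c x - 1" using parent(2)[OF False] by simp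
  ultimately show ?thesis
    using False by (simp add: avg_def sum_nbrs card_children)
qed

subsection \<open>Automorphisms\<close>

lemma tree_auts_adj: "h \<in> tree_auts adj \<Longrightarrow> adj (h x) (h y) \<longleftrightarrow> adj x y"
  and tree_auts_bij: "h \<in> tree_auts adj \<Longrightarrow> bij h"
  by (auto simp: tree_auts_def)

lemma dist_aut:
  assumes h: "h \<in> tree_auts adj" shows "dist' (h x) (h y) = dist' x y"
proof -
  have "(adj ^^ n) (h x) (h y) \<longleftrightarrow> (adj ^^ n) x y" for n y
  proof (induction n arbitrary: y)
    case 0
    show ?case using tree_auts_bij[OF h] by (simp add: bij_def inj_eq)
  next
    case (Suc n)
    have "(adj ^^ Suc n) (h x) (h y) \<longleftrightarrow> (\<exists>z. (adj ^^ n) (h x) (h z) \<and> adj (h z) (h y))"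
      using bij_is_surj[OF tree_auts_bij[OF h]] unfolding relpowp.simps relcompp_apply by (metis surjE)
    then show ?case using Suc h by (auto simp: tree_auts_adj relcompp_apply)
  qed
  then show ?thesis by (simp add: graph_dist_def)
qed

lemma nbrs_aut:
  assumes h: "h \<in> tree_auts adj" shows "nbrs (h x) = h ` nbrs x"
proof (intro equalityI subsetI)
  fix y assume y: "y \<in> nbrs (h x)"
  obtain z where "y = h z" using bij_is_surj[OF tree_auts_bij[OF h]] by (metis surjE)
  then show "y \<in> h ` nbrs x" using y h by (auto simp: tree_auts_adj)
qed (use h in \<open>auto simp: tree_auts_adj\<close>)

end

section \<open>Boundary transitivity makes vertex stabilisers transitive on neighbours\<close>

context reg_tree
begin

text \<open>
  Without backtracking the distance from the start always increases, since only one neighbour of a vertex is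
  nearer to the start.
\<close>

lemma nonbacktracking_geodesic:
  assumes adj: "\<And>n. adj (r n) (r (Suc n))" and nb: "\<And>n. r (Suc (Suc n)) \<noteq> r n"
  shows "r \<in> geodesic_rays adj"
proof -
  have "dist' (r i) (r (i + k)) = k \<and> dist' (r i) (r (i + Suc k)) = Suc k" for i k
  proof (induction k)
    case 0
    show ?case using adj[of i] dist_adj by simp
  next
    case (Suc k)
    let ?x = "r (i + Suc k)"
    have a: "adj ?x (r (i + k))" "adj ?x (r (i + Suc (Suc k)))"
      using adj[of "i + k"] adj[of "i + Suc k"] adj_sym by auto
    have "dist' (r i) (r (i + Suc (Suc k))) = Suc (Suc k)"
    proof (rule ccontr)
      assume "\<not> ?thesis"
      then have "Suc (dist' (r i) (r (i + Suc (Suc k)))) = Suc k"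
        using dist_nbr_cases[OF a(2), of "r i"] Suc by auto
      then have "r (i + k) = r (i + Suc (Suc k))"
        using Suc by (intro parent_unique[OF a, of "r i"]) auto
      then show False using nb[of "i + k"] by simp
    qed
    then show ?case using Suc by simp
  qed
  then have "dist' (r i) (r (i + k)) = k" for i k by blast
  then have "i \<le> j \<longrightarrow> dist' (r i) (r j) = j - i" for i j
    by (metis le_add_diff_inverse)
  then show ?thesis by (simp add: geodesic_rays_def)
qed

text \<open>
  A ray is grown arc by arc. The predicate \<open>I\<close> is an invariant of the arcs, and \<open>J\<close> records the properties wanted of
  two consecutive arcs.
\<close>

lemma exists_ray:
  assumes "I u\<^sub>0 u\<^sub>1"
    and step: "\<And>u v. I u v \<Longrightarrow> adj u v \<and> (\<exists>w. adj v w \<and> w \<noteq> u \<and> I v w \<and> J u v w)"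
  shows "\<exists>r\<in>geodesic_rays adj. \<forall>n. I (r n) (r (Suc n)) \<and> J (r n) (r (Suc n)) (r (Suc (Suc n)))"
proof -
  define Q where "Q = (\<lambda>(n::nat) p p'. fst p' = snd p \<and> snd p' \<noteq> fst p \<and> J (fst p) (snd p) (snd p'))"
  have "\<exists>f. \<forall>n. I (fst (f n)) (snd (f n)) \<and> Q n (f n) (f (Suc n))"
  proof (rule dependent_nat_choice)
    show "\<exists>p. I (fst p) (snd p)" using assms(1) by (intro exI[of _ "(u\<^sub>0, u\<^sub>1)"]) simp
    fix p :: "'a \<times> 'a" and n assume "I (fst p) (snd p)"
    then obtain w where "w \<noteq> fst p" "I (snd p) w" "J (fst p) (snd p) w"
      using step by blast
    then show "\<exists>p'. I (fst p') (snd p') \<and> Q n p p'"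
      by (intro exI[of _ "(snd p, w)"]) (simp add: Q_def)
  qed
  then obtain f where f: "\<And>n. I (fst (f n)) (snd (f n))" "\<And>n. Q n (f n) (f (Suc n))" by blast
  define r where "r n = fst (f n)" for n
  have r1: "snd (f n) = r (Suc n)" for n using f(2)[of n] by (simp add: Q_def r_def)
  have I: "I (r n) (r (Suc n))" for n using f(1)[of n] r1 by (simp add: r_def)
  have J: "r (Suc (Suc n)) \<noteq> r n" "J (r n) (r (Suc n)) (r (Suc (Suc n)))" for n
    using f(2)[of n] r1[of "Suc n"] r1[of n] by (auto simp: Q_def r_def)
  have "r \<in> geodesic_rays adj"
    using step[OF I] J(1) by (intro nonbacktracking_geodesic) auto
  then show ?thesis using I J(2) by blast
qed

end

abbreviation finv :: "('a \<Rightarrow> 'a) \<Rightarrow> 'a \<Rightarrow> 'a" where "finv h \<equiv> inv_into UNIV h"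

locale tree_action = reg_tree +
  fixes H :: "('a \<Rightarrow> 'a) set"
  assumes subgroup_H: "subgroup H (aut_group adj)" and transitive: "vertex_transitive H"
begin

lemma H_aut: "h \<in> H \<Longrightarrow> h \<in> tree_auts adj"
  using subgroup.subset[OF subgroup_H] by (auto simp: aut_group_def)

lemma id_mem: "id \<in> H"
  using subgroup.one_closed[OF subgroup_H] by (simp add: aut_group_def)

lemma comp_mem: "g \<in> H \<Longrightarrow> h \<in> H \<Longrightarrow> g \<circ> h \<in> H"
  using subgroup.m_closed[OF subgroup_H] by (simp add: aut_group_def)

lemma inv_aut:
  assumes h: "h \<in> tree_auts adj"
  shows "finv h \<in> tree_auts adj" "h \<circ> finv h = id" "finv h \<circ> h = id" "inv\<^bsub>aut_group adj\<^esub> h = finv h"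
proof -
  have b: "bij h" using h tree_auts_bij by blast
  then show hi: "h \<circ> finv h = id" "finv h \<circ> h = id"
    by (auto simp: fun_eq_iff bij_is_surj surj_f_inv_f bij_is_inj)
  have "adj (finv h x) (finv h y) \<longleftrightarrow> adj x y" for x y
    using tree_auts_adj[OF h, of "finv h x" "finv h y"] b by (simp add: bij_is_surj surj_f_inv_f)
  then show iv: "finv h \<in> tree_auts adj" using b by (simp add: tree_auts_def bij_imp_bij_inv)
  show "inv\<^bsub>aut_group adj\<^esub> h = finv h"
    unfolding m_inv_def aut_group_def
  proof (rule the_equality; simp)
    show "finv h \<in> tree_auts adj \<and> h \<circ> finv h = id \<and> finv h \<circ> h = id" using iv hi by simp
    fix y assume "y \<in> tree_auts adj \<and> h \<circ> y = id \<and> y \<circ> h = id"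
    then show "y = finv h" using hi by (metis comp_assoc comp_id id_comp)
  qed
qed

lemma inv_mem: "h \<in> H \<Longrightarrow> finv h \<in> H"
  using subgroup.m_inv_closed[OF subgroup_H, of h] inv_aut(4)[OF H_aut] by simp

lemma inv_apply: "h \<in> H \<Longrightarrow> finv h (h x) = x" "h \<in> H \<Longrightarrow> h (finv h x) = x"
  using inv_aut(2,3)[OF H_aut] by (auto simp: fun_eq_iff)

text \<open>
  The arcs in the orbit of the arc from \<open>v\<close> to \<open>b\<close>: an orbit of \<open>H\<close> on arcs is regarded as a colour.
\<close>

definition arcs :: "'a \<Rightarrow> 'a \<Rightarrow> 'a \<Rightarrow> 'a set" where
  "arcs v b x = {y. \<exists>h\<in>H. h v = x \<and> h b = y}"

lemma arcs_subset_nbrs: "adj v b \<Longrightarrow> arcs v b x \<subseteq> nbrs x"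
  using H_aut tree_auts_adj by (auto simp: arcs_def)

lemma arcs_aut:
  assumes g: "g \<in> H" shows "g y \<in> arcs v b (g x) \<longleftrightarrow> y \<in> arcs v b x"
proof
  have *: "g y \<in> arcs v b (g x)" if "g \<in> H" "y \<in> arcs v b x" for g x y
  proof -
    obtain h where "h \<in> H" "h v = x" "h b = y" using \<open>y \<in> arcs v b x\<close> by (auto simp: arcs_def)
    then show ?thesis using comp_mem[OF \<open>g \<in> H\<close>, of h] by (auto simp: arcs_def intro!: bexI[of _ "g \<circ> h"])
  qed
  show "y \<in> arcs v b x \<Longrightarrow> g y \<in> arcs v b (g x)" by (rule *[OF g])
  show "g y \<in> arcs v b (g x) \<Longrightarrow> y \<in> arcs v b x"
    using *[of "finv g" "g y" "g x"] g by (simp add: inv_mem inv_apply)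
qed

lemma arcs_image:
  assumes g: "g \<in> H" shows "arcs v b (g x) = g ` arcs v b x"
proof (intro equalityI subsetI)
  fix y assume "y \<in> arcs v b (g x)"
  then have "finv g y \<in> arcs v b x" using arcs_aut[OF g, of "finv g y"] g by (simp add: inv_apply)
  then show "y \<in> g ` arcs v b x" using inv_apply(2)[OF g, of y] by (intro image_eqI[of y g "finv g y"]) simp_all
qed (use arcs_aut[OF g] in auto)

text \<open>By vertex transitivity each colour is seen equally often at every vertex.\<close>

lemma card_arcs: "card (arcs v b x) = card (arcs v b y)"
proof -
  obtain g where g: "g \<in> H" "g x = y" using transitive by (auto simp: vertex_transitive_def)
  have "inj g" using tree_auts_bij[OF H_aut[OF g(1)]] bij_is_inj by blast
  then show ?thesis using arcs_image[OF g(1), of v b x] g(2)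
    by (simp add: card_image inj_on_subset)
qed

lemma arcs_nonempty: "arcs v b x \<noteq> {}"
proof -
  obtain h where "h \<in> H" "h v = x" using transitive by (auto simp: vertex_transitive_def)
  then have "h b \<in> arcs v b x" by (auto simp: arcs_def)
  then show ?thesis by blast
qed

lemma finite_arcs: "adj v b \<Longrightarrow> finite (arcs v b x)"
  using arcs_subset_nbrs finite_nbrs finite_subset by metis

text \<open>
  Two rays represent the same end exactly if they have a common tail, so equality of ends gives an equality of
  tails after a shift.
\<close>

lemma boundary_transitive_rays:
  assumes "boundary_transitive adj H" and r: "r \<in> geodesic_rays adj" and s: "s \<in> geodesic_rays adj"
  obtains h m n where "h \<in> H" "\<And>k. h (r (m + k)) = s (n + k)"
proof -
  have "end_rel adj `` {r} \<in> tree_boundary adj" "end_rel adj `` {s} \<in> tree_boundary adj"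
    using r s by (auto simp: tree_boundary_def quotientI)
  then obtain h where h: "h \<in> H" "(\<lambda>r. h \<circ> r) ` (end_rel adj `` {r}) = end_rel adj `` {s}"
    using assms(1) unfolding boundary_transitive_def by blast
  have "r \<in> end_rel adj `` {r}" using r by (auto simp: end_rel_def)
  then have "h \<circ> r \<in> end_rel adj `` {s}" using h(2) by blast
  then obtain m n where "\<forall>k. s (m + k) = (h \<circ> r) (n + k)" by (auto simp: end_rel_def)
  then show ?thesis using that[OF h(1), of n m] by simp
qed

text \<open>
  If the stabiliser of \<open>v\<close> had two orbits on the neighbours, some colour would be taken by at most \<open>d - 2\<close>
  of the arcs leaving each vertex. Then one ray avoids this colour and another one uses it
  infinitely often, and no element of \<open>H\<close> maps the end of the first ray to the end of the second.
\<close>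

theorem stabiliser_transitive_on_nbrs:
  assumes bt: "boundary_transitive adj H" and x: "adj v x" and y: "adj v y"
  shows "\<exists>k\<in>H. k v = v \<and> k x = y"
proof (rule ccontr)
  assume no: "\<not> ?thesis"
  have self: "b \<in> arcs v b v" for b using id_mem by (auto simp: arcs_def intro!: bexI[of _ id])
  have disj: "arcs v x v \<inter> arcs v y v = {}"
  proof (rule ccontr)
    assume "arcs v x v \<inter> arcs v y v \<noteq> {}"
    then obtain z k k' where "k \<in> H" "k v = v" "k x = z" "k' \<in> H" "k' v = v" "k' y = z"
      by (auto simp: arcs_def)
    then have "finv k' \<circ> k \<in> H" "(finv k' \<circ> k) v = v" "(finv k' \<circ> k) x = y"
      using comp_mem inv_mem inv_apply(1)[of k' v] inv_apply(1)[of k' y] by auto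
    then show False using no by blast
  qed
  have "card (arcs v x v) + card (arcs v y v) = card (arcs v x v \<union> arcs v y v)"
    using disj finite_arcs x y by (simp add: card_Un_disjoint)
  also have "\<dots> \<le> card (nbrs v)"
    using arcs_subset_nbrs[OF x, of v] arcs_subset_nbrs[OF y, of v] finite_nbrs[of v]
    by (intro card_mono) auto
  finally have le: "card (arcs v x v) + card (arcs v y v) \<le> d" by (simp add: card_nbrs)
  have "\<exists>b. adj v b \<and> card (arcs v b v) \<le> d - 2"
  proof (cases "card (arcs v x v) \<le> d - 2")
    case False
    then have "card (arcs v y v) \<le> d - 2" using le degree by linarith
    then show ?thesis using y by blast
  qed (use x in blast)
  then obtain b where b: "adj v b" "card (arcs v b v) \<le> d - 2" by blast
  define N where "N = arcs v b"
  have N_adj: "w \<in> N u \<Longrightarrow> adj u w" for u w using arcs_subset_nbrs[OF b(1), of u] by (auto simp: N_def)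
  have avoid: "\<exists>w. adj z w \<and> w \<noteq> u \<and> w \<notin> N z" for u z
  proof (rule ccontr)
    assume "\<not> ?thesis"
    then have "nbrs z \<subseteq> insert u (N z)" by blast
    then have "card (nbrs z) \<le> card (insert u (N z))"
      using finite_arcs[OF b(1)] by (intro card_mono) (auto simp: N_def)
    also have "\<dots> \<le> Suc (card (N z))" by (simp add: card_insert_le_m1 card_insert_if finite_arcs[OF b(1)] N_def)
    also have "\<dots> \<le> d - 1" using b(2) card_arcs[of v b z v] degree by (simp add: N_def)
    finally show False using card_nbrs degree by simp
  qed
  obtain r where r: "r \<in> geodesic_rays adj" "\<And>n. r (Suc n) \<notin> N (r n)"
  proof -
    obtain w where "adj v w" "w \<notin> N v" using avoid by blast
    then have "\<exists>r\<in>geodesic_rays adj. \<forall>n. (adj (r n) (r (Suc n)) \<and> r (Suc n) \<notin> N (r n)) \<and> True"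
      using avoid by (intro exists_ray[of "\<lambda>u w. adj u w \<and> w \<notin> N u"]) auto
    then show ?thesis using that by blast
  qed
  obtain s where s: "s \<in> geodesic_rays adj" "\<And>n. s (Suc n) \<in> N (s n) \<or> s (Suc (Suc n)) \<in> N (s (Suc n))"
  proof (cases "\<forall>u w. w \<in> N u \<longrightarrow> N w - {u} \<noteq> {}")
    case True
    have "\<exists>s\<in>geodesic_rays adj. \<forall>n. s (Suc n) \<in> N (s n) \<and> True"
    proof (rule exists_ray[of "\<lambda>u w. w \<in> N u"])
      show "b \<in> N v" using self by (simp add: N_def)
      fix u w assume "w \<in> N u"
      then show "adj u w \<and> (\<exists>z. adj w z \<and> z \<noteq> u \<and> z \<in> N w \<and> True)" using True N_adj by blast
    qed
    then show ?thesis using that by blast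
  next
    case False
    \<comment> \<open>Every arc of the colour is followed only by its own reverse, so the colour is symmetric and each
      vertex is on exactly one edge of it; the ray alternates.\<close>
    then obtain u\<^sub>1 w\<^sub>1 where uw: "w\<^sub>1 \<in> N u\<^sub>1" "N w\<^sub>1 \<subseteq> {u\<^sub>1}" by auto
    then have Nw1: "N w\<^sub>1 = {u\<^sub>1}" using arcs_nonempty[of v b w\<^sub>1] by (auto simp: N_def)
    have symm: "u \<in> N w" if w: "w \<in> N u" for u w
    proof -
      obtain h where h: "h \<in> H" "h v = u" "h b = w" using w by (auto simp: N_def arcs_def)
      obtain h\<^sub>1 where h1: "h\<^sub>1 \<in> H" "h\<^sub>1 v = u\<^sub>1" "h\<^sub>1 b = w\<^sub>1" using uw by (auto simp: N_def arcs_def)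
      have "v \<in> N b" using arcs_aut[OF h1(1), of v v b b] Nw1 h1 by (simp add: N_def)
      then show ?thesis using arcs_aut[OF h(1), of v v b b] h by (simp add: N_def)
    qed
    have "\<exists>s\<in>geodesic_rays adj. \<forall>n. adj (s n) (s (Suc n)) \<and>
        (s (Suc n) \<in> N (s n) \<or> s (Suc (Suc n)) \<in> N (s (Suc n)))"
    proof (rule exists_ray)
      show "adj v b" by (rule b(1))
      fix u w assume uw': "adj u w"
      have "\<exists>z. adj w z \<and> z \<noteq> u \<and> (w \<in> N u \<or> z \<in> N w)"
      proof (cases "w \<in> N u")
        case True
        then show ?thesis using avoid by blast
      next
        case False
        obtain z where "z \<in> N w" using arcs_nonempty[of v b w] by (auto simp: N_def)
        then show ?thesis using symm False N_adj by blast
      qed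
      then show "adj u w \<and> (\<exists>z. adj w z \<and> z \<noteq> u \<and> adj w z \<and> (w \<in> N u \<or> z \<in> N w))" using uw' by blast
    qed
    then show ?thesis using that by blast
  qed
  obtain h m n where h: "h \<in> H" "\<And>k. h (r (m + k)) = s (n + k)"
    using boundary_transitive_rays[OF bt r(1) s(1)] by blast
  have "s (n + Suc k) \<notin> N (s (n + k))" for k
    using arcs_aut[OF h(1), of "r (m + Suc k)" v b "r (m + k)"] r(2)[of "m + k"] h(2)[of "Suc k"] h(2)[of k]
    by (simp add: N_def)
  from this[of 0] this[of 1] show False using s(2)[of n] by simp
qed

end

section \<open>Topological groups, Haar measure and unitary representations\<close>

lemma (in group) mult_inv_cancel:
  "a \<in> carrier G \<Longrightarrow> x \<in> carrier G \<Longrightarrow> inv a \<otimes> (a \<otimes> x) = x"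
  "a \<in> carrier G \<Longrightarrow> x \<in> carrier G \<Longrightarrow> a \<otimes> (inv a \<otimes> x) = x"
  by (simp_all add: m_assoc[symmetric])

locale top_group =
  fixes G :: "('g, 'm) monoid_scheme" (structure) and T :: "'g topology"
  assumes topological: "topological_group G T"
begin

sublocale group G
  using topological by (simp add: topological_group_def)

lemma topspace_T: "topspace T = carrier G"
  using topological by (simp add: topological_group_def)

lemma openin_subset_carrier: "openin T U \<Longrightarrow> U \<subseteq> carrier G"
  using openin_subset topspace_T by fastforce

lemma continuous_translate:
  assumes "g \<in> carrier G" shows "continuous_map T T (\<lambda>x. g \<otimes> x)"
proof -
  have "continuous_map T (prod_topology T T) (\<lambda>x. (g, x))"
    using assms topspace_T by (intro continuous_map_pairedI) (auto simp: continuous_map_const)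
  moreover have "continuous_map (prod_topology T T) T (\<lambda>(x, y). x \<otimes> y)"
    using topological by (simp add: topological_group_def)
  ultimately have "continuous_map T T ((\<lambda>(x, y). x \<otimes> y) \<circ> (\<lambda>x. (g, x)))"
    by (rule continuous_map_compose)
  then show ?thesis by (simp add: o_def)
qed

lemma continuous_translate_right:
  assumes "g \<in> carrier G" shows "continuous_map T T (\<lambda>x. x \<otimes> g)"
proof -
  have "continuous_map T (prod_topology T T) (\<lambda>x. (x, g))"
    using assms topspace_T by (intro continuous_map_pairedI) (auto simp: continuous_map_const)
  moreover have "continuous_map (prod_topology T T) T (\<lambda>(x, y). x \<otimes> y)"
    using topological by (simp add: topological_group_def)
  ultimately have "continuous_map T T ((\<lambda>(x, y). x \<otimes> y) \<circ> (\<lambda>x. (x, g)))"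
    by (rule continuous_map_compose)
  then show ?thesis by (simp add: o_def)
qed

lemma openin_translate:
  assumes g: "g \<in> carrier G" and U: "openin T U"
  shows "openin T ((\<lambda>x. g \<otimes> x) ` U)"
proof -
  have "(\<lambda>x. g \<otimes> x) ` U = {x \<in> topspace T. inv g \<otimes> x \<in> U}"
  proof (intro equalityI subsetI)
    fix x assume "x \<in> {x \<in> topspace T. inv g \<otimes> x \<in> U}"
    then show "x \<in> (\<lambda>x. g \<otimes> x) ` U"
      using g by (intro image_eqI[of _ _ "inv g \<otimes> x"]) (auto simp: topspace_T mult_inv_cancel)
  qed (use g openin_subset_carrier[OF U] in \<open>auto simp: topspace_T mult_inv_cancel subset_iff\<close>)
  then show ?thesis
    using continuous_translate[of "inv g"] g U by (simp add: continuous_map_def)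
qed

end

locale haar_group = top_group G T
  for G :: "('g, 'm) monoid_scheme" (structure) and T :: "'g topology" +
  fixes \<mu> :: "'g measure"
  assumes haar: "left_haar_measure G T \<mu>"
begin

lemma space_haar: "space \<mu> = carrier G"
  using haar by (simp add: left_haar_measure_def)

lemma open_measurable: "openin T U \<Longrightarrow> U \<in> sets \<mu>"
  using haar by (auto simp: left_haar_measure_def)

lemma continuous_measurable_map:
  assumes "continuous_map T T f" shows "f \<in> measurable \<mu> \<mu>"
proof -
  have s: "sets \<mu> = sigma_sets (carrier G) {U. openin T U}"
    using haar by (simp add: left_haar_measure_def)
  show ?thesis
  proof (rule measurable_sigma_sets[OF s])
    show "f \<in> space \<mu> \<rightarrow> carrier G"
      using continuous_map_image_subset_topspace[OF assms] by (auto simp: space_haar topspace_T)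
    fix U assume "U \<in> {U. openin T U}"
    then have "openin T {x \<in> topspace T. f x \<in> U}" using assms by (simp add: continuous_map_def)
    then show "f -` U \<inter> space \<mu> \<in> sets \<mu>"
      using open_measurable by (simp add: space_haar topspace_T vimage_def Int_def conj_commute)
  qed (auto dest: openin_subset_carrier)
qed

lemma continuous_measurable:
  fixes f :: "'g \<Rightarrow> 'b::topological_space"
  assumes "continuous_map T euclidean f" shows "f \<in> borel_measurable \<mu>"
proof (rule borel_measurableI)
  fix S :: "'b set" assume "open S"
  then have "openin T {x \<in> topspace T. f x \<in> S}" using assms by (simp add: continuous_map_def)
  then show "f -` S \<inter> space \<mu> \<in> sets \<mu>"
    using open_measurable by (simp add: space_haar topspace_T vimage_def Int_def conj_commute)
qed

lemma haar_translate:
  assumes "g \<in> carrier G" "A \<in> sets \<mu>"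
  shows "emeasure \<mu> ((\<lambda>x. g \<otimes> x) ` A) = emeasure \<mu> A"
  using haar assms by (simp add: left_haar_measure_def)

lemma haar_finite_compact: "compactin T K \<Longrightarrow> emeasure \<mu> K < \<infinity>"
  using haar unfolding left_haar_measure_def by blast

lemma distr_translate:
  assumes g: "g \<in> carrier G" shows "distr \<mu> \<mu> (\<lambda>x. g \<otimes> x) = \<mu>"
proof (rule measure_eqI)
  fix A assume "A \<in> sets (distr \<mu> \<mu> (\<lambda>x. g \<otimes> x))"
  then have A: "A \<in> sets \<mu>" by simp
  then have sub: "A \<subseteq> carrier G" using sets.sets_into_space space_haar by blast
  have "(\<lambda>x. g \<otimes> x) -` A \<inter> space \<mu> = (\<lambda>x. inv g \<otimes> x) ` A"
  proof (intro equalityI subsetI)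
    fix x assume "x \<in> (\<lambda>x. g \<otimes> x) -` A \<inter> space \<mu>"
    then show "x \<in> (\<lambda>x. inv g \<otimes> x) ` A"
      using g by (intro image_eqI[of _ _ "g \<otimes> x"]) (auto simp: space_haar m_assoc[symmetric])
  qed (use g sub in \<open>auto simp: space_haar m_assoc[symmetric]\<close>)
  then show "emeasure (distr \<mu> \<mu> (\<lambda>x. g \<otimes> x)) A = emeasure \<mu> A"
    using A g haar_translate[of "inv g" A] continuous_measurable_map[OF continuous_translate[OF g]]
    by (simp add: emeasure_distr)
qed simp

lemma integral_translate:
  fixes f :: "'g \<Rightarrow> complex"
  assumes g: "g \<in> carrier G" and f: "f \<in> borel_measurable \<mu>"
  shows "(\<integral>x. f (g \<otimes> x) \<partial>\<mu>) = (\<integral>x. f x \<partial>\<mu>)"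
  using integral_distr[OF continuous_measurable_map[OF continuous_translate[OF g]] f]
  by (simp add: distr_translate[OF g])

text \<open>
  A compact set is covered by finitely many translates of a non-empty open set. If the latter were a null set, then so
  would be all compact sets and, by inner regularity, the group.
\<close>

lemma haar_open_pos:
  assumes U: "openin T U" "U \<noteq> {}"
  shows "emeasure \<mu> U \<noteq> 0"
proof
  assume 0: "emeasure \<mu> U = 0"
  obtain u where u: "u \<in> U" "u \<in> carrier G" using U openin_subset_carrier by blast
  have "emeasure \<mu> C = 0" if C: "compactin T C" for C
  proof -
    let ?V = "\<lambda>c. (\<lambda>x. (c \<otimes> inv u) \<otimes> x) ` U"
    have Vopen: "openin T (?V c)" if "c \<in> carrier G" for c
      using that u U(1) by (intro openin_translate) auto
    have Csub: "C \<subseteq> carrier G" using compactin_subset_topspace[OF C] topspace_T by simp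
    have "C \<subseteq> \<Union>(?V ` C)"
    proof
      fix c assume c: "c \<in> C"
      have "c = (c \<otimes> inv u) \<otimes> u" using c Csub u by (auto simp: m_assoc)
      then have "c \<in> ?V c" using u by blast
      then show "c \<in> \<Union>(?V ` C)" using c by blast
    qed
    then obtain \<F> where F: "finite \<F>" "\<F> \<subseteq> ?V ` C" "C \<subseteq> \<Union>\<F>"
      using compactinD[OF C, of "?V ` C"] Vopen Csub by blast
    have null: "A \<in> null_sets \<mu>" if A: "A \<in> \<F>" for A
    proof -
      obtain c where c: "c \<in> C" "A = ?V c" using F(2) A by (auto simp: image_iff dest!: subsetD)
      then have "emeasure \<mu> A = emeasure \<mu> U"
        using haar_translate[of "c \<otimes> inv u" U] open_measurable[OF U(1)] Csub u by auto
      moreover have "A \<in> sets \<mu>" using Vopen[of c] c Csub open_measurable by blast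
      ultimately show ?thesis using 0 by (simp add: null_sets_def)
    qed
    have "\<Union>\<F> \<in> null_sets \<mu>" using F(1) null by (intro null_sets.finite_Union) auto
    then show ?thesis using F(3) by (metis null_setsD1 null_setsD2 emeasure_mono le_zero_eq)
  qed
  moreover have "openin T (carrier G)" using topspace_T by (metis openin_topspace)
  then have "emeasure \<mu> (carrier G) = (SUP C\<in>{C. compactin T C \<and> C \<subseteq> carrier G}. emeasure \<mu> C)"
    using haar unfolding left_haar_measure_def by blast
  ultimately have "emeasure \<mu> (carrier G) \<le> 0" by (simp only:) (rule SUP_least, simp)
  then show False using haar by (simp add: left_haar_measure_def)
qed

end

text \<open>
  Most of the calculus of a unitary representation does not refer to a topology of the group. It is
  separated from strong continuity, since the representations constructed below are first given as operators.
\<close>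

locale unitary_operators = group G + hilbert E
  for G :: "('g, 'm) monoid_scheme" (structure) and E :: "'v::complex_vector hspace" +
  fixes \<rho> :: "'g \<Rightarrow> 'v \<Rightarrow> 'v"
  assumes rep_unitary: "g \<in> carrier G \<Longrightarrow> unitary_map E E (\<rho> g)"
    and rep_mult: "g \<in> carrier G \<Longrightarrow> h \<in> carrier G \<Longrightarrow> v \<in> hcarrier E \<Longrightarrow> \<rho> (g \<otimes> h) v = \<rho> g (\<rho> h v)"
begin

lemma rep_mem [simp]: "g \<in> carrier G \<Longrightarrow> v \<in> hcarrier E \<Longrightarrow> \<rho> g v \<in> hcarrier E"
  using rep_unitary unfolding unitary_map_def by (meson bij_betwE)

lemma rep_add: "g \<in> carrier G \<Longrightarrow> u \<in> hcarrier E \<Longrightarrow> v \<in> hcarrier E \<Longrightarrow> \<rho> g (u + v) = \<rho> g u + \<rho> g v"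
  and rep_scale: "g \<in> carrier G \<Longrightarrow> v \<in> hcarrier E \<Longrightarrow> \<rho> g (a *\<^sub>C v) = a *\<^sub>C \<rho> g v"
  and rep_inner: "g \<in> carrier G \<Longrightarrow> u \<in> hcarrier E \<Longrightarrow> v \<in> hcarrier E \<Longrightarrow>
    hinner E (\<rho> g u) (\<rho> g v) = hinner E u v"
  using rep_unitary unfolding unitary_map_def by blast+

lemma rep_norm: "g \<in> carrier G \<Longrightarrow> v \<in> hcarrier E \<Longrightarrow> hnorm E (\<rho> g v) = hnorm E v"
  by (simp add: hnorm_def rep_inner)

lemma rep_zero: "g \<in> carrier G \<Longrightarrow> \<rho> g 0 = 0"
  using rep_scale[of g 0 0] by simp

lemma rep_diff: "g \<in> carrier G \<Longrightarrow> u \<in> hcarrier E \<Longrightarrow> v \<in> hcarrier E \<Longrightarrow> \<rho> g (u - v) = \<rho> g u - \<rho> g v"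
  using rep_add[of g "u - v" v] by simp

lemma rep_sum:
  "g \<in> carrier G \<Longrightarrow> (\<And>i. i \<in> I \<Longrightarrow> x i \<in> hcarrier E) \<Longrightarrow> \<rho> g (sum x I) = (\<Sum>i\<in>I. \<rho> g (x i))"
  by (induction I rule: infinite_finite_induct) (auto simp: rep_add rep_zero)

lemma rep_one: "v \<in> hcarrier E \<Longrightarrow> \<rho> \<one> v = v"
proof -
  assume v: "v \<in> hcarrier E"
  have "\<rho> \<one> (\<rho> \<one> v) = \<rho> \<one> v" using rep_mult[of \<one> \<one> v] v by simp
  moreover have "inj_on (\<rho> \<one>) (hcarrier E)"
    using rep_unitary[of \<one>] by (simp add: unitary_map_def bij_betw_def)
  ultimately show ?thesis using v by (meson inj_onD one_closed rep_mem)
qed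

lemma rep_inv: "g \<in> carrier G \<Longrightarrow> v \<in> hcarrier E \<Longrightarrow> \<rho> (inv g) (\<rho> g v) = v"
  "g \<in> carrier G \<Longrightarrow> v \<in> hcarrier E \<Longrightarrow> \<rho> g (\<rho> (inv g) v) = v"
  using rep_mult[of "inv g" g v] rep_mult[of g "inv g" v] rep_one by auto

lemma rep_adjoint:
  "g \<in> carrier G \<Longrightarrow> u \<in> hcarrier E \<Longrightarrow> v \<in> hcarrier E \<Longrightarrow>
    hinner E (\<rho> g u) v = hinner E u (\<rho> (inv g) v)"
  using rep_inner[of g u "\<rho> (inv g) v"] by (simp add: rep_inv)

end

locale unitary_representation =
  fixes G :: "('g, 'm) monoid_scheme" (structure) and T :: "'g topology"
    and E :: "'v::complex_vector hspace" and \<rho> :: "'g \<Rightarrow> 'v \<Rightarrow> 'v"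
  assumes group: "Group.group G" and topspace_eq: "topspace T = carrier G"
    and unitary: "unitary_rep G T E \<rho>"
begin

sublocale unitary_operators G E \<rho>
  using group unitary
  by (intro unitary_operators.intro unitary_operators_axioms.intro) (auto simp: unitary_rep_def hilbert_space_iff)

lemma rep_continuous: "v \<in> hcarrier E \<Longrightarrow> continuous_map T (htopology E) (\<lambda>g. \<rho> g v)"
  using unitary by (simp add: unitary_rep_def)

lemma coefficient_continuous:
  assumes v: "v \<in> hcarrier E" and w: "w \<in> hcarrier E"
  shows "continuous_map T euclidean (\<lambda>g. hinner E (\<rho> g v) w)"
proof -
  have "\<exists>U. openin T U \<and> g \<in> U \<and> (\<forall>h\<in>U. hinner E (\<rho> h v) w \<in> ball (hinner E (\<rho> g v) w) \<epsilon>)"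
    if g: "g \<in> topspace T" and e: "\<epsilon> > 0" for g \<epsilon>
  proof -
    define \<delta> where "\<delta> = \<epsilon> / (hnorm E w + 1)"
    have w1: "hnorm E w + 1 > 0" using norm_nonneg[OF w] by linarith
    have \<delta>: "\<delta> > 0" using e w1 by (simp add: \<delta>_def)
    obtain U where U: "openin T U" "g \<in> U" "\<forall>h\<in>U. hnorm E (\<rho> h v - \<rho> g v) < \<delta>"
      using rep_continuous[OF v, unfolded continuous_map_iff, THEN conjunct2, rule_format, OF g \<delta>]
      by (elim exE conjE)
    have "hinner E (\<rho> h v) w \<in> ball (hinner E (\<rho> g v) w) \<epsilon>" if h: "h \<in> U" for h
    proof -
      have hg: "h \<in> carrier G" "g \<in> carrier G" using h g openin_subset[OF U(1)] topspace_eq by auto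
      have "cmod (hinner E (\<rho> h v) w - hinner E (\<rho> g v) w) = cmod (hinner E (\<rho> h v - \<rho> g v) w)"
        using hg v w by (simp add: inner_diff_left)
      also have "\<dots> \<le> hnorm E (\<rho> h v - \<rho> g v) * hnorm E w"
        using hg v w by (intro Cauchy_Schwarz) auto
      also have "\<dots> \<le> hnorm E (\<rho> h v - \<rho> g v) * (hnorm E w + 1)"
        using hg v by (intro mult_left_mono) auto
      also have "\<dots> < \<delta> * (hnorm E w + 1)"
        using U h w1 by (intro mult_strict_right_mono) auto
      also have "\<dots> = \<epsilon>" using w1 by (simp add: \<delta>_def)
      finally show ?thesis by (simp add: dist_norm Real_Vector_Spaces.norm_minus_commute)
    qed
    with U show ?thesis by blast
  qed
  then show ?thesis
    unfolding Met_TC.continuous_map_to_metric[unfolded mtopology_is_euclidean] mball_eq_ball by blast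
qed

end

section \<open>Averaging over a compact open subgroup\<close>

lemma norm_integral_le:
  fixes f :: "'x \<Rightarrow> complex"
  assumes "integrable M f" "integrable M g" "\<And>x. x \<in> space M \<Longrightarrow> norm (f x) \<le> g x"
  shows "norm (\<integral>x. f x \<partial>M) \<le> (\<integral>x. g x \<partial>M)"
proof -
  have "norm (\<integral>x. f x \<partial>M) \<le> (\<integral>x. norm (f x) \<partial>M)" by (rule integral_norm_bound)
  also have "\<dots> \<le> (\<integral>x. g x \<partial>M)" using assms by (intro integral_mono) auto
  finally show ?thesis .
qed

locale haar_representation = haar_group G T \<mu> + unitary_representation G T E \<rho>
  for G :: "('g, 'm) monoid_scheme" (structure) and T :: "'g topology" and \<mu> :: "'g measure"
    and E :: "'v::complex_vector hspace" and \<rho> :: "'g \<Rightarrow> 'v \<Rightarrow> 'v" +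
  fixes K :: "'g set"
  assumes K_subgroup: "subgroup K G" and K_open: "openin T K" and K_compact: "compactin T K"
begin

lemma K_carrier: "k \<in> K \<Longrightarrow> k \<in> carrier G"
  using K_subgroup subgroup.mem_carrier by fast

lemma K_sets [simp]: "K \<in> sets \<mu>"
  by (rule open_measurable[OF K_open])

lemma K_finite: "emeasure \<mu> K < \<infinity>"
  by (rule haar_finite_compact[OF K_compact])

lemma K_pos: "0 < measure \<mu> K"
proof -
  have "emeasure \<mu> K \<noteq> 0"
    using haar_open_pos[OF K_open] subgroup.one_closed[OF K_subgroup] by blast
  then show ?thesis using K_finite by (simp add: measure_def enn2real_positive_iff zero_less_iff_neq_zero)
qed

lemma K_translate_mem: "k \<in> K \<Longrightarrow> g \<in> carrier G \<Longrightarrow> k \<otimes> g \<in> K \<longleftrightarrow> g \<in> K"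
  using subgroup.m_closed[OF K_subgroup, of k g] K_carrier[of k]
    subgroup.m_closed[OF K_subgroup subgroup.m_inv_closed[OF K_subgroup, of k], of "k \<otimes> g"]
  by (auto simp: m_assoc[symmetric])

lemma coefficient_measurable:
  "v \<in> hcarrier E \<Longrightarrow> w \<in> hcarrier E \<Longrightarrow> (\<lambda>g. hinner E (\<rho> g v) w) \<in> borel_measurable \<mu>"
  by (rule continuous_measurable[OF coefficient_continuous])

lemma coefficient_bound:
  "g \<in> carrier G \<Longrightarrow> v \<in> hcarrier E \<Longrightarrow> w \<in> hcarrier E \<Longrightarrow>
    cmod (hinner E (\<rho> g v) w) \<le> hnorm E v * hnorm E w"
  using Cauchy_Schwarz[of "\<rho> g v" w] by (simp add: rep_norm)

lemma coset_eq:
  assumes g: "g \<in> carrier G" shows "(\<lambda>k. g \<otimes> k) ` K = {x \<in> carrier G. inv g \<otimes> x \<in> K}"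
proof (intro equalityI subsetI)
  fix x assume "x \<in> {x \<in> carrier G. inv g \<otimes> x \<in> K}"
  then show "x \<in> (\<lambda>k. g \<otimes> k) ` K"
    using g by (intro image_eqI[of _ _ "inv g \<otimes> x"]) (auto simp: m_assoc[symmetric])
qed (use g K_carrier in \<open>auto simp: m_assoc[symmetric]\<close>)

lemma coset_measurable: "g \<in> carrier G \<Longrightarrow> (\<lambda>k. g \<otimes> k) ` K \<in> sets \<mu>"
  by (intro open_measurable openin_translate K_open)

text \<open>The functional represented by the average of the orbit of \<open>v\<close> under \<open>K\<close>.\<close>

definition kmean :: "'v \<Rightarrow> 'v \<Rightarrow> complex" where
  "kmean v w = (\<integral>k. indicator K k *\<^sub>R hinner E (\<rho> k v) w \<partial>\<mu>) / of_real (measure \<mu> K)"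

lemma coefficient_integrable_on:
  assumes A: "A \<in> sets \<mu>" "emeasure \<mu> A < \<infinity>" and v: "v \<in> hcarrier E" and w: "w \<in> hcarrier E"
  shows "integrable \<mu> (\<lambda>k. indicator A k *\<^sub>R hinner E (\<rho> k v) w)"
proof (rule integrableI_bounded_set_indicator[where B = "hnorm E v * hnorm E w"])
  show "AE x in \<mu>. x \<in> A \<longrightarrow> norm (hinner E (\<rho> x v) w) \<le> hnorm E v * hnorm E w"
    using coefficient_bound[OF _ v w] by (intro AE_I2) (simp add: space_haar)
qed (use A coefficient_measurable[OF v w] in auto)

text \<open>
  A finite open cover of \<open>K\<close> is made disjoint by removing from each set those that come before it.
\<close>

lemma measure_cover:
  assumes F: "finite \<F>" "\<And>A. A \<in> \<F> \<Longrightarrow> openin T A" "K \<subseteq> \<Union>\<F>"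
  obtains P where "\<And>A. A \<in> \<F> \<Longrightarrow> P A \<in> sets \<mu> \<and> P A \<subseteq> A \<inter> K"
    "\<And>k. k \<in> K \<Longrightarrow> \<exists>!A. A \<in> \<F> \<and> k \<in> P A"
proof -
  obtain n and e :: "nat \<Rightarrow> 'g set" where e: "\<F> = e ` {i. i < n}" "inj_on e {i. i < n}"
    using finite_imp_nat_seg_image_inj_on[OF F(1)] by blast
  define idx where "idx A = (THE i. i < n \<and> e i = A)" for A
  have idx: "idx (e i) = i" if "i < n" for i
    unfolding idx_def using that e(2) by (auto simp: inj_on_def)
  define P where "P A = K \<inter> A - (\<Union>j<idx A. e j)" for A
  show ?thesis
  proof (rule that[of P])
    fix A assume A: "A \<in> \<F>"
    then obtain i where i: "i < n" "A = e i" using e by auto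
    have "e j \<in> sets \<mu>" if "j \<le> i" for j using that i e F(2) open_measurable by auto
    then show "P A \<in> sets \<mu> \<and> P A \<subseteq> A \<inter> K"
      using i by (auto simp: P_def idx intro!: sets.Diff sets.Int sets.finite_UN)
  next
    fix k assume k: "k \<in> K"
    then obtain i0 where i0: "i0 < n" "k \<in> e i0" using F(3) e by auto
    define i where "i = (LEAST i. k \<in> e i)"
    have i: "k \<in> e i" "i \<le> i0" "\<And>j. j < i \<Longrightarrow> k \<notin> e j"
      unfolding i_def using i0(2) by (auto intro: LeastI Least_le dest: not_less_Least)
    show "\<exists>!A. A \<in> \<F> \<and> k \<in> P A"
    proof (intro ex1I conjI)
      show "e i \<in> \<F>" using i i0 e by auto
      show "k \<in> P (e i)" using i i0 k by (auto simp: P_def idx)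
      fix A assume A: "A \<in> \<F> \<and> k \<in> P A"
      then obtain j where j: "j < n" "A = e j" using e by auto
      then have "k \<in> e j" "\<forall>l<j. k \<notin> e l" using A by (auto simp: P_def idx)
      then have "j = i" using i by (metis linorder_neqE_nat)
      then show "A = e i" using j by simp
    qed
  qed
qed

text \<open>
  Riemann sums for the average: on a sufficiently fine finite partition of the compact set \<open>K\<close> the
  orbit map is almost constant.
\<close>

lemma kmean_approx:
  assumes v: "v \<in> hcarrier E" and e: "\<epsilon> > 0"
  shows "\<exists>x\<in>hcarrier E. \<forall>w\<in>hcarrier E. cmod (hinner E x w - kmean v w) \<le> \<epsilon> * hnorm E w"
proof -
  have "\<exists>U. openin T U \<and> c \<in> U \<and> (\<forall>g\<in>U. hnorm E (\<rho> g v - \<rho> c v) < \<epsilon>)" if c: "c \<in> K" for c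
  proof -
    have c': "c \<in> topspace T" using c K_carrier by (simp add: topspace_T)
    show ?thesis
      using rep_continuous[OF v, unfolded continuous_map_iff, THEN conjunct2, rule_format, OF c' e] .
  qed
  then obtain U where U: "\<And>c. c \<in> K \<Longrightarrow> openin T (U c)" "\<And>c. c \<in> K \<Longrightarrow> c \<in> U c"
    "\<And>c g. c \<in> K \<Longrightarrow> g \<in> U c \<Longrightarrow> hnorm E (\<rho> g v - \<rho> c v) < \<epsilon>" by metis
  have "K \<subseteq> \<Union>(U ` K)" using U(2) by blast
  then obtain \<F> where F: "finite \<F>" "\<F> \<subseteq> U ` K" "K \<subseteq> \<Union>\<F>"
    using compactinD[OF K_compact, of "U ` K"] U(1) by blast
  then have "\<exists>c. c \<in> K \<and> A \<subseteq> U c" if "A \<in> \<F>" for A using that by blast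
  then obtain c where c: "\<And>A. A \<in> \<F> \<Longrightarrow> c A \<in> K" "\<And>A. A \<in> \<F> \<Longrightarrow> A \<subseteq> U (c A)" by metis
  have Fopen: "openin T A" if "A \<in> \<F>" for A using F(2) U(1) that by blast
  obtain P where P: "\<And>A. A \<in> \<F> \<Longrightarrow> P A \<in> sets \<mu> \<and> P A \<subseteq> A \<inter> K"
    "\<And>k. k \<in> K \<Longrightarrow> \<exists>!A. A \<in> \<F> \<and> k \<in> P A"
    using measure_cover[OF F(1) Fopen F(3)] by metis
  have Pfin: "emeasure \<mu> (P A) < \<infinity>" if "A \<in> \<F>" for A
    using P(1)[OF that] K_finite emeasure_mono[of "P A" K \<mu>] by (simp add: le_less_trans)
  have cE: "\<rho> (c A) v \<in> hcarrier E" if "A \<in> \<F>" for A using c(1)[OF that] K_carrier v by simp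
  define m where "m = measure \<mu> K"
  have m: "m > 0" using K_pos by (simp add: m_def)
  define x where "x = (\<Sum>A\<in>\<F>. of_real (measure \<mu> (P A) / m) *\<^sub>C \<rho> (c A) v)"
  have x: "x \<in> hcarrier E" unfolding x_def using cE by (intro sum_mem) auto
  have "cmod (hinner E x w - kmean v w) \<le> \<epsilon> * hnorm E w" if w: "w \<in> hcarrier E" for w
  proof -
    let ?f = "\<lambda>k. indicator K k *\<^sub>R hinner E (\<rho> k v) w"
    let ?g = "\<lambda>k. \<Sum>A\<in>\<F>. indicator (P A) k *\<^sub>R hinner E (\<rho> (c A) v) w"
    have fi: "integrable \<mu> ?f" using K_finite v w by (intro coefficient_integrable_on) auto
    have gi1: "integrable \<mu> (\<lambda>k. indicator (P A) k *\<^sub>R hinner E (\<rho> (c A) v) w)" if "A \<in> \<F>" for A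
      using P(1)[OF that] Pfin[OF that] by (intro integrable_scaleR_left integrable_real_indicator) auto
    have gi: "integrable \<mu> ?g" using gi1 by (intro Bochner_Integration.integrable_sum)
    have "(\<integral>k. ?g k \<partial>\<mu>) = (\<Sum>A\<in>\<F>. measure \<mu> (P A) *\<^sub>R hinner E (\<rho> (c A) v) w)"
    proof -
      have "(\<integral>k. indicator (P A) k *\<^sub>R hinner E (\<rho> (c A) v) w \<partial>\<mu>) =
          measure \<mu> (P A) *\<^sub>R hinner E (\<rho> (c A) v) w" if A: "A \<in> \<F>" for A
      proof -
        have "integrable \<mu> (indicator (P A) :: 'g \<Rightarrow> real)"
          using P(1)[OF A] Pfin[OF A] by (intro integrable_real_indicator) auto
        moreover have "P A \<inter> space \<mu> = P A"
          using P(1)[OF A] sets.sets_into_space by blast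
        ultimately show ?thesis by simp
      qed
      then show ?thesis
        using gi1 by (subst Bochner_Integration.integral_sum) auto
    qed
    moreover have "hinner E x w = (\<Sum>A\<in>\<F>. measure \<mu> (P A) *\<^sub>R hinner E (\<rho> (c A) v) w) / of_real m"
      unfolding x_def using cE w
      by (simp add: inner_sum_left inner_scale_left sum_divide_distrib scaleR_conv_of_real)
    ultimately have "hinner E x w = (\<integral>k. ?g k \<partial>\<mu>) / of_real m" by simp
    then have eq: "hinner E x w - kmean v w = (\<integral>k. ?g k - ?f k \<partial>\<mu>) / of_real m"
      using fi gi by (simp add: kmean_def m_def diff_divide_distrib)
    have le: "cmod (\<integral>k. ?g k - ?f k \<partial>\<mu>) \<le> (\<integral>k. indicator K k * (\<epsilon> * hnorm E w) \<partial>\<mu>)"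
    proof (rule norm_integral_le)
      show "integrable \<mu> (\<lambda>k. indicator K k * (\<epsilon> * hnorm E w))"
        using K_finite by (intro integrable_mult_left integrable_real_indicator) auto
      fix k assume "k \<in> space \<mu>"
      show "norm (?g k - ?f k) \<le> indicator K k * (\<epsilon> * hnorm E w)"
      proof (cases "k \<in> K")
        case False
        then have "k \<notin> P A" if "A \<in> \<F>" for A using P(1)[OF that] by blast
        then have "?g k = 0" by (intro sum.neutral) auto
        then show ?thesis using False by simp
      next
        case True
        obtain A where A: "A \<in> \<F>" "k \<in> P A" "\<And>B. B \<in> \<F> \<Longrightarrow> k \<in> P B \<Longrightarrow> B = A"
          using P(2)[OF True] by (elim ex1E) blast
        have "?g k = (\<Sum>B\<in>\<F>. if B = A then hinner E (\<rho> (c A) v) w else 0)"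
        proof (rule sum.cong)
          fix B assume "B \<in> \<F>"
          then have "k \<in> P B \<longleftrightarrow> B = A" using A by blast
          then show "indicator (P B) k *\<^sub>R hinner E (\<rho> (c B) v) w =
              (if B = A then hinner E (\<rho> (c A) v) w else 0)" using A(2) by auto
        qed simp
        also have "\<dots> = hinner E (\<rho> (c A) v) w" using A(1) F(1) by simp
        finally have g: "?g k = hinner E (\<rho> (c A) v) w" .
        have kc: "\<rho> k v \<in> hcarrier E" using True K_carrier v by simp
        have "k \<in> U (c A)" using A(2) P(1)[OF A(1)] c(2)[OF A(1)] by blast
        then have lt: "hnorm E (\<rho> (c A) v - \<rho> k v) < \<epsilon>"
          using U(3)[OF c(1)[OF A(1)], of k] by (simp only: norm_minus_commute[OF kc cE[OF A(1)]])
        have "norm (?g k - ?f k) = cmod (hinner E (\<rho> (c A) v - \<rho> k v) w)"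
          unfolding g using True kc cE[OF A(1)] w by (simp add: inner_diff_left)
        also have "\<dots> \<le> hnorm E (\<rho> (c A) v - \<rho> k v) * hnorm E w"
          using kc cE[OF A(1)] w by (intro Cauchy_Schwarz) auto
        also have "\<dots> \<le> \<epsilon> * hnorm E w" using lt w by (intro mult_right_mono) auto
        finally show ?thesis using True by simp
      qed
    qed (use fi gi in auto)
    have int: "(\<integral>k. indicator K k * (\<epsilon> * hnorm E w) \<partial>\<mu>) = m * (\<epsilon> * hnorm E w)"
      using K_finite sets.sets_into_space[OF K_sets] by (simp add: m_def Int_absorb2)
    have "cmod (hinner E x w - kmean v w) * m = cmod (\<integral>k. ?g k - ?f k \<partial>\<mu>)"
      unfolding eq using m by (simp add: norm_divide)
    also have "\<dots> \<le> m * (\<epsilon> * hnorm E w)" using le unfolding int .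
    finally show ?thesis using m by (simp add: mult.commute)
  qed
  then show ?thesis using x by blast
qed

text \<open>
  The Riemann sums of finer and finer partitions form a Cauchy sequence; its limit represents the functional, so that
  no vector-valued integral has to be constructed.
\<close>

lemma kmean_represented:
  assumes v: "v \<in> hcarrier E"
  shows "\<exists>x\<in>hcarrier E. \<forall>w\<in>hcarrier E. hinner E x w = kmean v w"
proof -
  have "\<exists>x\<in>hcarrier E. \<forall>w\<in>hcarrier E. cmod (hinner E x w - kmean v w) \<le> inverse (real (Suc n)) * hnorm E w" for n
    using v by (intro kmean_approx) auto
  then obtain \<sigma> where s: "\<And>n. \<sigma> n \<in> hcarrier E"
    "\<And>n w. w \<in> hcarrier E \<Longrightarrow> cmod (hinner E (\<sigma> n) w - kmean v w) \<le> inverse (real (Suc n)) * hnorm E w"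
    by metis
  have d: "hnorm E (\<sigma> m - \<sigma> n) \<le> inverse (real (Suc m)) + inverse (real (Suc n))" for m n
  proof (rule norm_le_of_inner_le)
    fix w assume w: "w \<in> hcarrier E"
    have "hinner E (\<sigma> m - \<sigma> n) w = (hinner E (\<sigma> m) w - kmean v w) - (hinner E (\<sigma> n) w - kmean v w)"
      using s w by (simp add: inner_diff_left)
    then have "cmod (hinner E (\<sigma> m - \<sigma> n) w) \<le>
        cmod (hinner E (\<sigma> m) w - kmean v w) + cmod (hinner E (\<sigma> n) w - kmean v w)"
      by (simp only: norm_triangle_ineq4)
    then show "cmod (hinner E (\<sigma> m - \<sigma> n) w) \<le> (inverse (real (Suc m)) + inverse (real (Suc n))) * hnorm E w"
      using s(2)[OF w, of m] s(2)[OF w, of n] unfolding distrib_right by linarith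
  qed (use s in auto)
  have small: "\<exists>N. \<forall>n\<ge>N. inverse (real (Suc n)) < \<epsilon>" if e: "\<epsilon> > 0" for \<epsilon>
  proof -
    obtain N where N: "inverse (real (Suc N)) < \<epsilon>" using reals_Archimedean[OF e] by blast
    have "inverse (real (Suc n)) \<le> inverse (real (Suc N))" if "n \<ge> N" for n
      using that by (intro le_imp_inverse_le) auto
    then show ?thesis using N by (meson le_less_trans)
  qed
  obtain x where x: "x \<in> hcarrier E" "\<And>\<epsilon>. \<epsilon> > 0 \<Longrightarrow> \<exists>N. \<forall>n\<ge>N. hnorm E (\<sigma> n - x) < \<epsilon>"
  proof (rule Cauchy_converges[of \<sigma>])
    fix \<epsilon> :: real assume "\<epsilon> > 0"
    then obtain N where N: "\<forall>n\<ge>N. inverse (real (Suc n)) < \<epsilon> / 2" using small[of "\<epsilon> / 2"] by auto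
    have "hnorm E (\<sigma> m - \<sigma> n) < \<epsilon>" if "m \<ge> N" "n \<ge> N" for m n
    proof -
      have "inverse (real (Suc m)) < \<epsilon> / 2" "inverse (real (Suc n)) < \<epsilon> / 2" using N that by blast+
      then show ?thesis using d[of m n] by linarith
    qed
    then show "\<exists>N. \<forall>m\<ge>N. \<forall>n\<ge>N. hnorm E (\<sigma> m - \<sigma> n) < \<epsilon>" by blast
  qed (use s in auto)
  have "hinner E x w = kmean v w" if w: "w \<in> hcarrier E" for w
  proof -
    have le: "cmod (hinner E x w - kmean v w) \<le> \<epsilon>" if e: "\<epsilon> > 0" for \<epsilon>
    proof -
      define M where "M = hnorm E w + 1"
      have M: "M > 0" using norm_nonneg[OF w] by (simp add: M_def)
      define \<delta> where "\<delta> = \<epsilon> / 2 / M"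
      have \<delta>: "\<delta> > 0" using e M by (simp add: \<delta>_def)
      obtain N1 where N1: "\<forall>n\<ge>N1. inverse (real (Suc n)) < \<delta>" using small[OF \<delta>] by blast
      obtain N2 where N2: "\<forall>n\<ge>N2. hnorm E (\<sigma> n - x) < \<delta>" using x(2)[OF \<delta>] by blast
      define n where "n = max N1 N2"
      have n: "inverse (real (Suc n)) < \<delta>" "hnorm E (\<sigma> n - x) < \<delta>"
        using N1 N2 by (auto simp: n_def)
      have "hinner E x w - kmean v w = (hinner E (\<sigma> n) w - kmean v w) - hinner E (\<sigma> n - x) w"
        using s x(1) w by (simp add: inner_diff_left)
      then have "cmod (hinner E x w - kmean v w) \<le>
          cmod (hinner E (\<sigma> n) w - kmean v w) + cmod (hinner E (\<sigma> n - x) w)"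
        by (simp only: norm_triangle_ineq4)
      also have "\<dots> \<le> inverse (real (Suc n)) * hnorm E w + hnorm E (\<sigma> n - x) * hnorm E w"
        using s x(1) w by (intro add_mono Cauchy_Schwarz s(2)) auto
      also have "\<dots> \<le> \<delta> * hnorm E w + \<delta> * hnorm E w"
        using n w by (intro add_mono mult_right_mono) auto
      also have "\<dots> \<le> 2 * \<delta> * M" using \<delta> by (simp add: M_def algebra_simps)
      also have "\<dots> = \<epsilon>" using M by (simp add: \<delta>_def)
      finally show ?thesis .
    qed
    have "cmod (hinner E x w - kmean v w) \<le> 0" by (rule field_le_epsilon) (simp add: le)
    then show ?thesis by simp
  qed
  with x(1) show ?thesis by blast
qed

definition mean :: "'v \<Rightarrow> 'v" where
  "mean v = (SOME x. x \<in> hcarrier E \<and> (\<forall>w\<in>hcarrier E. hinner E x w = kmean v w))"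

lemma mean:
  assumes "v \<in> hcarrier E"
  shows mean_mem [simp]: "mean v \<in> hcarrier E"
    and inner_mean: "w \<in> hcarrier E \<Longrightarrow> hinner E (mean v) w = kmean v w"
proof -
  have "\<exists>x. x \<in> hcarrier E \<and> (\<forall>w\<in>hcarrier E. hinner E x w = kmean v w)"
    using kmean_represented[OF assms] by blast
  then have "mean v \<in> hcarrier E \<and> (\<forall>w\<in>hcarrier E. hinner E (mean v) w = kmean v w)"
    unfolding mean_def by (rule someI_ex)
  then show "mean v \<in> hcarrier E" "w \<in> hcarrier E \<Longrightarrow> hinner E (mean v) w = kmean v w" by auto
qed

definition invariants :: "'v set" where
  "invariants = {v \<in> hcarrier E. \<forall>k\<in>K. \<rho> k v = v}"

text \<open>
  By left invariance of the measure, moving the average by \<open>g\<close> is averaging over the coset \<open>g K\<close>.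
\<close>

lemma inner_translate_mean:
  assumes g: "g \<in> carrier G" and v: "v \<in> hcarrier E" and w: "w \<in> hcarrier E"
  shows "hinner E (\<rho> g (mean v)) w =
    (\<integral>h. indicator ((\<lambda>k. g \<otimes> k) ` K) h *\<^sub>R hinner E (\<rho> h v) w \<partial>\<mu>) / of_real (measure \<mu> K)"
proof -
  have ind: "indicator ((\<lambda>k. g \<otimes> k) ` K) (g \<otimes> k) = (indicator K k :: real)" if "k \<in> carrier G" for k
    using that g by (simp add: coset_eq indicator_def m_assoc[symmetric])
  have adj: "hinner E (\<rho> k v) (\<rho> (inv g) w) = hinner E (\<rho> (g \<otimes> k) v) w" if "k \<in> carrier G" for k
    using that g v w rep_adjoint[of g "\<rho> k v" w] by (simp add: rep_mult)
  have "hinner E (\<rho> g (mean v)) w = kmean v (\<rho> (inv g) w)"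
    using g v w by (simp add: rep_adjoint inner_mean)
  also have "\<dots> = (\<integral>k. indicator K k *\<^sub>R hinner E (\<rho> (g \<otimes> k) v) w \<partial>\<mu>) / of_real (measure \<mu> K)"
    unfolding kmean_def using adj
    by (intro arg_cong2[of _ _ _ _ "(/)"] Bochner_Integration.integral_cong refl) (simp add: space_haar)
  also have "(\<integral>k. indicator K k *\<^sub>R hinner E (\<rho> (g \<otimes> k) v) w \<partial>\<mu>) =
      (\<integral>k. indicator ((\<lambda>k. g \<otimes> k) ` K) (g \<otimes> k) *\<^sub>R hinner E (\<rho> (g \<otimes> k) v) w \<partial>\<mu>)"
    by (intro Bochner_Integration.integral_cong refl) (simp add: ind space_haar)
  also have "\<dots> = (\<integral>h. indicator ((\<lambda>k. g \<otimes> k) ` K) h *\<^sub>R hinner E (\<rho> h v) w \<partial>\<mu>)"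
  proof (rule integral_translate[OF g, of "\<lambda>h. indicator ((\<lambda>k. g \<otimes> k) ` K) h *\<^sub>R hinner E (\<rho> h v) w"])
    show "(\<lambda>h. indicator ((\<lambda>k. g \<otimes> k) ` K) h *\<^sub>R hinner E (\<rho> h v) w) \<in> borel_measurable \<mu>"
      using coset_measurable[OF g] coefficient_measurable[OF v w]
      by (intro borel_measurable_scaleR borel_measurable_indicator)
  qed
  finally show ?thesis .
qed

lemma invariants_mem: "u \<in> invariants \<Longrightarrow> u \<in> hcarrier E"
  and invariants_fixed: "u \<in> invariants \<Longrightarrow> k \<in> K \<Longrightarrow> \<rho> k u = u"
  by (auto simp: invariants_def)

lemma mean_invariant:
  assumes v: "v \<in> hcarrier E" shows "mean v \<in> invariants"
proof -
  have "\<rho> k (mean v) = mean v" if k: "k \<in> K" for k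
  proof (rule vector_eqI)
    fix w assume w: "w \<in> hcarrier E"
    have "(\<lambda>x. k \<otimes> x) ` K = K"
      using k K_carrier K_translate_mem[of "inv k"] subgroup.m_inv_closed[OF K_subgroup]
      by (auto simp: coset_eq)
    then show "hinner E (\<rho> k (mean v)) w = hinner E (mean v) w"
      using k K_carrier v w by (simp add: inner_translate_mean inner_mean kmean_def)
  qed (use k K_carrier v in auto)
  then show ?thesis using v by (simp add: invariants_def)
qed

text \<open>
  Together with the previous lemma this says that \<open>mean\<close> is the orthogonal projection onto the invariant vectors.
\<close>

lemma inner_mean_invariant:
  assumes v: "v \<in> hcarrier E" and u: "u \<in> invariants"
  shows "hinner E (mean v) u = hinner E v u"
proof -
  have uE: "u \<in> hcarrier E" using u by (rule invariants_mem)
  have "hinner E (\<rho> k v) u = hinner E v u" if k: "k \<in> K" for k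
  proof -
    have "hinner E (\<rho> k v) u = hinner E (\<rho> k v) (\<rho> k u)"
      using invariants_fixed[OF u k] by simp
    then show ?thesis using rep_inner[of k v u] k K_carrier v uE by simp
  qed
  then have "(\<lambda>k. indicator K k *\<^sub>R hinner E (\<rho> k v) u) = (\<lambda>k. indicator K k *\<^sub>R hinner E v u)"
    by (auto simp: indicator_def fun_eq_iff)
  then have "kmean v u = measure \<mu> K *\<^sub>R hinner E v u / of_real (measure \<mu> K)"
    unfolding kmean_def using K_finite sets.sets_into_space[OF K_sets] by (simp add: Int_absorb2)
  also have "\<dots> = hinner E v u" using K_pos by (simp add: scaleR_conv_of_real)
  finally show ?thesis using inner_mean[OF v uE] by simp
qed

lemma invariants_diff: "u \<in> invariants \<Longrightarrow> v \<in> invariants \<Longrightarrow> u - v \<in> invariants"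
  using K_carrier by (auto simp: invariants_def rep_diff)

text \<open>
  An orthogonal projection is a contraction, so the projections of a dense set of vectors are dense in the
  space of invariant vectors.
\<close>

lemma norm_mean_diff:
  assumes v: "v \<in> hcarrier E" and u: "u \<in> invariants"
  shows "hnorm E (mean v - u) \<le> hnorm E (v - u)"
proof -
  define z where "z = mean v - u"
  have z: "z \<in> invariants" using invariants_diff[OF mean_invariant[OF v] u] by (simp add: z_def)
  have c: "z \<in> hcarrier E" "u \<in> hcarrier E" "mean v \<in> hcarrier E"
    using z u v invariants_mem by auto
  have "hinner E z z = hinner E (v - u) z"
    using c v inner_mean_invariant[OF v z] inner_diff_left[of "mean v" u z]
    by (simp add: inner_diff_left z_def[symmetric])
  moreover have "cmod (hinner E z z) = (hnorm E z)\<^sup>2" using c by (simp add: inner_self norm_power)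
  ultimately have "(hnorm E z)\<^sup>2 \<le> hnorm E (v - u) * hnorm E z"
    using Cauchy_Schwarz[of "v - u" z] c v by simp
  then show ?thesis
    using norm_nonneg[OF c(1)] norm_nonneg[of "v - u"] c v
    by (cases "hnorm E z = 0") (auto simp: power2_eq_square z_def[symmetric])
qed

end

section \<open>The Hecke operator\<close>

text \<open>
  A representation of a group with an open subgroup \<open>L\<close> that acts on the tree, transitively on the vertices
  and with a vertex stabiliser \<open>K\<close> transitive on the neighbours. The whole group does not act on the tree: the group to
  have in mind is that of the almost automorphisms, and \<open>L\<close> is the group of automorphisms in it.
\<close>

locale tree_representation =
  haar_representation G T \<mu> E \<rho> K + reg_tree d adj
  for G :: "('g, 'm) monoid_scheme" (structure) and T :: "'g topology" and \<mu> :: "'g measure"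
    and E :: "'v::complex_vector hspace" and \<rho> :: "'g \<Rightarrow> 'v \<Rightarrow> 'v" and K :: "'g set"
    and d :: nat and adj :: "'a \<Rightarrow> 'a \<Rightarrow> bool" +
  fixes L :: "'g set" and act :: "'g \<Rightarrow> 'a \<Rightarrow> 'a" and v\<^sub>0 :: 'a
  assumes L_subgroup: "subgroup L G"
    and act_aut: "g \<in> L \<Longrightarrow> act g \<in> tree_auts adj"
    and act_mult: "g \<in> L \<Longrightarrow> h \<in> L \<Longrightarrow> act (g \<otimes> h) x = act g (act h x)"
    and act_transitive: "\<exists>g\<in>L. act g v\<^sub>0 = x"
    and K_eq: "K = {g \<in> L. act g v\<^sub>0 = v\<^sub>0}"
    and nbr_transitive: "adj v\<^sub>0 x \<Longrightarrow> adj v\<^sub>0 y \<Longrightarrow> \<exists>k\<in>K. act k x = y"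
begin

lemma L_carrier: "g \<in> L \<Longrightarrow> g \<in> carrier G"
  using subgroup.mem_carrier[OF L_subgroup] .

lemma L_mult: "g \<in> L \<Longrightarrow> h \<in> L \<Longrightarrow> g \<otimes> h \<in> L"
  using subgroup.m_closed[OF L_subgroup] .

lemma L_inv: "g \<in> L \<Longrightarrow> inv g \<in> L"
  using subgroup.m_inv_closed[OF L_subgroup] .

lemma act_one: "act \<one> x = x"
proof -
  have "\<one> \<in> L" using subgroup.one_closed[OF L_subgroup] .
  then have "act \<one> (act \<one> x) = act \<one> x" "inj (act \<one>)"
    using act_mult[of \<one> \<one> x] tree_auts_bij[OF act_aut[of \<one>]] bij_is_inj by auto
  then show ?thesis by (simp add: inj_eq)
qed

lemma act_inv: "g \<in> L \<Longrightarrow> act (inv g) (act g x) = x" "g \<in> L \<Longrightarrow> act g (act (inv g) x) = x"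
  using act_mult[of "inv g" g x] act_mult[of g "inv g" x] L_carrier L_inv act_one by auto

lemma K_in_L: "k \<in> K \<Longrightarrow> k \<in> L"
  by (simp add: K_eq)

definition tr :: "'a \<Rightarrow> 'g" where
  "tr x = (SOME g. g \<in> L \<and> act g v\<^sub>0 = x)"

lemma tr: "tr x \<in> L" "act (tr x) v\<^sub>0 = x"
proof -
  have "tr x \<in> L \<and> act (tr x) v\<^sub>0 = x"
    unfolding tr_def by (rule someI_ex) (use act_transitive in blast)
  then show "tr x \<in> L" "act (tr x) v\<^sub>0 = x" by auto
qed

lemma tr_carrier [simp]: "tr x \<in> carrier G"
  using tr(1) by (rule L_carrier)

text \<open>
  The translate of a \<open>K\<close>-invariant vector by an element of \<open>L\<close> depends only on where the element
  moves the base vertex, so that invariant vectors can be moved to each vertex.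
\<close>

definition moved :: "'v \<Rightarrow> 'a \<Rightarrow> 'v" where
  "moved u x = \<rho> (tr x) u"

lemma rep_invariant:
  assumes u: "u \<in> invariants" and g: "g \<in> L"
  shows "\<rho> g u = moved u (act g v\<^sub>0)"
proof -
  define x where "x = act g v\<^sub>0"
  have "act (inv (tr x) \<otimes> g) v\<^sub>0 = v\<^sub>0"
    using act_mult[of "inv (tr x)" g] act_inv(1)[of "tr x" "v\<^sub>0"] tr g L_inv by (simp add: x_def)
  then have k: "inv (tr x) \<otimes> g \<in> K" using tr(1) g L_inv L_mult by (simp add: K_eq)
  have "g = tr x \<otimes> (inv (tr x) \<otimes> g)" using L_carrier[OF g] by (simp add: m_assoc[symmetric])
  then have "\<rho> g u = \<rho> (tr x) (\<rho> (inv (tr x) \<otimes> g) u)"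
    using rep_mult[of "tr x" "inv (tr x) \<otimes> g" u] u L_carrier[OF g] by (simp add: invariants_mem)
  then show ?thesis using invariants_fixed[OF u k] by (simp add: moved_def x_def)
qed

lemma moved_mem [simp]: "u \<in> invariants \<Longrightarrow> moved u x \<in> hcarrier E"
  by (simp add: moved_def invariants_mem)

lemma moved_base: "u \<in> invariants \<Longrightarrow> moved u v\<^sub>0 = u"
  using rep_invariant[of u \<one>] subgroup.one_closed[OF L_subgroup]
  by (simp add: act_one rep_one invariants_mem)

lemma rep_moved:
  assumes u: "u \<in> invariants" and g: "g \<in> L" shows "\<rho> g (moved u x) = moved u (act g x)"
proof -
  have "\<rho> g (moved u x) = \<rho> (g \<otimes> tr x) u"
    using u L_carrier[OF g] by (simp add: moved_def rep_mult invariants_mem)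
  then show ?thesis using rep_invariant[OF u L_mult[OF g tr(1)]] act_mult[OF g tr(1)] tr(2) by simp
qed

text \<open>
  The vector obtained from \<open>u\<close> by averaging over its copies at the neighbours of the base vertex; in terms of the group
  this is the action of the double coset \<open>K a K\<close> of an element \<open>a\<close> moving the base vertex to a neighbour.
\<close>

definition hecke :: "'v \<Rightarrow> 'v" where
  "hecke u = (1 / of_nat d) *\<^sub>C (\<Sum>y\<in>nbrs v\<^sub>0. moved u y)"

lemma hecke_mem [simp]: "u \<in> invariants \<Longrightarrow> hecke u \<in> hcarrier E"
  by (simp add: hecke_def)

lemma rep_hecke:
  assumes u: "u \<in> invariants" and g: "g \<in> L"
  shows "\<rho> g (hecke u) = (1 / of_nat d) *\<^sub>C (\<Sum>y\<in>nbrs (act g v\<^sub>0). moved u y)"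
proof -
  have "inj (act g)" using tree_auts_bij[OF act_aut[OF g]] bij_is_inj by blast
  then have i: "inj_on (act g) (nbrs v\<^sub>0)" using inj_on_subset by blast
  have "\<rho> g (hecke u) = (1 / of_nat d) *\<^sub>C (\<Sum>y\<in>nbrs v\<^sub>0. \<rho> g (moved u y))"
    using u L_carrier[OF g] by (simp add: hecke_def rep_scale rep_sum)
  also have "(\<Sum>y\<in>nbrs v\<^sub>0. \<rho> g (moved u y)) = (\<Sum>y\<in>nbrs v\<^sub>0. moved u (act g y))"
    by (intro sum.cong refl rep_moved[OF u g])
  also have "\<dots> = (\<Sum>y\<in>nbrs (act g v\<^sub>0). moved u y)"
    unfolding nbrs_aut[OF act_aut[OF g]] using i by (simp add: sum.reindex)
  finally show ?thesis .
qed

lemma hecke_invariant: "u \<in> invariants \<Longrightarrow> hecke u \<in> invariants"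
proof -
  assume u: "u \<in> invariants"
  have "\<rho> k (hecke u) = hecke u" if k: "k \<in> K" for k
  proof -
    have "act k v\<^sub>0 = v\<^sub>0" using k by (simp add: K_eq)
    then show ?thesis using rep_hecke[OF u K_in_L[OF k]] by (simp add: hecke_def)
  qed
  then show ?thesis using u by (simp add: invariants_def hecke_mem)
qed

lemma moved_hecke: "u \<in> invariants \<Longrightarrow> moved (hecke u) x = (1 / of_nat d) *\<^sub>C (\<Sum>y\<in>nbrs x. moved u y)"
  using rep_hecke[of u "tr x"] tr by (simp add: moved_def[of "hecke u"])

lemma hecke_power_invariant: "u \<in> invariants \<Longrightarrow> (hecke ^^ n) u \<in> invariants"
  by (induction n) (simp_all add: hecke_invariant)

text \<open>Powers of the Hecke operator are governed by the averaging operator of the tree.\<close>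

lemma coefficient_hecke_power:
  assumes u: "u \<in> invariants" and w: "w \<in> hcarrier E"
  shows "(\<lambda>x. hinner E (moved ((hecke ^^ n) u) x) w) = (avg ^^ n) (\<lambda>x. hinner E (moved u x) w)"
proof (induction n)
  case (Suc n)
  have "hinner E (moved ((hecke ^^ Suc n) u) x) w = avg (\<lambda>x. hinner E (moved ((hecke ^^ n) u) x) w) x" for x
    using hecke_power_invariant[OF u, of n] w
    by (simp add: moved_hecke inner_scale_left inner_sum_left avg_def)
  then show ?case using Suc by (simp add: fun_eq_iff)
qed simp

lemma inner_hecke_power:
  assumes u: "u \<in> invariants" and w: "w \<in> hcarrier E"
  shows "hinner E ((hecke ^^ n) u) w = (avg ^^ n) (\<lambda>x. hinner E (moved u x) w) v\<^sub>0"
  using fun_cong[OF coefficient_hecke_power[OF u w, of n], of v\<^sub>0]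
  by (simp add: moved_base hecke_power_invariant u)

text \<open>
  As \<open>K\<close> permutes the neighbours of the base vertex transitively, the Hecke operator has the same
  matrix coefficients on invariant vectors as any element moving the base vertex to a neighbour;
  the inverse of such an element is another one.
\<close>

lemma inner_hecke:
  assumes u: "u \<in> invariants" and w: "w \<in> invariants" and x: "adj v\<^sub>0 x"
  shows "hinner E (hecke u) w = hinner E (moved u x) w"
proof -
  have "hinner E (moved u y) w = hinner E (moved u x) w" if y: "y \<in> nbrs v\<^sub>0" for y
  proof -
    obtain k where k: "k \<in> K" "act k x = y" using nbr_transitive[OF x, of y] y by blast
    have "hinner E (moved u y) w = hinner E (\<rho> k (moved u x)) (\<rho> k w)"
      using rep_moved[OF u K_in_L[OF k(1)], of x] k invariants_fixed[OF w k(1)] by simp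
    then show ?thesis using k(1) K_carrier u w by (simp add: rep_inner invariants_mem)
  qed
  then have "(\<Sum>y\<in>nbrs v\<^sub>0. hinner E (moved u y) w) = (\<Sum>y\<in>nbrs v\<^sub>0. hinner E (moved u x) w)"
    by (intro sum.cong) auto
  then show ?thesis
    using u w degree by (simp add: hecke_def inner_scale_left inner_sum_left invariants_mem card_nbrs)
qed

lemma hecke_selfadjoint:
  assumes u: "u \<in> invariants" and w: "w \<in> invariants"
  shows "hinner E (hecke u) w = hinner E u (hecke w)"
proof -
  obtain x where x: "adj v\<^sub>0 x" using card_nbrs[of "v\<^sub>0"] degree by fastforce
  define g where "g = tr x"
  have g: "g \<in> L" "act g v\<^sub>0 = x" using tr by (auto simp: g_def)
  have "adj (act (inv g) v\<^sub>0) (act (inv g) x)"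
    using x tree_auts_adj[OF act_aut[OF L_inv[OF g(1)]]] by simp
  then have x': "adj v\<^sub>0 (act (inv g) v\<^sub>0)" using act_inv(1)[OF g(1), of "v\<^sub>0"] g adj_sym by simp
  have "hinner E (hecke u) w = hinner E (\<rho> g u) w"
    using inner_hecke[OF u w x] rep_invariant[OF u g(1)] g by simp
  also have "\<dots> = cnj (hinner E (\<rho> (inv g) w) u)"
    using L_carrier[OF g(1)] u w invariants_mem rep_adjoint[of g u w]
      inner_commute[of "\<rho> (inv g) w" u] by simp
  also have "\<dots> = cnj (hinner E (hecke w) u)"
    using inner_hecke[OF w u x'] rep_invariant[OF w L_inv[OF g(1)]] by simp
  also have "\<dots> = hinner E u (hecke w)"
    using inner_commute[of "hecke w" u] u w invariants_mem by simp
  finally show ?thesis .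
qed

lemma hecke_power_selfadjoint:
  assumes u: "u \<in> invariants" and w: "w \<in> invariants"
  shows "hinner E ((hecke ^^ n) u) w = hinner E u ((hecke ^^ n) w)"
  using w
proof (induction n arbitrary: w)
  case (Suc n)
  have "hinner E ((hecke ^^ Suc n) u) w = hinner E ((hecke ^^ n) u) (hecke w)"
    using hecke_selfadjoint[OF hecke_power_invariant[OF u, of n] Suc.prems] by simp
  also have "\<dots> = hinner E u ((hecke ^^ n) (hecke w))"
    using Suc.IH hecke_invariant[OF Suc.prems] by blast
  finally show ?case by (simp add: funpow_swap1)
qed simp

lemma norm_hecke_power_square:
  assumes u: "u \<in> invariants"
  shows "complex_of_real ((hnorm E ((hecke ^^ n) u))\<^sup>2) = hinner E ((hecke ^^ (2 * n)) u) u"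
proof -
  have "hinner E ((hecke ^^ (2 * n)) u) u = hinner E ((hecke ^^ n) ((hecke ^^ n) u)) u"
    by (simp add: mult_2 funpow_add)
  also have "\<dots> = hinner E ((hecke ^^ n) u) ((hecke ^^ n) u)"
    using hecke_power_selfadjoint[OF hecke_power_invariant[OF u] u] by simp
  finally show ?thesis
    using inner_self[of "(hecke ^^ n) u"] hecke_power_invariant[OF u] invariants_mem by simp
qed

lemma hecke_diff:
  assumes "u \<in> invariants" "v \<in> invariants" shows "hecke (u - v) = hecke u - hecke v"
proof -
  have "moved (u - v) y = moved u y - moved v y" for y using assms invariants_mem by (simp add: moved_def rep_diff)
  moreover have "a *\<^sub>C (x - y) = a *\<^sub>C x - a *\<^sub>C y" for a and x y :: 'v
    using scaleC_add_right[of a "x - y" y] by simp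
  ultimately show ?thesis by (simp add: hecke_def sum_subtractf)
qed

lemma norm_hecke_le: "u \<in> invariants \<Longrightarrow> hnorm E (hecke u) \<le> hnorm E u"
proof -
  assume u: "u \<in> invariants"
  have "hnorm E (\<Sum>y\<in>nbrs v\<^sub>0. moved u y) \<le> (\<Sum>y\<in>nbrs v\<^sub>0. hnorm E (moved u y))"
    using u by (intro norm_sum_le) simp
  also have "\<dots> = d * hnorm E u"
    using u by (simp add: moved_def rep_norm invariants_mem card_nbrs)
  finally show ?thesis using u degree by (simp add: hecke_def norm_scale norm_divide field_simps)
qed

end

section \<open>Integrability of matrix coefficients bounds the Hecke operator\<close>

text \<open>
  A form of Young's inequality in which the exponent conjugate to \<open>s\<close> does not occur; with the best \<open>l\<close> it gives,
  up to a factor 2, Hoelder's inequality on a set of finite measure.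
\<close>

lemma young_powr:
  fixes t l s :: real
  assumes "0 \<le> t" "0 < l" "1 \<le> s"
  shows "t \<le> l + l powr (1 - s) * t powr s"
proof (cases "t \<le> l")
  case True
  have "0 \<le> l powr (1 - s) * t powr s" by simp
  then show ?thesis using True by linarith
next
  case False
  then have t: "t > 0" "l < t" using assms by linarith+
  have "t = t powr (1 - s) * t powr s" using t by (simp add: powr_add[symmetric])
  also have "\<dots> \<le> l powr (1 - s) * t powr s"
    using t assms by (intro mult_right_mono powr_mono2') auto
  finally show ?thesis using assms by linarith
qed

text \<open>
  Comparison of growth rates. The exponents are powers of two because the lower bounds used below come from
  repeated squaring.
\<close>

lemma le_if_powers_bounded:
  fixes t c :: real
  assumes t: "0 \<le> t" and c: "0 < c" and M: "\<And>k. t ^ (2 ^ k) \<le> M * c ^ (2 ^ k)"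
  shows "t \<le> c"
proof (rule ccontr)
  assume "\<not> t \<le> c"
  then have "1 < t / c" using c by simp
  then obtain n where n: "M < (t / c) ^ n" using real_arch_pow by blast
  have "(t / c) ^ n \<le> (t / c) ^ (2 ^ n)"
    using \<open>1 < t / c\<close> less_exp[of n] by (intro power_increasing) auto
  also have "\<dots> \<le> M" using M[of n] c by (simp add: power_divide divide_le_eq)
  finally show False using n by simp
qed

context reg_tree
begin

lemma power_le_card_sphere: "real (d - 1) ^ n \<le> real (card (sphere c n))"
proof (cases n)
  case 0
  then show ?thesis by (simp add: sphere_0)
next
  case (Suc m)
  have "(d - 1) ^ Suc m \<le> card (sphere c (Suc m))" by (simp add: card_sphere)
  then show ?thesis using Suc by (metis of_nat_le_iff of_nat_power)
qed

end

context tree_representation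
begin

abbreviation coset :: "'a \<Rightarrow> 'g set" where "coset x \<equiv> (\<lambda>k. tr x \<otimes> k) ` K"

lemma coset_act: "g \<in> coset x \<Longrightarrow> g \<in> L \<and> act g v\<^sub>0 = x"
  using tr[of x] L_mult act_mult by (auto simp: K_eq)

lemma measure_coset: "emeasure \<mu> (coset x) = emeasure \<mu> K"
  by (rule haar_translate) simp_all

text \<open>
  Averaging over \<open>K\<close> turns the matrix coefficient of \<open>v\<close> into a function on the vertices. Its sums over
  spheres are integrals over finitely many cosets of \<open>K\<close>, and an \<open>L\<^sup>s\<close> bound controls such an integral by the
  number of cosets, which is about \<open>(d - 1)\<^sup>n\<close>.
\<close>

lemma sphere_coefficient_bound:
  assumes v: "v \<in> hcarrier E" and s: "1 \<le> s"
    and Lp: "Lp_function \<mu> s (\<lambda>g. hinner E (\<rho> g v) v)"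
    and th: "\<theta> = real (d - 1) powr (- 1 / s)"
  shows "\<exists>C\<ge>0. \<forall>n. cmod (\<Sum>x\<in>sphere v\<^sub>0 n. hinner E (moved (mean v) x) v) \<le>
    C * real (card (sphere v\<^sub>0 n)) * \<theta> ^ n"
proof -
  define \<psi> where "\<psi> g = hinner E (\<rho> g v) v" for g
  define m where "m = measure \<mu> K"
  define J where "J = (\<integral>g. cmod (\<psi> g) powr s \<partial>\<mu>)"
  have m: "m > 0" using K_pos by (simp add: m_def)
  have q: "real (d - 1) > 0" using degree by simp
  have \<theta>: "\<theta> > 0" using q by (simp add: th)
  have Jint: "integrable \<mu> (\<lambda>g. cmod (\<psi> g) powr s)" using Lp by (simp add: Lp_function_def \<psi>_def)
  have J: "0 \<le> J" by (simp add: J_def integral_nonneg_AE)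
  have Bs: "coset x \<in> sets \<mu>" for x by (rule coset_measurable) simp
  have Bf: "emeasure \<mu> (coset x) < \<infinity>" for x using measure_coset K_finite by simp
  have Bm: "measure \<mu> (coset x) = m" for x using measure_coset by (simp add: measure_def m_def)
  have i1: "integrable \<mu> (\<lambda>g. indicator (coset x) g * cmod (\<psi> g))" for x
    using integrable_norm[OF coefficient_integrable_on[OF Bs Bf v v, of x]]
    by (simp add: \<psi>_def norm_scaleR)
  have i2: "integrable \<mu> (\<lambda>g. indicator (coset x) g * cmod (\<psi> g) powr s)" for x
    using integrable_mult_indicator[OF Bs Jint, of x] by simp
  have i3: "integrable \<mu> (indicator (coset x) :: _ \<Rightarrow> real)" for x
    using Bs Bf by (intro integrable_real_indicator)
  have one: "cmod (hinner E (moved (mean v) x) v) \<le>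
      (l * m + l powr (1 - s) * (\<integral>g. indicator (coset x) g * cmod (\<psi> g) powr s \<partial>\<mu>)) / m"
    if l: "l > 0" for x l
  proof -
    have "cmod (hinner E (moved (mean v) x) v) = cmod (\<integral>g. indicator (coset x) g *\<^sub>R \<psi> g \<partial>\<mu>) / m"
      using inner_translate_mean[of "tr x" v v] v m
      by (simp add: moved_def \<psi>_def m_def norm_divide)
    also have "cmod (\<integral>g. indicator (coset x) g *\<^sub>R \<psi> g \<partial>\<mu>) \<le>
        (\<integral>g. l * indicator (coset x) g + l powr (1 - s) * (indicator (coset x) g * cmod (\<psi> g) powr s) \<partial>\<mu>)"
    proof (rule norm_integral_le)
      show "integrable \<mu> (\<lambda>g. indicator (coset x) g *\<^sub>R \<psi> g)"
        unfolding \<psi>_def by (rule coefficient_integrable_on[OF Bs Bf v v])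
      show "integrable \<mu> (\<lambda>g. l * indicator (coset x) g + l powr (1 - s) * (indicator (coset x) g * cmod (\<psi> g) powr s))"
        using i2 i3 by (intro Bochner_Integration.integrable_add integrable_mult_right)
      show "norm (indicator (coset x) g *\<^sub>R \<psi> g) \<le>
          l * indicator (coset x) g + l powr (1 - s) * (indicator (coset x) g * cmod (\<psi> g) powr s)" for g
        using young_powr[OF norm_ge_zero l s, of "\<psi> g"] by (simp add: indicator_def)
    qed
    also have "\<dots> = l * m + l powr (1 - s) * (\<integral>g. indicator (coset x) g * cmod (\<psi> g) powr s \<partial>\<mu>)"
      using i2[of x] i3[of x] Bm[of x] sets.sets_into_space[OF Bs[of x]]
      by (simp add: Int_absorb2)
    finally show ?thesis using m by (simp add: divide_right_mono)
  qed
  have "cmod (\<Sum>x\<in>sphere v\<^sub>0 n. hinner E (moved (mean v) x) v) \<le>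
    (1 + J / m) * real (card (sphere v\<^sub>0 n)) * \<theta> ^ n" for n
  proof -
    let ?S = "sphere v\<^sub>0 n"
    let ?I = "\<lambda>x. \<integral>g. indicator (coset x) g * cmod (\<psi> g) powr s \<partial>\<mu>"
    define l where "l = \<theta> ^ n"
    have l: "l > 0" using \<theta> by (simp add: l_def)
    have "(\<Sum>x\<in>?S. ?I x) = (\<integral>g. (\<Sum>x\<in>?S. indicator (coset x) g * cmod (\<psi> g) powr s) \<partial>\<mu>)"
      using i2 by (intro Bochner_Integration.integral_sum[symmetric])
    also have "\<dots> \<le> J"
      unfolding J_def
    proof (rule integral_mono)
      show "integrable \<mu> (\<lambda>g. \<Sum>x\<in>?S. indicator (coset x) g * cmod (\<psi> g) powr s)"
        using i2 by (intro Bochner_Integration.integrable_sum)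
      fix g
      have "(\<Sum>x\<in>?S. indicator (coset x) g :: real) \<le> (\<Sum>x\<in>?S. if x = act g v\<^sub>0 then 1 else 0)"
        using coset_act[of g] by (intro sum_mono) (auto simp: indicator_def)
      also have "\<dots> \<le> 1" using finite_sphere by (simp add: sum.delta)
      finally have "(\<Sum>x\<in>?S. indicator (coset x) g) * cmod (\<psi> g) powr s \<le> 1 * cmod (\<psi> g) powr s"
        by (intro mult_right_mono) auto
      then show "(\<Sum>x\<in>?S. indicator (coset x) g * cmod (\<psi> g) powr s) \<le> cmod (\<psi> g) powr s"
        by (simp add: sum_distrib_right)
    qed (rule Jint)
    finally have IJ: "(\<Sum>x\<in>?S. ?I x) \<le> J" .
    have "(\<theta> ^ n) powr (- s) = real (d - 1) ^ n"
      using q s by (simp add: th powr_realpow[symmetric] powr_powr powr_mult)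
    then have "l powr (1 - s) = l * real (d - 1) ^ n"
      using l powr_add[of l 1 "- s"] by (simp add: l_def)
    also have "\<dots> \<le> l * real (card ?S)" using l power_le_card_sphere by (intro mult_left_mono) auto
    finally have lp: "l powr (1 - s) \<le> l * real (card ?S)" .
    have "cmod (\<Sum>x\<in>?S. hinner E (moved (mean v) x) v) \<le>
        (\<Sum>x\<in>?S. (l * m + l powr (1 - s) * ?I x) / m)"
      using one[OF l] by (intro sum_norm_le) auto
    also have "\<dots> = (real (card ?S) * (l * m) + l powr (1 - s) * (\<Sum>x\<in>?S. ?I x)) / m"
      by (simp add: sum_divide_distrib[symmetric] sum.distrib sum_distrib_left)
    also have "\<dots> \<le> (real (card ?S) * (l * m) + (l * real (card ?S)) * J) / m"
      using IJ lp l m J by (intro divide_right_mono add_left_mono mult_mono)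
        (auto intro!: sum_nonneg integral_nonneg_AE)
    also have "\<dots> = (1 + J / m) * real (card ?S) * l" using m by (simp add: field_simps)
    finally show ?thesis by (simp add: l_def)
  qed
  moreover have "0 \<le> 1 + J / m" using J m by simp
  ultimately show ?thesis by blast
qed

text \<open>
  Let \<open>u\<close> be the average of \<open>v\<close> over \<open>K\<close> and \<open>A\<close> the Hecke operator. On the one hand \<open>\<parallel>A\<^sup>n u\<parallel>\<^sup>2 = \<langle>A\<^sup>2\<^sup>n u, v\<rangle>\<close> is an iterated average of a
  function whose sums over spheres decay, which bounds it by a multiple of the power \<open>2 n\<close> of \<open>growth \<theta>\<close>. On the other
  hand the norms \<open>\<parallel>A\<^sup>n u\<parallel>\<close> are log-convex since \<open>A\<close> is self-adjoint, so that they grow at least like the powers of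
  \<open>\<parallel>A u\<parallel> / \<parallel>u\<parallel>\<close>. The multiplicative constant disappears in the limit.
\<close>

lemma hecke_norm_bound_mean:
  assumes v: "v \<in> hcarrier E" and s: "1 \<le> s"
    and Lp: "Lp_function \<mu> s (\<lambda>g. hinner E (\<rho> g v) v)"
    and th: "\<theta> = real (d - 1) powr (- 1 / s)"
  shows "hnorm E (hecke (mean v)) \<le> growth \<theta> * hnorm E (mean v)"
proof -
  define u where "u = mean v"
  have u: "u \<in> invariants" using mean_invariant[OF v] by (simp add: u_def)
  then have uE: "u \<in> hcarrier E" by (rule invariants_mem)
  define b where "b n = hnorm E ((hecke ^^ n) u)" for n
  have Hn: "(hecke ^^ n) u \<in> hcarrier E" for n using hecke_power_invariant[OF u] invariants_mem by blast
  have b0: "b n \<ge> 0" for n using Hn by (simp add: b_def)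
  have \<theta>: "0 < \<theta>" "\<theta> \<le> 1"
    using degree s by (auto simp: th powr_minus_divide intro!: ge_one_powr_ge_zero)
  obtain C where C: "C \<ge> 0" "\<And>n. cmod (\<Sum>x\<in>sphere v\<^sub>0 n. hinner E (moved u x) v) \<le>
      C * real (card (sphere v\<^sub>0 n)) * \<theta> ^ n"
    using sphere_coefficient_bound[OF v s Lp th] by (auto simp: u_def)
  have upper: "(b n)\<^sup>2 \<le> C * growth \<theta> ^ (2 * n)" for n
  proof -
    have "complex_of_real ((b n)\<^sup>2) = hinner E ((hecke ^^ (2 * n)) u) u"
      unfolding b_def by (rule norm_hecke_power_square[OF u])
    also have "\<dots> = hinner E ((hecke ^^ (2 * n)) u) v"
      using inner_mean_invariant[OF v hecke_power_invariant[OF u, of "2 * n"]]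
        inner_commute[OF uE Hn[of "2 * n"]] inner_commute[OF v Hn[of "2 * n"]] by (simp add: u_def)
    also have "\<dots> = (avg ^^ (2 * n)) (\<lambda>x. hinner E (moved u x) v) v\<^sub>0"
      by (rule inner_hecke_power[OF u v])
    finally have "(b n)\<^sup>2 = cmod ((avg ^^ (2 * n)) (\<lambda>x. hinner E (moved u x) v) v\<^sub>0)"
      by (metis norm_of_real abs_of_nonneg zero_le_power2)
    also have "\<dots> \<le> C * growth \<theta> ^ (2 * n)"
      by (rule avg_power_bound[OF \<theta> C])
    finally show ?thesis .
  qed
  have logconvex: "(b n)\<^sup>2 \<le> b (2 * n) * b 0" for n
  proof -
    have "(b n)\<^sup>2 = cmod (hinner E ((hecke ^^ (2 * n)) u) u)"
      using norm_hecke_power_square[OF u, of n, symmetric] by (simp add: b_def norm_power)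
    also have "\<dots> \<le> b (2 * n) * b 0" using Cauchy_Schwarz[OF Hn[of "2 * n"] uE] by (simp add: b_def)
    finally show ?thesis .
  qed
  show ?thesis
  proof (cases "b 0 = 0")
    case True
    then have "hnorm E (hecke u) \<le> 0" using norm_hecke_le[OF u] unfolding b_def by simp
    then show ?thesis using True by (simp add: u_def[symmetric] b_def)
  next
    case False
    then have pos: "b 0 > 0" using b0[of 0] by linarith
    define t where "t = b 1 / b 0"
    have lower: "t ^ (2 ^ k) * b 0 \<le> b (2 ^ k)" for k
    proof (induction k)
      case 0
      show ?case using pos by (simp add: t_def)
    next
      case (Suc k)
      have t0: "0 \<le> t" using b0[of 1] pos by (simp add: t_def)
      have "(t ^ (2 ^ Suc k) * b 0) * b 0 = (t ^ (2 ^ k) * b 0)\<^sup>2"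
        by (simp add: power2_eq_square power_add[symmetric] mult_2[symmetric] algebra_simps)
      also have "\<dots> \<le> (b (2 ^ k))\<^sup>2" using Suc pos t0 by (intro power_mono) auto
      also have "\<dots> \<le> b (2 ^ Suc k) * b 0" using logconvex[of "2 ^ k"] by simp
      finally show ?case using pos by (rule mult_right_le_imp_le)
    qed
    have "t \<le> growth \<theta>"
    proof (rule le_if_powers_bounded)
      show "0 \<le> t" using b0[of 1] pos by (simp add: t_def)
      show "0 < growth \<theta>" by (rule growth_pos[OF \<theta>(1)])
      fix k
      have "b (2 ^ k) \<le> sqrt C * growth \<theta> ^ (2 ^ k)"
      proof (rule power2_le_imp_le)
        show "(b (2 ^ k))\<^sup>2 \<le> (sqrt C * growth \<theta> ^ (2 ^ k))\<^sup>2"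
          using upper[of "2 ^ k"] C(1) by (simp add: power_mult_distrib power_mult[symmetric] mult.commute)
        show "0 \<le> sqrt C * growth \<theta> ^ (2 ^ k)" using C(1) growth_pos[OF \<theta>(1)] by simp
      qed
      then have "t ^ (2 ^ k) * b 0 \<le> sqrt C * growth \<theta> ^ (2 ^ k)" using lower[of k] by linarith
      then show "t ^ (2 ^ k) \<le> (sqrt C / b 0) * growth \<theta> ^ (2 ^ k)" using pos by (simp add: field_simps)
    qed
    then show ?thesis using pos by (simp add: t_def b_def u_def[symmetric] field_simps)
  qed
qed

text \<open>
  The bound contains no constant that depends on the vector, so it extends by continuity from the averages of the
  vectors with integrable coefficients to all invariant vectors.
\<close>

theorem Lp_rep_hecke_norm_bound:
  assumes Lp: "Lp_rep \<mu> s E \<rho>" and s: "1 \<le> s" and u: "u \<in> invariants"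
    and th: "\<theta> = real (d - 1) powr (- 1 / s)"
  shows "hnorm E (hecke u) \<le> growth \<theta> * hnorm E u"
proof (rule field_le_epsilon)
  fix e :: real assume e: "e > 0"
  obtain V\<^sub>0 where V0: "V\<^sub>0 \<subseteq> hcarrier E" "htopology E closure_of V\<^sub>0 = hcarrier E"
    "\<And>v. v \<in> V\<^sub>0 \<Longrightarrow> Lp_function \<mu> s (\<lambda>g. hinner E (\<rho> g v) v)"
    using Lp by (auto simp: Lp_rep_def)
  have uE: "u \<in> hcarrier E" using u by (rule invariants_mem)
  have gr: "0 < growth \<theta>" using degree by (intro growth_pos) (simp add: th)
  define \<delta> where "\<delta> = e / (1 + growth \<theta>)"
  have \<delta>: "\<delta> > 0" using e gr by (simp add: \<delta>_def)
  have "u \<in> htopology E closure_of V\<^sub>0" using V0 uE by simp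
  then obtain v where v: "v \<in> V\<^sub>0" "hnorm E (u - v) < \<delta>"
    using closure_of_approx[OF V0(1) _ \<delta>] by blast
  define w where "w = mean v"
  have vE: "v \<in> hcarrier E" using v V0 by blast
  have w: "w \<in> invariants" "w \<in> hcarrier E" using mean_invariant[OF vE] invariants_mem by (auto simp: w_def)
  have "hnorm E (w - u) \<le> hnorm E (v - u)" unfolding w_def by (rule norm_mean_diff[OF vE u])
  then have wu: "hnorm E (w - u) \<le> \<delta>" using v norm_minus_commute[OF uE vE] by linarith
  have uw: "hnorm E (u - w) \<le> \<delta>" using wu norm_minus_commute[OF uE w(2)] by linarith
  have "hnorm E (hecke u) \<le> hnorm E (hecke u - hecke w) + hnorm E (hecke w)"
    using norm_triangle[of "hecke u - hecke w" "hecke w"] u w by simp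
  also have "hnorm E (hecke u - hecke w) \<le> \<delta>"
    using norm_hecke_le[OF invariants_diff[OF u w(1)]] uw by (simp add: hecke_diff[OF u w(1)])
  also have "hnorm E (hecke w) \<le> growth \<theta> * hnorm E w"
    unfolding w_def by (rule hecke_norm_bound_mean[OF vE s V0(3)[OF v(1)] th])
  also have "hnorm E w \<le> hnorm E u + \<delta>"
    using norm_triangle[of "w - u" u] w uE wu by simp
  finally have "hnorm E (hecke u) \<le> \<delta> + growth \<theta> * (hnorm E u + \<delta>)" using gr by simp
  also have "\<dots> = growth \<theta> * hnorm E u + \<delta> * (1 + growth \<theta>)" by (simp add: algebra_simps)
  also have "\<delta> * (1 + growth \<theta>) = e" using gr by (simp add: \<delta>_def)
  finally show "hnorm E (hecke u) \<le> growth \<theta> * hnorm E u + e" .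
qed

text \<open>The bound in terms of the positive-definite function of an invariant unit vector.\<close>

corollary Lp_rep_avg_power_bound:
  assumes Lp: "Lp_rep \<mu> s E \<rho>" and s: "1 \<le> s" and u: "u \<in> invariants" "hnorm E u = 1"
    and th: "\<theta> = real (d - 1) powr (- 1 / s)"
    and coeff: "\<And>g. g \<in> L \<Longrightarrow> hinner E (\<rho> g u) u = \<Phi> (dist' v\<^sub>0 (act g v\<^sub>0))"
  shows "cmod ((avg ^^ n) (\<lambda>x. \<Phi> (dist' v\<^sub>0 x)) v\<^sub>0) \<le> growth \<theta> ^ n"
proof -
  have gr: "0 < growth \<theta>" using degree by (intro growth_pos) (simp add: th)
  have uE: "u \<in> hcarrier E" using u invariants_mem by blast
  have f: "(\<lambda>x. hinner E (moved u x) u) = (\<lambda>x. \<Phi> (dist' v\<^sub>0 x))"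
    using coeff[OF tr(1)] tr(2) by (simp add: moved_def fun_eq_iff)
  have "hnorm E ((hecke ^^ n) u) \<le> growth \<theta> ^ n"
  proof (induction n)
    case (Suc n)
    have "hnorm E ((hecke ^^ Suc n) u) \<le> growth \<theta> * hnorm E ((hecke ^^ n) u)"
      using Lp_rep_hecke_norm_bound[OF Lp s hecke_power_invariant[OF u(1), of n] th] by simp
    also have "\<dots> \<le> growth \<theta> * growth \<theta> ^ n" using Suc gr by (intro mult_left_mono) auto
    finally show ?case by simp
  qed (use u in simp)
  moreover have "cmod (hinner E ((hecke ^^ n) u) u) \<le> hnorm E ((hecke ^^ n) u) * hnorm E u"
    using hecke_power_invariant[OF u(1)] invariants_mem uE by (intro Cauchy_Schwarz) auto
  ultimately have "cmod (hinner E ((hecke ^^ n) u) u) \<le> growth \<theta> ^ n" using u(2) by simp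
  then show ?thesis unfolding inner_hecke_power[OF u(1) uE] f .
qed

end

section \<open>Cyclic representations with a p-integrable matrix coefficient\<close>

lemma powr_add_le:
  fixes a b s :: real
  assumes "0 \<le> a" "0 \<le> b" "0 \<le> s"
  shows "(a + b) powr s \<le> 2 powr s * (a powr s + b powr s)"
proof -
  have "(a + b) powr s \<le> (2 * max a b) powr s" using assms by (intro powr_mono2) auto
  also have "\<dots> = 2 powr s * (max a b) powr s" using assms by (simp add: powr_mult)
  also have "(max a b) powr s \<le> a powr s + b powr s" by (simp add: max_def)
  finally show ?thesis by simp
qed

lemma Lp_function_add:
  assumes f: "Lp_function \<mu> s f" and g: "Lp_function \<mu> s g" and s: "0 \<le> s"
  shows "Lp_function \<mu> s (\<lambda>x. f x + g x)"
proof -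
  have m: "f \<in> borel_measurable \<mu>" "g \<in> borel_measurable \<mu>"
    and i: "integrable \<mu> (\<lambda>x. norm (f x) powr s)" "integrable \<mu> (\<lambda>x. norm (g x) powr s)"
    using f g by (auto simp: Lp_function_def)
  have "integrable \<mu> (\<lambda>x. norm (f x + g x) powr s)"
  proof (rule Bochner_Integration.integrable_bound)
    show "integrable \<mu> (\<lambda>x. 2 powr s * (norm (f x) powr s + norm (g x) powr s))"
      using i by (intro integrable_mult_right Bochner_Integration.integrable_add)
    show "(\<lambda>x. norm (f x + g x) powr s) \<in> borel_measurable \<mu>"
      using m by measurable
    show "AE x in \<mu>. norm (norm (f x + g x) powr s) \<le>
        norm (2 powr s * (norm (f x) powr s + norm (g x) powr s))"
    proof (intro AE_I2)
      fix x
      have "norm (f x + g x) powr s \<le> (norm (f x) + norm (g x)) powr s"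
        using s by (intro powr_mono2 norm_triangle_ineq) auto
      also have "\<dots> \<le> 2 powr s * (norm (f x) powr s + norm (g x) powr s)"
        using s by (intro powr_add_le) auto
      finally show "norm (norm (f x + g x) powr s) \<le>
          norm (2 powr s * (norm (f x) powr s + norm (g x) powr s))" by simp
    qed
  qed
  then show ?thesis using m by (auto simp: Lp_function_def intro: borel_measurable_add)
qed

lemma Lp_function_scale:
  assumes f: "Lp_function \<mu> s f" shows "Lp_function \<mu> s (\<lambda>x. a * f x)"
proof -
  have "integrable \<mu> (\<lambda>x. norm a powr s * norm (f x) powr s)"
    using f by (intro integrable_mult_right) (simp add: Lp_function_def)
  then show ?thesis using f
    by (auto simp: Lp_function_def norm_mult powr_mult intro: borel_measurable_times)
qed

lemma Lp_function_zero: "Lp_function \<mu> s (\<lambda>x. 0)"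
  by (simp add: Lp_function_def)

lemma Lp_function_cong:
  "Lp_function \<mu> s f \<Longrightarrow> (\<And>x. x \<in> space \<mu> \<Longrightarrow> f x = g x) \<Longrightarrow> Lp_function \<mu> s g"
  unfolding Lp_function_def
  by (auto cong: measurable_cong Bochner_Integration.integrable_cong)

context haar_representation
begin

text \<open>
  The integrable functions of exponent \<open>s\<close> form a vector space, so integrability passes from \<open>S\<close> to its span, first in
  one argument and then in the other.
\<close>

lemma Lp_rep_cyclic:
  assumes s: "0 \<le> s" and S: "S \<subseteq> hcarrier E" and dense: "htopology E closure_of (cspan S) = hcarrier E"
    and Lp: "\<And>v w. v \<in> S \<Longrightarrow> w \<in> S \<Longrightarrow> Lp_function \<mu> s (\<lambda>g. hinner E (\<rho> g v) w)"
  shows "Lp_rep \<mu> s E \<rho>"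
proof -
  have spanE: "cspan S \<subseteq> hcarrier E" by (rule cspan_minimal[OF csubspace_carrier S])
  have "csubspace {v \<in> hcarrier E. \<forall>w\<in>S. Lp_function \<mu> s (\<lambda>g. hinner E (\<rho> g v) w)}"
    unfolding csubspace_def
  proof (intro conjI ballI allI)
    show "0 \<in> {v \<in> hcarrier E. \<forall>w\<in>S. Lp_function \<mu> s (\<lambda>g. hinner E (\<rho> g v) w)}"
      using S by (auto intro!: Lp_function_cong[OF Lp_function_zero] simp: space_haar rep_zero)
  next
    fix x y
    assume x: "x \<in> {v \<in> hcarrier E. \<forall>w\<in>S. Lp_function \<mu> s (\<lambda>g. hinner E (\<rho> g v) w)}"
      and y: "y \<in> {v \<in> hcarrier E. \<forall>w\<in>S. Lp_function \<mu> s (\<lambda>g. hinner E (\<rho> g v) w)}"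
    have "Lp_function \<mu> s (\<lambda>g. hinner E (\<rho> g (x + y)) w)" if w: "w \<in> S" for w
      by (rule Lp_function_cong[OF Lp_function_add[OF _ _ s, of \<mu> "\<lambda>g. hinner E (\<rho> g x) w"
            "\<lambda>g. hinner E (\<rho> g y) w"]])
        (use x y w S in \<open>auto simp: space_haar rep_add inner_add_left subset_iff\<close>)
    then show "x + y \<in> {v \<in> hcarrier E. \<forall>w\<in>S. Lp_function \<mu> s (\<lambda>g. hinner E (\<rho> g v) w)}"
      using x y by simp
  next
    fix a x
    assume x: "x \<in> {v \<in> hcarrier E. \<forall>w\<in>S. Lp_function \<mu> s (\<lambda>g. hinner E (\<rho> g v) w)}"
    have "Lp_function \<mu> s (\<lambda>g. hinner E (\<rho> g (a *\<^sub>C x)) w)" if w: "w \<in> S" for w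
      by (rule Lp_function_cong[OF Lp_function_scale[of \<mu> s "\<lambda>g. hinner E (\<rho> g x) w" a]])
        (use x w S in \<open>auto simp: space_haar rep_scale inner_scale_left subset_iff\<close>)
    then show "a *\<^sub>C x \<in> {v \<in> hcarrier E. \<forall>w\<in>S. Lp_function \<mu> s (\<lambda>g. hinner E (\<rho> g v) w)}"
      using x by simp
  qed
  then have "cspan S \<subseteq> {v \<in> hcarrier E. \<forall>w\<in>S. Lp_function \<mu> s (\<lambda>g. hinner E (\<rho> g v) w)}"
    using S Lp by (intro cspan_minimal) auto
  then have left: "Lp_function \<mu> s (\<lambda>g. hinner E (\<rho> g v) w)" if "v \<in> cspan S" "w \<in> S" for v w
    using that by blast
  let ?W = "{w \<in> hcarrier E. \<forall>v\<in>cspan S. Lp_function \<mu> s (\<lambda>g. hinner E (\<rho> g v) w)}"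
  have "csubspace ?W"
    unfolding csubspace_def
  proof (intro conjI ballI allI)
    show "0 \<in> ?W"
      using spanE by (auto intro!: Lp_function_cong[OF Lp_function_zero] simp: space_haar subset_iff)
  next
    fix x y assume x: "x \<in> ?W" and y: "y \<in> ?W"
    have "Lp_function \<mu> s (\<lambda>g. hinner E (\<rho> g v) (x + y))" if v: "v \<in> cspan S" for v
      by (rule Lp_function_cong[OF Lp_function_add[OF _ _ s, of \<mu> "\<lambda>g. hinner E (\<rho> g v) x"
            "\<lambda>g. hinner E (\<rho> g v) y"]])
        (use x y v spanE in \<open>auto simp: space_haar inner_add_right subset_iff\<close>)
    then show "x + y \<in> ?W" using x y by simp
  next
    fix a x assume x: "x \<in> ?W"
    have "Lp_function \<mu> s (\<lambda>g. hinner E (\<rho> g v) (a *\<^sub>C x))" if v: "v \<in> cspan S" for v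
      by (rule Lp_function_cong[OF Lp_function_scale[of \<mu> s "\<lambda>g. hinner E (\<rho> g v) x" "cnj a"]])
        (use x v spanE in \<open>auto simp: space_haar inner_scale_right subset_iff\<close>)
    then show "a *\<^sub>C x \<in> ?W" using x by simp
  qed
  then have "cspan S \<subseteq> ?W" using S left by (intro cspan_minimal) auto
  then have "\<forall>v\<in>cspan S. \<forall>w\<in>cspan S. Lp_function \<mu> s (\<lambda>g. hinner E (\<rho> g v) w)" by blast
  then show ?thesis
    unfolding Lp_rep_def using csubspace_cspan spanE dense by blast
qed

end

context tree_representation
begin

text \<open>
  Right translates are dealt with by counting cosets of the conjugate \<open>a K a\<^sup>-\<^sup>1\<close>, all of which have the same
  measure; in this way only left translations of the measure occur.
\<close>

lemma translated_coefficient_Lp: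
  assumes s: "0 < s" and u: "u \<in> hcarrier E" and a: "a \<in> carrier G" and b: "b \<in> carrier G"
    and coeff: "\<And>g. g \<in> L \<Longrightarrow> hinner E (\<rho> g u) u = \<Phi> (dist' v\<^sub>0 (act g v\<^sub>0))"
    and off: "\<And>g. g \<in> carrier G \<Longrightarrow> g \<notin> L \<Longrightarrow> hinner E (\<rho> g u) u = 0"
    and summable: "summable (\<lambda>n. real (card (sphere v\<^sub>0 n)) * cmod (\<Phi> n) powr s)"
  shows "Lp_function \<mu> s (\<lambda>g. hinner E (\<rho> g (\<rho> a u)) (\<rho> b u))"
proof -
  define c where "c g = hinner E (\<rho> g (\<rho> a u)) (\<rho> b u)" for g
  define \<tau> where "\<tau> g = inv b \<otimes> g \<otimes> a" for g
  have tc: "\<tau> g \<in> carrier G" if "g \<in> carrier G" for g using that a b by (simp add: \<tau>_def)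
  have c_eq: "c g = hinner E (\<rho> (\<tau> g) u) u" if g: "g \<in> carrier G" for g
  proof -
    have "c g = hinner E (\<rho> (inv b) (\<rho> g (\<rho> a u))) u"
      using rep_adjoint[of "inv b" "\<rho> g (\<rho> a u)" u] a b g u by (simp add: c_def)
    then show ?thesis using a b g u by (simp add: \<tau>_def rep_mult)
  qed
  define D where "D = {y \<in> topspace T. inv a \<otimes> y \<otimes> a \<in> K}"
  have cont: "continuous_map T T (\<lambda>y. g \<otimes> y \<otimes> h)" if "g \<in> carrier G" "h \<in> carrier G" for g h
    using continuous_map_compose[OF continuous_translate[OF that(1)] continuous_translate_right[OF that(2)]]
    by (simp add: o_def)
  have D_open: "openin T D"
    unfolding D_def using cont[of "inv a" a] a K_open by (simp add: continuous_map_def)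
  have "D = (\<lambda>k. a \<otimes> k \<otimes> inv a) ` K"
  proof (intro equalityI subsetI)
    fix y assume "y \<in> (\<lambda>k. a \<otimes> k \<otimes> inv a) ` K"
    then obtain k where k: "k \<in> K" "y = a \<otimes> k \<otimes> inv a" by blast
    then have "inv a \<otimes> y \<otimes> a = k"
      using a K_carrier by (simp add: m_assoc mult_inv_cancel)
    then show "y \<in> D" using a k K_carrier by (simp add: D_def topspace_T)
  next
    fix y assume y: "y \<in> D"
    then have "a \<otimes> (inv a \<otimes> y) = y" using a by (simp add: D_def topspace_T m_assoc[symmetric])
    then show "y \<in> (\<lambda>k. a \<otimes> k \<otimes> inv a) ` K"
      using a y by (intro image_eqI[of _ _ "inv a \<otimes> y \<otimes> a"]) (auto simp: D_def topspace_T m_assoc)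
  qed
  moreover have "compactin T ((\<lambda>k. a \<otimes> k \<otimes> inv a) ` K)"
    using cont[of a "inv a"] a K_compact by (intro image_compactin) auto
  ultimately have D_fin: "emeasure \<mu> D < \<infinity>"
    using haar_finite_compact by simp
  define B where "B x = {g \<in> carrier G. \<tau> g \<in> L \<and> act (\<tau> g) v\<^sub>0 = x}" for x
  have B_eq: "B x = (\<lambda>y. (b \<otimes> tr x \<otimes> inv a) \<otimes> y) ` D" for x
  proof (intro equalityI subsetI)
    fix g assume "g \<in> B x"
    then have g: "g \<in> carrier G" "\<tau> g \<in> L" "act (\<tau> g) v\<^sub>0 = x" by (auto simp: B_def)
    let ?y = "a \<otimes> inv (tr x) \<otimes> inv b \<otimes> g"
    have y1: "inv a \<otimes> ?y \<otimes> a = inv (tr x) \<otimes> \<tau> g"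
      using a b g by (simp add: \<tau>_def m_assoc mult_inv_cancel)
    have "act (inv (tr x) \<otimes> \<tau> g) v\<^sub>0 = v\<^sub>0"
      using act_mult[of "inv (tr x)" "\<tau> g" "v\<^sub>0"] act_inv(1)[of "tr x" "v\<^sub>0"] tr[of x] g L_inv by simp
    then have "inv (tr x) \<otimes> \<tau> g \<in> K" using tr(1) g L_inv L_mult by (simp add: K_eq)
    then have "?y \<in> D" using y1 a b g by (simp add: D_def topspace_T)
    moreover have "g = (b \<otimes> tr x \<otimes> inv a) \<otimes> ?y"
      using a b g by (simp add: m_assoc mult_inv_cancel)
    ultimately show "g \<in> (\<lambda>y. (b \<otimes> tr x \<otimes> inv a) \<otimes> y) ` D" by blast
  next
    fix g assume "g \<in> (\<lambda>y. (b \<otimes> tr x \<otimes> inv a) \<otimes> y) ` D"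
    then obtain y where y: "y \<in> carrier G" "inv a \<otimes> y \<otimes> a \<in> K" "g = (b \<otimes> tr x \<otimes> inv a) \<otimes> y"
      by (auto simp: D_def topspace_T)
    have t: "\<tau> g = tr x \<otimes> (inv a \<otimes> y \<otimes> a)"
      using a b y by (simp add: \<tau>_def m_assoc mult_inv_cancel)
    have "\<tau> g \<in> L" "act (\<tau> g) v\<^sub>0 = x"
      unfolding t using y(2) tr[of x] L_mult act_mult by (auto simp: K_eq)
    then show "g \<in> B x" using a b y by (simp add: B_def)
  qed
  have B_sets: "B x \<in> sets \<mu>" for x
    unfolding B_eq using a b D_open by (intro open_measurable openin_translate) auto
  have B_measure: "emeasure \<mu> (B x) = emeasure \<mu> D" for x
    unfolding B_eq using a b open_measurable[OF D_open] by (intro haar_translate) auto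
  define A where "A n = (\<Union>x\<in>sphere v\<^sub>0 n. B x)" for n
  have A_sets: "A n \<in> sets \<mu>" for n
    unfolding A_def using B_sets finite_sphere by (intro sets.finite_UN) auto
  define M where "M = measure \<mu> D"
  have A_measure: "emeasure \<mu> (A n) \<le> ennreal (real (card (sphere v\<^sub>0 n)) * M)" for n
  proof -
    have "emeasure \<mu> (A n) \<le> (\<Sum>x\<in>sphere v\<^sub>0 n. emeasure \<mu> (B x))"
      unfolding A_def using B_sets finite_sphere by (intro emeasure_subadditive_finite) auto
    also have "\<dots> = of_nat (card (sphere v\<^sub>0 n)) * emeasure \<mu> D" by (simp add: B_measure)
    also have "emeasure \<mu> D = ennreal M" using D_fin by (simp add: M_def emeasure_eq_ennreal_measure)
    finally show ?thesis by (simp add: ennreal_mult'' M_def ennreal_of_nat_eq_real_of_nat)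
  qed
  have c_meas: "c \<in> borel_measurable \<mu>"
    unfolding c_def using a b u by (intro coefficient_measurable) auto
  have pointwise: "ennreal (cmod (c g) powr s) \<le> (\<Sum>n. ennreal (cmod (\<Phi> n) powr s) * indicator (A n) g)"
    if g: "g \<in> space \<mu>" for g
  proof (cases "\<tau> g \<in> L")
    case False
    then show ?thesis using c_eq[of g] off[OF tc[of g] False] g by (simp add: space_haar)
  next
    case True
    define k where "k = dist' v\<^sub>0 (act (\<tau> g) v\<^sub>0)"
    have "g \<in> A k" using g True by (auto simp: A_def B_def k_def sphere_def space_haar)
    moreover have "c g = \<Phi> k" using c_eq[of g] coeff[OF True] g by (simp add: space_haar k_def)
    ultimately have "ennreal (cmod (c g) powr s) =
        (\<Sum>n\<in>{k}. ennreal (cmod (\<Phi> n) powr s) * indicator (A n) g)" by simp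
    also have "\<dots> \<le> (\<Sum>n. ennreal (cmod (\<Phi> n) powr s) * indicator (A n) g)"
      by (intro sum_le_suminf) auto
    finally show ?thesis .
  qed
  have "(\<integral>\<^sup>+g. ennreal (cmod (c g) powr s) \<partial>\<mu>) \<le>
      (\<integral>\<^sup>+g. (\<Sum>n. ennreal (cmod (\<Phi> n) powr s) * indicator (A n) g) \<partial>\<mu>)"
    by (intro nn_integral_mono pointwise)
  also have "\<dots> = (\<Sum>n. \<integral>\<^sup>+g. ennreal (cmod (\<Phi> n) powr s) * indicator (A n) g \<partial>\<mu>)"
    using A_sets by (intro nn_integral_suminf) auto
  also have "\<dots> = (\<Sum>n. ennreal (cmod (\<Phi> n) powr s) * emeasure \<mu> (A n))"
    using A_sets by (simp add: nn_integral_cmult_indicator)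
  also have "\<dots> \<le> (\<Sum>n. ennreal (real (card (sphere v\<^sub>0 n)) * cmod (\<Phi> n) powr s * M))"
  proof (intro suminf_le)
    fix n
    have "ennreal (cmod (\<Phi> n) powr s) * emeasure \<mu> (A n) \<le>
        ennreal (cmod (\<Phi> n) powr s) * ennreal (real (card (sphere v\<^sub>0 n)) * M)"
      by (intro mult_left_mono A_measure) auto
    also have "\<dots> = ennreal (real (card (sphere v\<^sub>0 n)) * cmod (\<Phi> n) powr s * M)"
      by (simp add: ennreal_mult[symmetric] M_def mult_ac)
    finally show "ennreal (cmod (\<Phi> n) powr s) * emeasure \<mu> (A n) \<le>
      ennreal (real (card (sphere v\<^sub>0 n)) * cmod (\<Phi> n) powr s * M)" .
  qed auto
  also have "\<dots> < \<infinity>"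
    using summable_mult2[OF summable, of M] by (simp add: M_def suminf_ennreal_eq less_top[symmetric] ennreal_suminf_neq_top)
  finally have "(\<integral>\<^sup>+g. ennreal (cmod (c g) powr s) \<partial>\<mu>) < \<infinity>" .
  moreover have "(\<lambda>g. cmod (c g) powr s) \<in> borel_measurable \<mu>" using c_meas by measurable
  ultimately have "integrable \<mu> (\<lambda>g. cmod (c g) powr s)" by (intro integrableI_bounded) simp_all
  then show ?thesis using c_meas by (simp add: Lp_function_def c_def[abs_def])
qed

text \<open>
  The translates of a cyclic vector span a dense subspace, and summation over the spheres replaces
  integration over the group.
\<close>

theorem cyclic_Lp_rep:
  assumes s: "0 < s" and u: "u \<in> hcarrier E"
    and cyclic: "htopology E closure_of (cspan {\<rho> g u | g. g \<in> carrier G}) = hcarrier E"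
    and coeff: "\<And>g. g \<in> L \<Longrightarrow> hinner E (\<rho> g u) u = \<Phi> (dist' v\<^sub>0 (act g v\<^sub>0))"
    and off: "\<And>g. g \<in> carrier G \<Longrightarrow> g \<notin> L \<Longrightarrow> hinner E (\<rho> g u) u = 0"
    and summable: "summable (\<lambda>n. real (card (sphere v\<^sub>0 n)) * cmod (\<Phi> n) powr s)"
  shows "Lp_rep \<mu> s E \<rho>"
  by (rule Lp_rep_cyclic[OF _ _ cyclic])
    (use s u translated_coefficient_Lp[OF s u _ _ coeff off summable] in auto)

end

section \<open>Strong continuity from a dense set of vectors\<close>

text \<open>
  Unitary operators of which strong continuity is still to be shown. Openness of left translates is all that is
  required of the topology, so that the notion applies to subgroups with the relative topology as well.
\<close>

locale unitary_action = unitary_operators G E \<rho>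
  for G :: "('g, 'm) monoid_scheme" (structure) and E :: "'v::complex_vector hspace"
    and \<rho> :: "'g \<Rightarrow> 'v \<Rightarrow> 'v" +
  fixes T :: "'g topology"
  assumes topspace_eq: "topspace T = carrier G"
    and translate_open: "g \<in> carrier G \<Longrightarrow> openin T N \<Longrightarrow> openin T ((\<lambda>x. g \<otimes> x) ` N)"
begin

text \<open>The vectors with continuous orbit map form a closed subspace.\<close>

definition smooth :: "'v set" where
  "smooth = {f \<in> hcarrier E. \<forall>\<epsilon>>0. \<exists>N. openin T N \<and> \<one> \<in> N \<and> (\<forall>g\<in>N. hnorm E (\<rho> g f - f) < \<epsilon>)}"

lemma smoothI:
  "f \<in> hcarrier E \<Longrightarrow> (\<And>\<epsilon>. \<epsilon> > 0 \<Longrightarrow> \<exists>N. openin T N \<and> \<one> \<in> N \<and> (\<forall>g\<in>N. hnorm E (\<rho> g f - f) < \<epsilon>)) \<Longrightarrow>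
    f \<in> smooth"
  by (simp add: smooth_def)

lemma smooth_mem: "f \<in> smooth \<Longrightarrow> f \<in> hcarrier E"
  by (simp add: smooth_def)

lemma smoothD: "f \<in> smooth \<Longrightarrow> \<epsilon> > 0 \<Longrightarrow> \<exists>N. openin T N \<and> \<one> \<in> N \<and> (\<forall>g\<in>N. hnorm E (\<rho> g f - f) < \<epsilon>)"
  by (simp add: smooth_def)

lemma open_carrier: "openin T N \<Longrightarrow> g \<in> N \<Longrightarrow> g \<in> carrier G"
  using openin_subset[of T N] topspace_eq by blast

lemma csubspace_smooth: "csubspace smooth"
  unfolding csubspace_def
proof (intro conjI ballI allI)
  have "openin T (carrier G)" using topspace_eq openin_topspace by metis
  then show "0 \<in> smooth" by (auto simp: smooth_def rep_zero intro!: exI[of _ "carrier G"])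
next
  fix f f' assume f: "f \<in> smooth" and f': "f' \<in> smooth"
  note fE = smooth_mem[OF f] smooth_mem[OF f']
  show "f + f' \<in> smooth"
  proof (rule smoothI)
    fix \<epsilon> :: real assume "\<epsilon> > 0"
    then have e2: "\<epsilon> / 2 > 0" by simp
    obtain N where N: "openin T N" "\<one> \<in> N" "\<forall>g\<in>N. hnorm E (\<rho> g f - f) < \<epsilon> / 2"
      using smoothD[OF f e2] by blast
    obtain N' where N': "openin T N'" "\<one> \<in> N'" "\<forall>g\<in>N'. hnorm E (\<rho> g f' - f') < \<epsilon> / 2"
      using smoothD[OF f' e2] by blast
    have "hnorm E (\<rho> g (f + f') - (f + f')) < \<epsilon>" if g: "g \<in> N \<inter> N'" for g
    proof -
      have gc: "g \<in> carrier G" using g N(1) open_carrier by blast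
      have eq: "\<rho> g (f + f') - (f + f') = (\<rho> g f - f) + (\<rho> g f' - f')" using gc fE by (simp add: rep_add)
      have "hnorm E (\<rho> g (f + f') - (f + f')) \<le> hnorm E (\<rho> g f - f) + hnorm E (\<rho> g f' - f')"
        unfolding eq using fE gc by (intro norm_triangle) simp_all
      moreover have "hnorm E (\<rho> g f - f) < \<epsilon> / 2" "hnorm E (\<rho> g f' - f') < \<epsilon> / 2"
        using N(3) N'(3) g by blast+
      ultimately show ?thesis by linarith
    qed
    then show "\<exists>N. openin T N \<and> \<one> \<in> N \<and> (\<forall>g\<in>N. hnorm E (\<rho> g (f + f') - (f + f')) < \<epsilon>)"
      using N N' by (intro exI[of _ "N \<inter> N'"]) auto
  qed (use fE in simp)
next
  fix a f assume f: "f \<in> smooth"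
  note fE = smooth_mem[OF f]
  show "a *\<^sub>C f \<in> smooth"
  proof (rule smoothI)
    fix \<epsilon> :: real assume e: "\<epsilon> > 0"
    define M where "M = cmod a + 1"
    have M: "M > 0" by (simp add: M_def add_nonneg_pos)
    have "\<epsilon> / M > 0" using e M by simp
    then obtain N where N: "openin T N" "\<one> \<in> N" "\<forall>g\<in>N. hnorm E (\<rho> g f - f) < \<epsilon> / M"
      using smoothD[OF f] by blast
    have "hnorm E (\<rho> g (a *\<^sub>C f) - a *\<^sub>C f) < \<epsilon>" if g: "g \<in> N" for g
    proof -
      have gc: "g \<in> carrier G" using g N(1) open_carrier by blast
      have mem: "\<rho> g f - f \<in> hcarrier E" using fE gc by simp
      have "\<rho> g (a *\<^sub>C f) - a *\<^sub>C f = a *\<^sub>C (\<rho> g f - f)"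
        using scaleC_add_right[of a "\<rho> g f - f" f] gc fE by (simp add: rep_scale)
      then have "hnorm E (\<rho> g (a *\<^sub>C f) - a *\<^sub>C f) = cmod a * hnorm E (\<rho> g f - f)"
        using mem by (simp add: norm_scale)
      also have "\<dots> \<le> M * hnorm E (\<rho> g f - f)"
        using mem by (intro mult_right_mono) (auto simp: M_def)
      also have "\<dots> < M * (\<epsilon> / M)" using N g M by (intro mult_strict_left_mono) auto
      also have "\<dots> = \<epsilon>" using M by simp
      finally show ?thesis .
    qed
    then show "\<exists>N. openin T N \<and> \<one> \<in> N \<and> (\<forall>g\<in>N. hnorm E (\<rho> g (a *\<^sub>C f) - a *\<^sub>C f) < \<epsilon>)"
      using N by blast
  qed (use fE in simp)
qed

text \<open>The three-epsilon argument for uniformly equicontinuous maps.\<close>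

lemma smooth_closed:
  assumes f: "f \<in> htopology E closure_of smooth" shows "f \<in> smooth"
proof -
  have sub: "smooth \<subseteq> hcarrier E" using smooth_mem by blast
  have fE: "f \<in> hcarrier E" using f closure_of_iff[OF sub] by blast
  show ?thesis
  proof (rule smoothI[OF fE])
    fix \<epsilon> :: real assume "\<epsilon> > 0"
    then have e3: "\<epsilon> / 3 > 0" by simp
    obtain f' where f': "f' \<in> smooth" "hnorm E (f - f') < \<epsilon> / 3"
      using closure_of_approx[OF sub f e3] by blast
    have f'E: "f' \<in> hcarrier E" using f' sub by blast
    obtain N where N: "openin T N" "\<one> \<in> N" "\<forall>g\<in>N. hnorm E (\<rho> g f' - f') < \<epsilon> / 3"
      using smoothD[OF f'(1) e3] by blast
    have "hnorm E (\<rho> g f - f) < \<epsilon>" if g: "g \<in> N" for g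
    proof -
      have gc: "g \<in> carrier G" using g N(1) open_carrier by blast
      note mem = fE f'E rep_mem[OF gc fE] rep_mem[OF gc f'E]
      have "hnorm E (\<rho> g f - \<rho> g f') = hnorm E (f - f')"
        using rep_norm[OF gc, of "f - f'"] rep_diff[OF gc fE f'E] mem by simp
      moreover have "hnorm E (\<rho> g f - f) \<le> hnorm E (\<rho> g f - \<rho> g f') + hnorm E (\<rho> g f' - f)"
        using mem by (intro norm_diff_triangle)
      moreover have "hnorm E (\<rho> g f' - f) \<le> hnorm E (\<rho> g f' - f') + hnorm E (f' - f)"
        using mem by (intro norm_diff_triangle)
      moreover have "hnorm E (f' - f) = hnorm E (f - f')" using mem by (intro norm_minus_commute)
      moreover have "hnorm E (\<rho> g f' - f') < \<epsilon> / 3" using N g by blast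
      ultimately show ?thesis using f'(2) by linarith
    qed
    then show "\<exists>N. openin T N \<and> \<one> \<in> N \<and> (\<forall>g\<in>N. hnorm E (\<rho> g f - f) < \<epsilon>)" using N by blast
  qed
qed

text \<open>Continuity at the neutral element is transported to every other element by translation.\<close>

theorem unitary_rep_if_smooth_dense:
  assumes "htopology E closure_of smooth = hcarrier E" shows "unitary_rep G T E \<rho>"
proof -
  have "continuous_map T (htopology E) (\<lambda>g. \<rho> g f)" if f: "f \<in> hcarrier E" for f
    unfolding continuous_map_iff
  proof (intro conjI ballI allI impI)
    have sm: "f \<in> smooth" using smooth_closed f assms by blast
    fix g assume "g \<in> topspace T"
    then have g: "g \<in> carrier G" by (simp add: topspace_eq)
    then show "\<rho> g f \<in> hcarrier E" using f by simp
    fix \<epsilon> :: real assume "\<epsilon> > 0"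
    then obtain N where N: "openin T N" "\<one> \<in> N" "\<forall>h\<in>N. hnorm E (\<rho> h f - f) < \<epsilon>"
      using smoothD[OF sm] by blast
    have "hnorm E (\<rho> (g \<otimes> h) f - \<rho> g f) < \<epsilon>" if h: "h \<in> N" for h
    proof -
      have hc: "h \<in> carrier G" using h N(1) open_carrier by blast
      have "\<rho> (g \<otimes> h) f - \<rho> g f = \<rho> g (\<rho> h f - f)" using g hc f by (simp add: rep_mult rep_diff)
      then show ?thesis using rep_norm[OF g, of "\<rho> h f - f"] f hc N h by simp
    qed
    moreover have "g \<in> (\<lambda>x. g \<otimes> x) ` N" using N(2) g by (intro image_eqI[of _ _ \<one>]) auto
    ultimately show "\<exists>U. openin T U \<and> g \<in> U \<and> (\<forall>g'\<in>U. hnorm E (\<rho> g' f - \<rho> g f) < \<epsilon>)"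
      using translate_open[OF g N(1)] by (intro exI[of _ "(\<lambda>x. g \<otimes> x) ` N"]) auto
  qed
  moreover have "hilbert_space E" using hilbert_axioms by (simp add: hilbert_space_iff hilbert_axioms)
  ultimately show ?thesis
    unfolding unitary_rep_def using rep_unitary rep_mult by blast
qed

end

section \<open>Representations induced from an open subgroup\<close>

locale induction = top_group G T +
  U: unitary_representation "G\<lparr>carrier := L\<rparr>" "subtopology T L" V \<pi>
  for G :: "('g, 'm) monoid_scheme" (structure) and T :: "'g topology" and L :: "'g set"
    and V :: "'v::complex_vector hspace" and \<pi> :: "'g \<Rightarrow> 'v \<Rightarrow> 'v" +
  fixes R :: "'g set"
  assumes L_subgroup: "subgroup L G" and L_open: "openin T L"
    and transversal: "left_transversal G L R"
begin

lemma L_carrier [simp]: "h \<in> L \<Longrightarrow> h \<in> carrier G"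
  using subgroup.mem_carrier[OF L_subgroup] .

lemma L_one [simp]: "\<one> \<in> L" using subgroup.one_closed[OF L_subgroup] .
lemma L_mult [simp]: "h \<in> L \<Longrightarrow> k \<in> L \<Longrightarrow> h \<otimes> k \<in> L" using subgroup.m_closed[OF L_subgroup] .
lemma L_inv [simp]: "h \<in> L \<Longrightarrow> inv h \<in> L" using subgroup.m_inv_closed[OF L_subgroup] .

lemma pi_mem [simp]: "h \<in> L \<Longrightarrow> v \<in> hcarrier V \<Longrightarrow> \<pi> h v \<in> hcarrier V"
  using U.rep_mem[of h v] by simp
lemma pi_mult: "h \<in> L \<Longrightarrow> k \<in> L \<Longrightarrow> v \<in> hcarrier V \<Longrightarrow> \<pi> (h \<otimes> k) v = \<pi> h (\<pi> k v)"
  using U.rep_mult[of h k v] by simp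
lemma pi_add: "h \<in> L \<Longrightarrow> u \<in> hcarrier V \<Longrightarrow> v \<in> hcarrier V \<Longrightarrow> \<pi> h (u + v) = \<pi> h u + \<pi> h v"
  using U.rep_add[of h u v] by simp
lemma pi_scale: "h \<in> L \<Longrightarrow> v \<in> hcarrier V \<Longrightarrow> \<pi> h (a *\<^sub>C v) = a *\<^sub>C \<pi> h v"
  using U.rep_scale[of h v a] by simp
lemma pi_zero: "h \<in> L \<Longrightarrow> \<pi> h 0 = 0"
  using U.rep_zero[of h] by simp
lemma pi_inner: "h \<in> L \<Longrightarrow> u \<in> hcarrier V \<Longrightarrow> v \<in> hcarrier V \<Longrightarrow>
    hinner V (\<pi> h u) (\<pi> h v) = hinner V u v"
  using U.rep_inner[of h u v] by simp
lemma pi_norm: "h \<in> L \<Longrightarrow> v \<in> hcarrier V \<Longrightarrow> hnorm V (\<pi> h v) = hnorm V v"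
  using U.rep_norm[of h v] by simp
lemma pi_one: "v \<in> hcarrier V \<Longrightarrow> \<pi> \<one> v = v"
  using U.rep_one[of v] by simp

lemma R_carrier [simp]: "t \<in> R \<Longrightarrow> t \<in> carrier G"
  using transversal by (auto simp: left_transversal_def)

text \<open>The decomposition of the group along the transversal.\<close>

definition rpt :: "'g \<Rightarrow> 'g" where "rpt g = (THE t. t \<in> R \<and> g \<in> t <# L)"

lemma mem_coset_iff: "t \<in> carrier G \<Longrightarrow> g \<in> carrier G \<Longrightarrow> g \<in> t <# L \<longleftrightarrow> inv t \<otimes> g \<in> L"
  unfolding l_coset_def
  by (auto simp: mult_inv_cancel intro!: bexI[of _ "inv t \<otimes> g"])

lemma rpt: 
  assumes "g \<in> carrier G" shows "rpt g \<in> R" "inv (rpt g) \<otimes> g \<in> L"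
proof -
  have "\<exists>!t. t \<in> R \<and> g \<in> t <# L" using transversal assms by (simp add: left_transversal_def)
  then have "rpt g \<in> R \<and> g \<in> rpt g <# L" unfolding rpt_def by (rule theI')
  then show "rpt g \<in> R" "inv (rpt g) \<otimes> g \<in> L" using assms mem_coset_iff by auto
qed

lemma rpt_eqI: "g \<in> carrier G \<Longrightarrow> t \<in> R \<Longrightarrow> inv t \<otimes> g \<in> L \<Longrightarrow> rpt g = t"
  using transversal rpt[of g] mem_coset_iff[of t g] mem_coset_iff[of "rpt g" g]
  unfolding left_transversal_def by (metis R_carrier)

lemma rpt_mult: "g \<in> carrier G \<Longrightarrow> h \<in> L \<Longrightarrow> rpt (g \<otimes> h) = rpt g"
  using rpt[of g] by (intro rpt_eqI) (auto simp: m_assoc[symmetric])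

lemma rpt_R: "t \<in> R \<Longrightarrow> rpt t = t"
  by (intro rpt_eqI) auto

definition equivariant :: "('g \<Rightarrow> 'v) set" where
  "equivariant = {f. (\<forall>g\<in>carrier G. f g \<in> hcarrier V) \<and> (\<forall>g. g \<notin> carrier G \<longrightarrow> f g = 0) \<and>
     (\<forall>g\<in>carrier G. \<forall>h\<in>L. f (g \<otimes> h) = \<pi> (inv h) (f g))}"

lemma equivariant_mem [simp]: "f \<in> equivariant \<Longrightarrow> g \<in> carrier G \<Longrightarrow> f g \<in> hcarrier V"
  and equivariant_outside: "f \<in> equivariant \<Longrightarrow> g \<notin> carrier G \<Longrightarrow> f g = 0"
  and equivariant_mult: "f \<in> equivariant \<Longrightarrow> g \<in> carrier G \<Longrightarrow> h \<in> L \<Longrightarrow> f (g \<otimes> h) = \<pi> (inv h) (f g)"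
  by (auto simp: equivariant_def)

lemma equivariant_rpt: "f \<in> equivariant \<Longrightarrow> g \<in> carrier G \<Longrightarrow> f g = \<pi> (inv (inv (rpt g) \<otimes> g)) (f (rpt g))"
  using equivariant_mult[of f "rpt g" "inv (rpt g) \<otimes> g"] rpt[of g] by (simp add: mult_inv_cancel)

lemma equivariantI:
  assumes "\<And>g. g \<in> carrier G \<Longrightarrow> f g \<in> hcarrier V" "\<And>g. g \<notin> carrier G \<Longrightarrow> f g = 0"
    "\<And>g h. g \<in> carrier G \<Longrightarrow> h \<in> L \<Longrightarrow> f (g \<otimes> h) = \<pi> (inv h) (f g)"
  shows "f \<in> equivariant"
  using assms by (simp only: equivariant_def mem_Collect_eq) blast

lemma csubspace_equivariant: "csubspace equivariant"
  unfolding csubspace_def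
proof (intro conjI ballI allI)
  show "0 \<in> equivariant" by (rule equivariantI) (simp_all add: pi_zero)
  show "f + f' \<in> equivariant" if "f \<in> equivariant" "f' \<in> equivariant" for f f'
    by (rule equivariantI)
      (simp_all add: that pi_add equivariant_outside equivariant_mult[OF that(1)] equivariant_mult[OF that(2)])
  show "a *\<^sub>C f \<in> equivariant" if "f \<in> equivariant" for a f
    by (rule equivariantI)
      (simp_all add: that pi_scale equivariant_outside equivariant_mult[OF that] scaleC_fun_def)
qed

sublocale C: coordinates V R equivariant "\<lambda>t f. f t"
proof
  show "csubspace equivariant" by (rule csubspace_equivariant)
next
  fix f assume f: "f \<in> equivariant" "\<And>t. t \<in> R \<Longrightarrow> f t = 0"
  have "f g = 0" for g
  proof (cases "g \<in> carrier G")
    case True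
    have "f g = \<pi> (inv (inv (rpt g) \<otimes> g)) 0"
      using equivariant_rpt[OF f(1) True] f(2)[OF rpt(1)[OF True]] by (simp only:)
    then show ?thesis using pi_zero[OF L_inv[OF rpt(2)[OF True]]] by (simp only:)
  qed (use f equivariant_outside in blast)
  then show "f = 0" by (simp add: fun_eq_iff)
next
  fix x assume x: "\<And>t. t \<in> R \<Longrightarrow> x t \<in> hcarrier V"
  define f where "f g = (if g \<in> carrier G then \<pi> (inv (inv (rpt g) \<otimes> g)) (x (rpt g)) else 0)" for g
  have "f (g \<otimes> h) = \<pi> (inv h) (f g)" if g: "g \<in> carrier G" "h \<in> L" for g h
  proof -
    have "inv (inv (rpt g) \<otimes> (g \<otimes> h)) = inv h \<otimes> inv (inv (rpt g) \<otimes> g)"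
      using g rpt[OF g(1)] by (simp add: inv_mult_group m_assoc)
    then show ?thesis
      using g rpt[OF g(1)] x by (simp add: f_def rpt_mult pi_mult)
  qed
  then have "f \<in> equivariant" using rpt x by (intro equivariantI) (auto simp: f_def)
  moreover have "f t = x t" if "t \<in> R" for t using that x by (simp add: f_def rpt_R pi_one)
  ultimately show "\<exists>f\<in>equivariant. \<forall>t\<in>R. f t = x t" by blast
qed (auto simp: scaleC_fun_def)

lemma induced_space_eq: "induced_space G L R V \<pi> = C.E"
  unfolding induced_space_def C.E_def by (simp only: equivariant_def mem_Collect_eq conj_assoc)

abbreviation E where "E \<equiv> C.E"
abbreviation ind where "ind \<equiv> induced_rep G"

lemma ind_equivariant:
  assumes g: "g \<in> carrier G" and f: "f \<in> equivariant" shows "ind g f \<in> equivariant"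
proof -
  have "f (inv g \<otimes> (x \<otimes> h)) = \<pi> (inv h) (f (inv g \<otimes> x))" if "x \<in> carrier G" "h \<in> L" for x h
    using equivariant_mult[OF f, of "inv g \<otimes> x" h] that g by (simp add: m_assoc)
  then show ?thesis using g f by (intro equivariantI) (auto simp: induced_rep_def)
qed

lemma inner_rpt:
  assumes f: "f \<in> equivariant" "f' \<in> equivariant" and g: "g \<in> carrier G"
  shows "hinner V (f g) (f' g) = hinner V (f (rpt g)) (f' (rpt g))"
  using equivariant_rpt[OF f(1) g] equivariant_rpt[OF f(2) g] rpt[OF g] f
  by (simp add: pi_inner)

text \<open>Translation by a group element permutes the cosets.\<close>

lemma bij_betw_translate_rpt:
  assumes g: "g \<in> carrier G" shows "bij_betw (\<lambda>t. rpt (g \<otimes> t)) R R"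
proof -
  have inverse: "rpt (inv a \<otimes> rpt (a \<otimes> t)) = t" if a: "a \<in> carrier G" and t: "t \<in> R" for a t
  proof (rule rpt_eqI)
    have r: "rpt (a \<otimes> t) \<in> R" "inv (rpt (a \<otimes> t)) \<otimes> (a \<otimes> t) \<in> L" using rpt[of "a \<otimes> t"] a t by auto
    have "inv (inv (rpt (a \<otimes> t)) \<otimes> (a \<otimes> t)) = inv t \<otimes> (inv a \<otimes> rpt (a \<otimes> t))"
      using r a t by (simp add: inv_mult_group m_assoc)
    then show "inv t \<otimes> (inv a \<otimes> rpt (a \<otimes> t)) \<in> L" using L_inv[OF r(2)] by simp
    show "inv a \<otimes> rpt (a \<otimes> t) \<in> carrier G" "t \<in> R" using r a t by auto
  qed
  show ?thesis
    using g rpt inverse[of g] inverse[of "inv g"]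
    by (intro bij_betwI[where g = "\<lambda>t. rpt (inv g \<otimes> t)"]) auto
qed

lemma ind_mem_inner:
  assumes g: "g \<in> carrier G" and f: "f \<in> hcarrier E"
  shows "ind g f \<in> hcarrier E"
    and "f' \<in> hcarrier E \<Longrightarrow> hinner E (ind g f) (ind g f') = hinner E f f'"
proof -
  have bij: "bij_betw (\<lambda>t. rpt (inv g \<otimes> t)) R R" using g by (intro bij_betw_translate_rpt) simp
  have eq: "hinner V (ind g f1 t) (ind g f2 t) = hinner V (f1 (rpt (inv g \<otimes> t))) (f2 (rpt (inv g \<otimes> t)))"
    if "f1 \<in> equivariant" "f2 \<in> equivariant" "t \<in> R" for f1 f2 t
    using that g inner_rpt[of f1 f2 "inv g \<otimes> t"] by (simp add: induced_rep_def)
  have fW: "f \<in> equivariant" using f by (simp add: C.mem_E)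
  have "(\<lambda>t. (hnorm V (f (rpt (inv g \<otimes> t))))\<^sup>2) summable_on R"
    using f summable_on_reindex_bij_betw[OF bij, of "\<lambda>t. (hnorm V (f t))\<^sup>2"] by (simp add: C.mem_E)
  then have "(\<lambda>t. (hnorm V (ind g f t))\<^sup>2) summable_on R"
    by (rule summable_on_cong[THEN iffD1, rotated]) (simp add: hnorm_def eq[OF fW fW])
  then show "ind g f \<in> hcarrier E" using ind_equivariant[OF g fW] by (simp add: C.mem_E)
  show "hinner E (ind g f) (ind g f') = hinner E f f'" if f': "f' \<in> hcarrier E"
  proof -
    have f'W: "f' \<in> equivariant" using f' by (simp add: C.mem_E)
    have "hinner E (ind g f) (ind g f') =
        (\<Sum>\<^sub>\<infinity>t\<in>R. hinner V (f (rpt (inv g \<otimes> t))) (f' (rpt (inv g \<otimes> t))))"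
      unfolding C.inner_E by (intro infsum_cong eq fW f'W)
    also have "\<dots> = hinner E f f'"
      unfolding C.inner_E by (rule infsum_reindex_bij_betw[OF bij])
    finally show ?thesis .
  qed
qed

lemma ind_mult:
  assumes "g \<in> carrier G" "h \<in> carrier G" shows "ind (g \<otimes> h) f = ind g (ind h f)"
  using assms by (auto simp: induced_rep_def fun_eq_iff inv_mult_group m_assoc)

lemma ind_one: "f \<in> equivariant \<Longrightarrow> ind \<one> f = f"
  by (auto simp: induced_rep_def fun_eq_iff equivariant_outside)

lemma ind_add: "ind g (f + f' :: 'g \<Rightarrow> 'v) = ind g f + ind g f'"
  by (auto simp: induced_rep_def fun_eq_iff)

lemma ind_scale: "ind g (a *\<^sub>C f :: 'g \<Rightarrow> 'v) = a *\<^sub>C ind g f"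
  by (auto simp: induced_rep_def fun_eq_iff scaleC_fun_def)

lemma ind_diff: "ind g (f - f' :: 'g \<Rightarrow> 'v) = ind g f - ind g f'"
  by (auto simp: induced_rep_def fun_eq_iff)

lemma ind_norm: "g \<in> carrier G \<Longrightarrow> f \<in> hcarrier E \<Longrightarrow> hnorm E (ind g f) = hnorm E f"
  by (simp add: hnorm_def ind_mem_inner)

lemma unitary_ind:
  assumes g: "g \<in> carrier G" shows "unitary_map E E (ind g)"
proof -
  have "ind (inv g) (ind g f) = f" "ind g (ind (inv g) f) = f" if "f \<in> hcarrier E" for f
    using that g ind_mult[of "inv g" g f] ind_mult[of g "inv g" f] ind_one[of f] by (auto simp: C.mem_E)
  then have "bij_betw (ind g) (hcarrier E) (hcarrier E)"
    using g ind_mem_inner(1) by (intro bij_betwI[where g = "ind (inv g)"]) auto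
  then show ?thesis unfolding unitary_map_def using g by (simp add: ind_add ind_scale ind_mem_inner)
qed

sublocale A: unitary_action G E ind T
proof (intro unitary_action.intro unitary_operators.intro unitary_operators_axioms.intro unitary_action_axioms.intro)
  show "hilbert E" by (rule C.hilbert_E)
qed (use topspace_T openin_translate unitary_ind ind_mult group_axioms in auto)

text \<open>
  A function supported on one coset \<open>t L\<close> has a continuous orbit map, because the open subgroup \<open>t L t\<^sup>-\<^sup>1\<close> acts
  on such functions through the inducing representation.
\<close>

lemma smooth_single:
  assumes f: "f \<in> hcarrier E" and t: "t \<in> R" and z: "\<And>t'. t' \<in> R \<Longrightarrow> t' \<noteq> t \<Longrightarrow> f t' = 0"
  shows "f \<in> A.smooth"
proof -
  have fW: "f \<in> equivariant" using f by (simp add: C.mem_E)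
  define v where "v = f t"
  have v: "v \<in> hcarrier V" using fW t by (simp add: v_def)
  have "\<exists>N. openin T N \<and> \<one> \<in> N \<and> (\<forall>g\<in>N. hnorm E (ind g f - f) < \<epsilon>)" if e: "\<epsilon> > 0" for \<epsilon>
  proof -
    have one: "\<one> \<in> topspace (subtopology T L)" using topspace_T by simp
    have e2: "\<epsilon> / 2 > 0" using e by simp
    obtain N0 where N0: "openin (subtopology T L) N0" "\<one> \<in> N0" "\<forall>h\<in>N0. hnorm V (\<pi> h v - \<pi> \<one> v) < \<epsilon> / 2"
      using U.rep_continuous[OF v, unfolded U.continuous_map_iff, THEN conjunct2, rule_format, OF one e2]
      by (elim exE conjE)
    have N0': "openin T N0" "N0 \<subseteq> L" using N0(1) openin_open_subtopology[OF L_open] by auto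
    define N where "N = {g \<in> topspace T. inv t \<otimes> g \<otimes> t \<in> N0}"
    have "continuous_map T T (\<lambda>g. inv t \<otimes> g \<otimes> t)"
      using continuous_map_compose[OF continuous_translate[of "inv t"] continuous_translate_right[of t]] t
      by (simp add: o_def)
    then have "openin T N" unfolding N_def using N0'(1) by (simp add: continuous_map_def)
    moreover have "\<one> \<in> N" using N0(2) t by (simp add: N_def topspace_T)
    moreover have "hnorm E (ind g f - f) < \<epsilon>" if g: "g \<in> N" for g
    proof -
      have gc: "g \<in> carrier G" using g by (simp add: N_def topspace_T)
      define h where "h = inv t \<otimes> g \<otimes> t"
      have h: "h \<in> N0" "h \<in> L" using g N0' by (auto simp: N_def h_def)
      have at: "ind g f t = \<pi> h v"
      proof -
        have "inv g \<otimes> t = t \<otimes> inv h" using t gc by (simp add: h_def inv_mult_group m_assoc mult_inv_cancel)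
        then show ?thesis using equivariant_mult[OF fW, of t "inv h"] t h by (simp add: induced_rep_def v_def)
      qed
      have off: "ind g f t' = 0" if t': "t' \<in> R" "t' \<noteq> t" for t'
      proof -
        let ?x = "inv g \<otimes> t'"
        have "rpt ?x \<noteq> t"
        proof
          assume "rpt ?x = t"
          then have "inv t \<otimes> ?x \<in> L" using rpt[of ?x] gc t' by simp
          then have "h \<otimes> (inv t \<otimes> ?x) \<in> L" using h by simp
          then have "inv t \<otimes> t' \<in> L" using t t' gc by (simp add: h_def m_assoc mult_inv_cancel)
          then have "rpt t' = t" using t t' by (intro rpt_eqI) auto
          then show False using t' by (simp add: rpt_R)
        qed
        then have "f (rpt ?x) = 0" using z rpt[of ?x] gc t' by simp
        then show ?thesis using equivariant_rpt[OF fW, of ?x] gc t' rpt[of ?x] by (simp add: induced_rep_def pi_zero)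
      qed
      have lt: "hnorm V (\<pi> h v - v) < \<epsilon> / 2" using N0(3) h v by (simp add: pi_one)
      have "hnorm E (ind g f - f) \<le> \<epsilon> / 2"
      proof (rule C.mem_E_if_bounded(2))
        show "ind g f - f \<in> equivariant" using ind_equivariant[OF gc fW] fW C.W_diff by blast
        fix I assume I: "finite I" "I \<subseteq> R"
        have "(\<Sum>i\<in>I. (hnorm V ((ind g f - f) i))\<^sup>2) = (\<Sum>i\<in>I. if i = t then (hnorm V (\<pi> h v - v))\<^sup>2 else 0)"
          using I off z at by (intro sum.cong) (auto simp: v_def)
        also have "\<dots> \<le> (hnorm V (\<pi> h v - v))\<^sup>2" using I by (simp add: sum.delta)
        also have "\<dots> \<le> (\<epsilon> / 2)\<^sup>2" using lt v h by (intro power_mono) auto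
        finally show "(\<Sum>i\<in>I. (hnorm V ((ind g f - f) i))\<^sup>2) \<le> (\<epsilon> / 2)\<^sup>2" .
      qed (use e in auto)
      then show ?thesis using e by linarith
    qed
    ultimately show ?thesis by blast
  qed
  then show ?thesis using f by (intro A.smoothI)
qed

theorem unitary_rep_induced: "unitary_rep G T (induced_space G L R V \<pi>) (induced_rep G)"
proof -
  have sub: "A.smooth \<subseteq> hcarrier E" using A.smooth_mem by blast
  have "htopology E closure_of A.smooth = hcarrier E"
  proof (rule C.total_single_coordinates[OF A.csubspace_smooth sub])
    fix f t assume "f \<in> hcarrier E" "t \<in> R" "\<And>i. i \<in> R \<Longrightarrow> i \<noteq> t \<Longrightarrow> f i = 0"
    then have "f \<in> A.smooth" by (rule smooth_single)
    then show "f \<in> htopology E closure_of A.smooth"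
      using closure_of_subset[of A.smooth "htopology E"] sub unfolding C.E.topspace_htopology by blast
  qed
  then show ?thesis unfolding induced_space_eq by (rule A.unitary_rep_if_smooth_dense)
qed

subsection \<open>Vectors supported on the subgroup\<close>

definition extend :: "'v \<Rightarrow> 'g \<Rightarrow> 'v" where
  "extend v = (\<lambda>g. if g \<in> L then \<pi> (inv g) v else 0)"

lemma extend_equivariant: 
  assumes v: "v \<in> hcarrier V" shows "extend v \<in> equivariant"
proof -
  have "extend v (g \<otimes> h) = \<pi> (inv h) (extend v g)" if g: "g \<in> carrier G" "h \<in> L" for g h
  proof (cases "g \<in> L")
    case True
    then show ?thesis using g v by (simp add: extend_def inv_mult_group pi_mult)
  next
    case False
    have "g \<otimes> h \<notin> L"
    proof
      assume "g \<otimes> h \<in> L"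
      then have "(g \<otimes> h) \<otimes> inv h \<in> L" using g by simp
      then show False using False g by (simp add: m_assoc)
    qed
    then show ?thesis using False g by (simp add: extend_def pi_zero)
  qed
  then show ?thesis using v by (intro equivariantI) (auto simp: extend_def)
qed

lemma rpt_one: "rpt \<one> \<in> R" "rpt \<one> \<in> L"
  using rpt[of \<one>] L_inv[of "inv (rpt \<one>)"] by auto

lemma R_L: "t \<in> R \<Longrightarrow> t \<in> L \<Longrightarrow> t = rpt \<one>"
  using rpt_eqI[of \<one> t] by simp

lemma extend_mem:
  assumes v: "v \<in> hcarrier V" shows "extend v \<in> hcarrier E"
proof (rule C.mem_E_if_bounded(1))
  fix I assume I: "finite I" "I \<subseteq> R"
  have "(\<Sum>i\<in>I. (hnorm V (extend v i))\<^sup>2) \<le> (\<Sum>i\<in>I. if i = rpt \<one> then (hnorm V v)\<^sup>2 else 0)"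
    using I R_L v by (intro sum_mono) (auto simp: extend_def pi_norm)
  also have "\<dots> \<le> (hnorm V v)\<^sup>2" using I by (simp add: sum.delta)
  finally show "(\<Sum>i\<in>I. (hnorm V (extend v i))\<^sup>2) \<le> (hnorm V v)\<^sup>2" .
qed (use v extend_equivariant in auto)

lemma inner_extend:
  assumes f: "f \<in> equivariant" and w: "w \<in> hcarrier V"
  shows "hinner E f (extend w) = hinner V (f \<one>) w"
proof -
  let ?t = "rpt \<one>"
  have zero: "hinner V (f t) (extend w t) = 0" if "t \<in> R" "t \<noteq> ?t" for t
    using that R_L f by (auto simp: extend_def)
  have "hinner E f (extend w) = (\<Sum>\<^sub>\<infinity>t\<in>{?t}. hinner V (f t) (extend w t))"
    unfolding C.inner_E using rpt_one zero by (intro infsum_cong_neutral) auto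
  also have "\<dots> = hinner V (f ?t) (extend w ?t)" by simp
  also have "\<dots> = hinner V (f \<one>) (extend w \<one>)"
    using inner_rpt[OF f extend_equivariant[OF w], of \<one>] by simp
  finally show ?thesis using w by (simp add: extend_def pi_one)
qed

lemma ind_extend:
  assumes h: "h \<in> L" and v: "v \<in> hcarrier V" shows "ind h (extend v) = extend (\<pi> h v)"
proof
  fix g
  show "ind h (extend v) g = extend (\<pi> h v) g"
  proof (cases "g \<in> L")
    case True
    then show ?thesis using h v by (simp add: induced_rep_def extend_def inv_mult_group pi_mult)
  next
    case False
    have "inv h \<otimes> g \<notin> L" if "g \<in> carrier G"
    proof
      assume "inv h \<otimes> g \<in> L"
      then have "h \<otimes> (inv h \<otimes> g) \<in> L" using h by simp
      then show False using False h that by (simp add: mult_inv_cancel)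
    qed
    then show ?thesis using False by (simp add: induced_rep_def extend_def)
  qed
qed

text \<open>
  The functions supported on \<open>L\<close> form a copy of the inducing representation, and a translate by \<open>g \<notin> L\<close> is supported on
  another coset. So a matrix coefficient of \<open>L\<close>, extended by zero, is one of the induced representation.
\<close>

lemma coefficient_extend:
  assumes g: "g \<in> carrier G" and v: "v \<in> hcarrier V" and w: "w \<in> hcarrier V"
  shows "hinner E (ind g (extend v)) (extend w) = (if g \<in> L then hinner V (\<pi> g v) w else 0)"
proof -
  have "inv g \<notin> L" if "g \<notin> L" using that L_inv[of "inv g"] g by auto
  then show ?thesis
    using inner_extend[OF ind_equivariant[OF g extend_equivariant[OF v]] w] g v w
    by (auto simp: induced_rep_def extend_def)
qed

lemma norm_extend:
  assumes v: "v \<in> hcarrier V" shows "hnorm E (extend v) = hnorm V v"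
  using inner_extend[OF extend_equivariant[OF v] v] v by (simp add: hnorm_def extend_def pi_one)

lemma extend_add: "u \<in> hcarrier V \<Longrightarrow> v \<in> hcarrier V \<Longrightarrow> extend (u + v) = extend u + extend v"
  and extend_scale: "v \<in> hcarrier V \<Longrightarrow> extend (a *\<^sub>C v) = a *\<^sub>C extend v"
  and extend_zero: "extend 0 = 0"
  by (auto simp: extend_def fun_eq_iff pi_add pi_scale pi_zero scaleC_fun_def)

text \<open>
  The translates of the functions supported on \<open>L\<close> by a transversal are the functions supported on a single coset.
\<close>

theorem cyclic_induced:
  assumes \<xi>: "\<xi> \<in> hcarrier V"
    and cyclic: "htopology V closure_of (cspan {\<pi> h \<xi> | h. h \<in> L}) = hcarrier V"
  shows "htopology E closure_of (cspan {ind g (extend \<xi>) | g. g \<in> carrier G}) = hcarrier E"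
proof (rule C.total_single_coordinates[OF csubspace_cspan])
  let ?S = "cspan {ind g (extend \<xi>) | g. g \<in> carrier G}"
  show sub: "?S \<subseteq> hcarrier E"
    using ind_mem_inner(1) extend_mem[OF \<xi>] by (intro cspan_minimal C.csubspace_E) auto
  fix f t assume f: "f \<in> hcarrier E" and t: "t \<in> R" and z: "\<And>i. i \<in> R \<Longrightarrow> i \<noteq> t \<Longrightarrow> f i = 0"
  have tc: "t \<in> carrier G" using t by simp
  have fW: "f \<in> equivariant" using f by (simp add: C.mem_E)
  define v where "v = f t"
  have v: "v \<in> hcarrier V" using fW t by (simp add: v_def)
  have f_eq: "f = ind t (extend v)"
  proof -
    have "f - ind t (extend v) = 0"
    proof (rule C.coord_separate)
      show "f - ind t (extend v) \<in> equivariant"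
        using fW ind_equivariant[OF tc extend_equivariant[OF v]] C.W_diff by blast
      fix i assume i: "i \<in> R"
      show "(f - ind t (extend v)) i = 0"
      proof (cases "i = t")
        case True
        then show ?thesis using tc v by (simp add: induced_rep_def extend_def pi_one v_def)
      next
        case False
        have "inv t \<otimes> i \<notin> L" using rpt_eqI[of i t] rpt_R[OF i] t i False by auto
        then show ?thesis using z i False by (simp add: induced_rep_def extend_def)
      qed
    qed
    then show ?thesis by simp
  qed
  have "csubspace {w \<in> hcarrier V. ind t (extend w) \<in> ?S}"
    using csubspace_cspan[of "{ind g (extend \<xi>) | g. g \<in> carrier G}"]
    unfolding csubspace_def
    by (auto simp: extend_add extend_scale extend_zero ind_add ind_scale) (simp add: induced_rep_def zero_fun_def)
  moreover have "{\<pi> h \<xi> | h. h \<in> L} \<subseteq> {w \<in> hcarrier V. ind t (extend w) \<in> ?S}"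
  proof
    fix w assume "w \<in> {\<pi> h \<xi> | h. h \<in> L}"
    then obtain h where h: "h \<in> L" "w = \<pi> h \<xi>" by blast
    have "ind t (extend w) = ind (t \<otimes> h) (extend \<xi>)" using h \<xi> tc ind_extend by (simp add: ind_mult)
    then have "ind t (extend w) \<in> ?S" using h tc by (intro subsetD[OF cspan_superset]) auto
    then show "w \<in> {w \<in> hcarrier V. ind t (extend w) \<in> ?S}" using h \<xi> by simp
  qed
  ultimately have span: "w \<in> hcarrier V \<and> ind t (extend w) \<in> ?S" if "w \<in> cspan {\<pi> h \<xi> | h. h \<in> L}" for w
    using cspan_minimal that by blast
  have subV: "cspan {\<pi> h \<xi> | h. h \<in> L} \<subseteq> hcarrier V" using span by blast
  show "f \<in> htopology E closure_of ?S"
    unfolding C.E.closure_of_iff[OF sub]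
  proof (intro CollectI conjI f allI impI)
    fix \<epsilon> :: real assume e: "\<epsilon> > 0"
    have "v \<in> htopology V closure_of (cspan {\<pi> h \<xi> | h. h \<in> L})" using v cyclic by simp
    then obtain w where w: "w \<in> cspan {\<pi> h \<xi> | h. h \<in> L}" "hnorm V (v - w) < \<epsilon>"
      using U.closure_of_approx[OF subV _ e] by blast
    have wV: "w \<in> hcarrier V" "ind t (extend w) \<in> ?S" using span w by auto
    have "f - ind t (extend w) = ind t (extend (v - w))"
      using extend_add[of "v - w" w] v wV by (simp add: f_eq ind_diff[symmetric])
    then have "hnorm E (f - ind t (extend w)) = hnorm V (v - w)"
      using tc v wV by (simp add: ind_norm extend_mem norm_extend)
    then show "\<exists>y\<in>?S. hnorm E (f - y) < \<epsilon>"
      using w(2) wV(2) by (intro bexI[of _ "ind t (extend w)"]) simp_all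
  qed
qed

end

section \<open>The group of honest almost automorphisms\<close>

context reg_tree
begin

definition tball :: "'a \<Rightarrow> nat \<Rightarrow> 'a set" where
  "tball c n = {x. dist' c x \<le> n}"

lemma finite_tball: "finite (tball c n)"
proof -
  have "tball c n = (\<Union>m\<le>n. sphere c m)" by (auto simp: tball_def sphere_def)
  then show ?thesis using finite_sphere by simp
qed

lemma finite_subtree_tball: "finite_subtree adj (tball c n)"
proof -
  define r where "r = (\<lambda>u v. adj u v \<and> u \<in> tball c n \<and> v \<in> tball c n)"
  have to_c: "r\<^sup>*\<^sup>* x c" if "x \<in> tball c n" for x
    using that
  proof (induction "dist' c x" arbitrary: x)
    case 0
    then show ?case by simp
  next
    case (Suc m)
    then obtain y where y: "adj x y" "dist' c y = m" using exists_parent[of c x m] by auto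
    then have "y \<in> tball c n" using Suc by (simp add: tball_def)
    then have "r\<^sup>*\<^sup>* y c" "r x y" using Suc y by (auto simp: r_def)
    then show ?case by (rule converse_rtranclp_into_rtranclp[rotated])
  qed
  have sym: "r\<^sup>*\<^sup>* u v \<Longrightarrow> r\<^sup>*\<^sup>* v u" for u v
    by (rule sympD[OF symp_rtranclp]) (auto simp: r_def symp_def adj_sym)
  have "r\<^sup>*\<^sup>* x y" if "x \<in> tball c n" "y \<in> tball c n" for x y
    using to_c[OF that(1)] sym[OF to_c[OF that(2)]] by (rule rtranclp_trans)
  moreover have "c \<in> tball c n" by (simp add: tball_def)
  ultimately show ?thesis
    using finite_tball unfolding finite_subtree_def graph_component_def r_def by auto
qed

lemma finite_subset_tball:
  assumes "finite A" shows "\<exists>n. A \<subseteq> tball c n"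
proof -
  have "dist' c x \<le> Max (dist' c ` A)" if "x \<in> A" for x using assms that by simp
  then show ?thesis by (auto simp: tball_def)
qed

lemma image_tball: "h \<in> tree_auts adj \<Longrightarrow> h ` tball c n = tball (h c) n"
proof (intro equalityI subsetI)
  fix y assume h: "h \<in> tree_auts adj" and y: "y \<in> tball (h c) n"
  obtain x where "y = h x" using bij_is_surj[OF tree_auts_bij[OF h]] by (metis surjE)
  then show "y \<in> h ` tball c n" using y dist_aut[OF h] by (auto simp: tball_def)
qed (auto simp: tball_def dist_aut)

end

context tree_action
begin

abbreviation reps where "reps \<equiv> honest_reps adj H"
abbreviation rel where "rel \<equiv> honest_rel adj H"
abbreviation HG where "HG \<equiv> honest_group adj H"
abbreviation emb where "emb \<equiv> honest_embed adj H"

text \<open>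
  Outside a large ball such a function is the restriction of \<open>h\<close>, and the image of a ball is a ball.
\<close>

lemma honest_reps_if_cofinite:
  assumes h: "h \<in> H" and A: "finite A" and F: "\<And>x. x \<notin> A \<Longrightarrow> F x = h x"
  shows "F \<in> reps"
proof -
  obtain c :: 'a where True by blast
  obtain n where n: "A \<subseteq> tball c n" using finite_subset_tball[OF A] by blast
  let ?T = "tball c n"
  have ha: "h \<in> tree_auts adj" by (rule H_aut[OF h])
  have Fh: "F x = h x" if "x \<in> - ?T" for x using F n that by blast
  have "bij_betw h (- ?T) (- h ` ?T)"
    using tree_auts_bij[OF ha] inj_on_subset[OF bij_is_inj[OF tree_auts_bij[OF ha]]]
    by (simp add: bij_betw_def bij_image_Compl_eq)
  then have "bij_betw F (- ?T) (- h ` ?T)" using bij_betw_cong[of "- ?T" F h, OF Fh] by blast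
  moreover have "finite_subtree adj (h ` ?T)" using finite_subtree_tball image_tball[OF ha] by simp
  moreover have "F y = h y" if "x \<in> - ?T" "y \<in> graph_component adj (- ?T) x" for x y
  proof -
    have "(\<lambda>u v. adj u v \<and> u \<in> - ?T \<and> v \<in> - ?T)\<^sup>*\<^sup>* x y" using that by (simp add: graph_component_def)
    then have "y \<in> - ?T" using that(1) by (cases rule: rtranclp.cases) auto
    then show ?thesis by (rule Fh)
  qed
  ultimately show ?thesis
    unfolding honest_reps_def mem_Collect_eq using finite_subtree_tball[of c n] Fh h tree_auts_adj[OF ha]
    by (intro exI[of _ ?T] exI[of _ "h ` ?T"] conjI ballI bexI[of _ h]) auto
qed

text \<open>
  Being equal outside a finite set is the same as being equal outside a finite subtree, as every finite set lies in a
  ball. The product of classes is formed by means of representatives that are not automorphisms themselves, for which this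
  lemma identifies the class.
\<close>

lemma rel_class_eq:
  assumes h: "h \<in> H" and A: "finite A" and F: "\<And>x. x \<notin> A \<Longrightarrow> F x = h x"
  shows "rel `` {F} = emb h"
proof -
  have reps: "F \<in> reps" "h \<in> reps"
    using honest_reps_if_cofinite[OF h A F] honest_reps_if_cofinite[OF h, of "{}" h] by auto
  have agree: "(\<exists>B. finite_subtree adj B \<and> (\<forall>x\<in>- B. f x = g x)) \<longleftrightarrow> (\<exists>B. finite B \<and> (\<forall>x\<in>- B. f x = g x))"
    for f g :: "'a \<Rightarrow> 'a"
  proof
    assume "\<exists>B. finite B \<and> (\<forall>x\<in>- B. f x = g x)"
    then obtain B where B: "finite B" "\<forall>x\<in>- B. f x = g x" by blast
    obtain n c where "B \<subseteq> tball c n" using finite_subset_tball[OF B(1)] by blast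
    then show "\<exists>B. finite_subtree adj B \<and> (\<forall>x\<in>- B. f x = g x)"
      using B(2) finite_subtree_tball[of c n] by blast
  qed (auto simp: finite_subtree_def)
  have "(\<exists>B. finite B \<and> (\<forall>x\<in>- B. F x = g x)) \<longleftrightarrow> (\<exists>B. finite B \<and> (\<forall>x\<in>- B. h x = g x))" for g
  proof
    assume "\<exists>B. finite B \<and> (\<forall>x\<in>- B. F x = g x)"
    then obtain B where B: "finite B" "\<forall>x\<in>- B. F x = g x" by blast
    have "h x = g x" if "x \<in> - (A \<union> B)" for x using F[of x] B(2) that by auto
    then show "\<exists>B. finite B \<and> (\<forall>x\<in>- B. h x = g x)" using A B(1) by (intro exI[of _ "A \<union> B"]) auto
  next
    assume "\<exists>B. finite B \<and> (\<forall>x\<in>- B. h x = g x)"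
    then obtain B where "finite B" "\<forall>x\<in>- B. h x = g x" by blast
    then show "\<exists>B. finite B \<and> (\<forall>x\<in>- B. F x = g x)" using A F by (intro exI[of _ "A \<union> B"]) auto
  qed
  then have "(F, g) \<in> rel \<longleftrightarrow> (h, g) \<in> rel" for g
    unfolding honest_rel_def using reps agree by simp
  then show ?thesis by (auto simp: honest_embed_def)
qed

lemma emb_agree: "f \<in> emb h \<Longrightarrow> \<exists>A. finite A \<and> (\<forall>x. x \<notin> A \<longrightarrow> f x = h x)"
  by (fastforce simp: honest_embed_def honest_rel_def finite_subtree_def)

lemma emb_mult:
  assumes h: "h \<in> H" and k: "k \<in> H"
  shows "emb h \<otimes>\<^bsub>HG\<^esub> emb k = emb (h \<circ> k)"
proof -
  have "rel `` {f \<circ> g} = emb (h \<circ> k)" if fg: "f \<in> emb h" "g \<in> emb k" for f g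
  proof -
    obtain A B where A: "finite A" "\<And>x. x \<notin> A \<Longrightarrow> f x = h x" and B: "finite B" "\<And>x. x \<notin> B \<Longrightarrow> g x = k x"
      using emb_agree fg by metis
    have "inj k" using tree_auts_bij[OF H_aut[OF k]] bij_is_inj by blast
    then have "finite (k -` A)" using A(1) finite_vimageI by blast
    then show ?thesis
      using A B by (intro rel_class_eq[of _ "B \<union> k -` A"] comp_mem h k) auto
  qed
  moreover have "h \<in> emb h" "k \<in> emb k"
  proof -
    have "l \<in> emb l" if "l \<in> H" for l
    proof -
      have "l \<in> reps" using honest_reps_if_cofinite[OF that, of "{}" l] by simp
      then show ?thesis using finite_subtree_tball by (auto simp: honest_embed_def honest_rel_def)
    qed
    then show "h \<in> emb h" "k \<in> emb k" using h k by auto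
  qed
  ultimately show ?thesis by (auto simp: honest_group_def)
qed

lemma emb_id: "\<one>\<^bsub>HG\<^esub> = emb id"
  by (simp add: honest_group_def honest_embed_def)

subsection \<open>Compact vertex stabilisers\<close>

abbreviation pointwise :: "('a \<Rightarrow> 'a) topology" where
  "pointwise \<equiv> product_topology (\<lambda>_. discrete_topology UNIV) UNIV"

lemma continuous_eval: "continuous_map pointwise (discrete_topology UNIV) (\<lambda>f. f x)"
  by (rule continuous_map_product_projection) simp

lemma closedin_two_points: "closedin pointwise {f. P (f x) (f y)}"
proof -
  have "continuous_map pointwise (prod_topology (discrete_topology UNIV) (discrete_topology UNIV)) (\<lambda>f. (f x, f y))"
    by (intro continuous_map_pairedI continuous_eval)
  then have "continuous_map pointwise (discrete_topology UNIV) (\<lambda>f. (f x, f y))"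
    by (metis UNIV_Times_UNIV prod_topology_discrete_topology)
  from closedin_continuous_map_preimage[OF this, of "{(a, b). P a b}"] show ?thesis by simp
qed

text \<open>
  Fixing a vertex replaces surjectivity by closed conditions: an injective adjacency-preserving map of a connected
  graph in which all vertices have the same finite degree is surjective.
\<close>

lemma stabiliser_tree_auts:
  "{h \<in> tree_auts adj. h v = v} =
    {f. f v = v} \<inter> (\<Inter>x y. {f. adj (f x) (f y) \<longleftrightarrow> adj x y}) \<inter> (\<Inter>x y. {f. f x = f y \<longrightarrow> x = y})" (is "?L = ?R")
proof (intro equalityI subsetI)
  fix f assume f: "f \<in> ?L"
  then have "inj f" using tree_auts_bij bij_is_inj by blast
  then show "f \<in> ?R" using f by (auto simp: tree_auts_adj inj_eq)
next
  fix f assume "f \<in> ?R"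
  then have f: "f v = v" "\<And>x y. adj (f x) (f y) \<longleftrightarrow> adj x y" "inj f" by (auto simp: inj_def)
  have nb: "f ` nbrs x = nbrs (f x)" for x
    using f card_nbrs finite_nbrs
    by (intro card_subset_eq) (auto simp: card_image inj_on_subset)
  have "y \<in> range f" for y
    using connected[of v y]
  proof (induction rule: rtranclp_induct)
    case base
    show ?case using f(1) by (metis rangeI)
  next
    case (step y z)
    then obtain x where "y = f x" by blast
    then have "z \<in> f ` nbrs x" using step nb by simp
    then show ?case by blast
  qed
  then have "bij f" using f(3) by (auto simp: bij_def)
  then show "f \<in> ?L" using f by (simp add: tree_auts_def)
qed

text \<open>
  The stabiliser of \<open>v\<close> is a closed subset of the product of the finite spheres around \<open>v\<close>, which is compact by
  Tychonoff's theorem.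
\<close>

lemma compactin_stabiliser:
  assumes cl: "closedin (aut_topology adj) H"
  shows "compactin (subgroup_topology adj H) (fixator H {v})"
proof -
  obtain C where C: "closedin pointwise C" "H = C \<inter> tree_auts adj"
    using cl by (auto simp: aut_topology_def closedin_subtopology)
  have fix_eq: "fixator H {v} = C \<inter> {h \<in> tree_auts adj. h v = v}"
    using C(2) by (auto simp: fixator_def)
  have "closedin pointwise {h \<in> tree_auts adj. h v = v}"
    unfolding stabiliser_tree_auts
    using closedin_two_points[of "\<lambda>a b. a = v" v v] closedin_two_points
    by (intro closedin_Int closedin_INT) auto
  then have closed: "closedin pointwise (fixator H {v})"
    unfolding fix_eq using C(1) by (rule closedin_Int[rotated])
  let ?P = "PiE UNIV (\<lambda>y. sphere v (dist' v y))"
  have "compactin pointwise ?P"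
    using finite_sphere by (simp add: compactin_PiE finite_imp_compactin)
  moreover have "fixator H {v} \<subseteq> ?P"
  proof
    fix h assume "h \<in> fixator H {v}"
    then have h: "h \<in> H" "h v = v" by (auto simp: fixator_def)
    have "dist' v (h y) = dist' v y" for y using dist_aut[OF H_aut[OF h(1)], of v y] h(2) by simp
    then show "h \<in> ?P" by (auto simp: sphere_def PiE_def)
  qed
  ultimately have "compactin pointwise (fixator H {v})"
    using closed closed_compactin by blast
  moreover have "fixator H {v} \<subseteq> H" "H \<subseteq> tree_auts adj" using H_aut by (auto simp: fixator_def)
  ultimately show ?thesis by (auto simp: aut_topology_def compactin_subtopology)
qed

lemma openin_stabiliser: "openin (subgroup_topology adj H) (fixator H {v})"
proof -
  have "openin pointwise {f. f v = v}"
    using openin_continuous_map_preimage[OF continuous_eval[of v], of "{v}"] by simp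
  moreover have "fixator H {v} = ({f. f v = v} \<inter> tree_auts adj) \<inter> H"
    using H_aut by (auto simp: fixator_def)
  ultimately show ?thesis unfolding aut_topology_def openin_subtopology by blast
qed

lemma topspace_subgroup: "topspace (subgroup_topology adj H) = H"
  using H_aut by (auto simp: aut_topology_def)

end

text \<open>
  The copy \<open>L\<close> of \<open>H\<close> inside the group of honest almost automorphisms acts on the tree through \<open>act\<close>, the inverse of the
  embedding. The embedding is injective as it is a homeomorphism onto \<open>L\<close>.
\<close>

locale honest_action = tree_action d adj H
  for d :: nat and adj :: "'a \<Rightarrow> 'a \<Rightarrow> bool" and H :: "('a \<Rightarrow> 'a) set" +
  fixes T :: "('a \<Rightarrow> 'a) set topology" and \<mu> :: "('a \<Rightarrow> 'a) set measure"
  assumes closed: "closedin (aut_topology adj) H"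
    and boundary: "boundary_transitive adj H"
    and topology: "honest_topology adj H T"
    and haar: "left_haar_measure (honest_group adj H) T \<mu>"
begin

abbreviation L where "L \<equiv> emb ` H"
abbreviation act where "act \<equiv> inv_into H emb"

sublocale haar_group HG T \<mu>
  using topology haar by unfold_locales (auto simp: honest_topology_def tdlc_group_def)

lemma L_open: "openin T L"
  and emb_homeomorphic: "homeomorphic_map (subgroup_topology adj H) (subtopology T L) emb"
  using topology by (auto simp: honest_topology_def)

lemma emb_inj: "inj_on emb H"
  using homeomorphic_imp_injective_map[OF emb_homeomorphic] unfolding topspace_subgroup .

lemma act_emb [simp]: "h \<in> H \<Longrightarrow> act (emb h) = h"
  using emb_inj by simp

lemma emb_carrier: "h \<in> H \<Longrightarrow> emb h \<in> carrier HG"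
  using openin_subset_carrier[OF L_open] by blast

lemma emb_inv: "h \<in> H \<Longrightarrow> inv\<^bsub>HG\<^esub> (emb h) = emb (finv h)"
  using emb_mult[OF inv_mem, of h h] inv_aut(3)[OF H_aut, of h]
  by (intro inv_equality) (auto simp: emb_id emb_carrier inv_mem)

lemma L_subgroup: "subgroup L HG"
proof
  show "L \<subseteq> carrier HG" using emb_carrier by blast
  show "x \<otimes>\<^bsub>HG\<^esub> y \<in> L" if "x \<in> L" "y \<in> L" for x y using that emb_mult comp_mem by auto
  show "\<one>\<^bsub>HG\<^esub> \<in> L" unfolding emb_id using id_mem by blast
  show "inv\<^bsub>HG\<^esub> x \<in> L" if "x \<in> L" for x using that emb_inv inv_mem by auto
qed

lemma act_mult: "x \<in> L \<Longrightarrow> y \<in> L \<Longrightarrow> act (x \<otimes>\<^bsub>HG\<^esub> y) = act x \<circ> act y"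
  using emb_mult comp_mem by auto

abbreviation K where "K v \<equiv> emb ` fixator H {v}"

lemma K_eq: "K v = {x \<in> L. act x v = v}"
  by (auto simp: fixator_def)

lemma K_open: "openin T (K v)"
proof -
  have "openin (subtopology T L) (K v)"
    using homeomorphic_map_openness_eq[OF emb_homeomorphic, of "fixator H {v}"] openin_stabiliser[of v]
    unfolding topspace_subgroup by (simp add: fixator_def)
  then show ?thesis using openin_open_subtopology[OF L_open] by blast
qed

lemma K_compact: "compactin T (K v)"
proof -
  have "compactin (subtopology T L) (K v)"
    using compactin_stabiliser[OF closed, of v] homeomorphic_imp_continuous_map[OF emb_homeomorphic]
    by (rule image_compactin)
  then show ?thesis by (simp add: compactin_subtopology)
qed

lemma K_subgroup: "subgroup (K v) HG"
proof
  show "K v \<subseteq> carrier HG" using emb_carrier by (auto simp: fixator_def)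
  show "x \<otimes>\<^bsub>HG\<^esub> y \<in> K v" if "x \<in> K v" "y \<in> K v" for x y
    using that emb_mult comp_mem by (auto simp: fixator_def)
  show "\<one>\<^bsub>HG\<^esub> \<in> K v" unfolding emb_id using id_mem by (auto simp: fixator_def)
  show "inv\<^bsub>HG\<^esub> x \<in> K v" if x: "x \<in> K v" for x
  proof -
    obtain h where h: "h \<in> H" "h v = v" "x = emb h" using x by (auto simp: fixator_def)
    then have "finv h v = v" using inv_apply(1)[of h v] by simp
    then show ?thesis using h emb_inv inv_mem by (auto simp: fixator_def)
  qed
qed

end

section \<open>The Dirichlet space of a tree\<close>

definition cplx :: "complex hspace" where
  "cplx = \<lparr>hcarrier = UNIV, hinner = (\<lambda>x y. x * cnj y)\<rparr>"

lemma cplx_simps [simp]: "hcarrier cplx = UNIV" "hinner cplx x y = x * cnj y"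
  by (simp_all add: cplx_def)

lemma hnorm_cplx [simp]: "hnorm cplx x = cmod x"
  by (simp add: hnorm_def complex_norm_square[symmetric] Re_complex_of_real del: of_real_power)

lemma hilbert_cplx: "hilbert cplx"
proof -
  interpret prehilbert cplx
  proof
    fix x :: complex assume "x \<noteq> 0"
    then have "0 < (cmod x)\<^sup>2" by simp
    then show "0 < Re (hinner cplx x x)"
      using complex_norm_square[of x] by (metis Re_complex_of_real cplx_simps(2))
  qed (auto simp: csubspace_def scaleC_complex_def algebra_simps)
  show ?thesis
  proof (intro hilbert.intro hilbert_axioms.intro prehilbert_axioms)
    have "\<exists>x. \<forall>\<epsilon>>0. \<exists>N. \<forall>n\<ge>N. cmod (\<sigma> n - x) < \<epsilon>"
      if "\<forall>\<epsilon>>0. \<exists>N. \<forall>m\<ge>N. \<forall>n\<ge>N. cmod (\<sigma> m - \<sigma> n) < \<epsilon>" for \<sigma> :: "nat \<Rightarrow> complex"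
    proof -
      have "Cauchy \<sigma>" using that by (simp add: Cauchy_def dist_norm)
      then obtain x where "\<sigma> \<longlonglongrightarrow> x" using Cauchy_convergent_iff convergent_def by blast
      then show ?thesis by (auto simp: LIMSEQ_iff)
    qed
    then show "Metric_space.mcomplete (hcarrier cplx) (hdist cplx)"
      unfolding mcomplete_iff by simp
  qed
qed

lemma has_sum_exchange:
  fixes f g :: "'i \<Rightarrow> complex"
  assumes f: "(f has_sum S) UNIV" and eq: "\<And>x. x \<noteq> a \<Longrightarrow> x \<noteq> b \<Longrightarrow> f x = g x"
    and ab: "a \<noteq> b" "f a + f b = g a + g b"
  shows "(g has_sum S) UNIV"
proof -
  have "((\<lambda>x. g x - f x) has_sum 0) UNIV"
    using eq ab by (intro has_sum_finite_neutralI[of "{a, b}"]) (auto simp: algebra_simps)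
  from has_sum_add[OF f this] show ?thesis by simp
qed

context reg_tree
begin

text \<open>
  Seen from \<open>x\<close>, two adjacent vertices other than \<open>x\<close> lie in the same direction.
\<close>

lemma parent_change_base:
  assumes cc: "adj c c'" and x: "x \<noteq> c" "x \<noteq> c'"
  shows "parent c' x = parent c x"
proof (rule parent_eqI)
  define p where "p = parent c x"
  have p: "adj x p" "dist' c x = Suc (dist' c p)" using parent[OF x(1)] by (auto simp: p_def)
  have q: "adj x (parent c' x)" "Suc (dist' c' (parent c' x)) = dist' c' x" using parent[OF x(2)] by auto
  have near: "dist' c y \<le> Suc (dist' c' y)" "dist' c' y \<le> Suc (dist' c y)" for y
    using dist_adj_le[OF cc, of y] dist_adj_le[OF adj_sym[OF cc], of y] dist_sym[of y] by auto
  have "dist' c' p \<noteq> Suc (dist' c' x)"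
  proof
    assume "dist' c' p = Suc (dist' c' x)"
    then have e: "dist' c x = Suc (dist' c' x)" using near[of p] near[of x] p(2) by linarith
    then have "parent c' x = p"
      using near(1)[of "parent c' x"] q p by (intro parent_unique[OF q(1) p(1), of c]) auto
    then show False using q \<open>dist' c' p = Suc (dist' c' x)\<close> by simp
  qed
  then show "dist' c' x = Suc (dist' c' (parent c x))"
    using dist_nbr_cases[OF p(1), of c'] by (auto simp: p_def)
  show "adj x (parent c x)" using p(1) by (simp add: p_def)
qed

lemma parent_nbr: "adj c c' \<Longrightarrow> parent c c' = c"
  by (intro parent_eqI) (auto simp: adj_sym dist_adj)

lemma parent_aut: "h \<in> tree_auts adj \<Longrightarrow> x \<noteq> c \<Longrightarrow> parent (h c) (h x) = h (parent c x)"
  using parent[of x c] by (intro parent_eqI) (auto simp: tree_auts_adj dist_aut)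

text \<open>
  The vertex \<open>x\<close> lies on the geodesic from \<open>c\<close> to \<open>y\<close> exactly if the step from \<open>x\<close> towards \<open>c\<close> leads away from \<open>y\<close>.
\<close>

lemma dist_parent_iff:
  assumes x: "x \<noteq> c"
  shows "dist' y (parent c x) = Suc (dist' y x) \<longleftrightarrow> dist' c y = dist' c x + dist' y x"
proof
  assume "dist' c y = dist' c x + dist' y x"
  then have "dist' c x + dist' y x \<le> dist' c (parent c x) + dist' (parent c x) y"
    using dist_triangle[of c y "parent c x"] by simp
  moreover have "dist' y (parent c x) \<le> Suc (dist' y x)"
    using dist_adj_le parent(1)[OF x] by blast
  ultimately show "dist' y (parent c x) = Suc (dist' y x)"
    using parent(2)[OF x] dist_sym[of y] by simp
next
  assume "dist' y (parent c x) = Suc (dist' y x)"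
  then show "dist' c y = dist' c x + dist' y x"
    using x
  proof (induction "dist' y x" arbitrary: x)
    case 0
    then show ?case by simp
  next
    case (Suc n)
    then have xy: "x \<noteq> y" by auto
    define w where "w = parent y x"
    have w: "adj x w" "Suc (dist' y w) = dist' y x" using parent[OF xy] by (auto simp: w_def)
    have "w \<noteq> parent c x" using w Suc by auto
    then have "w \<in> children c x" using w nbrs_eq[OF Suc.prems(2)] by blast
    then have wc: "w \<noteq> c" "parent c w = x" "dist' c w = Suc (dist' c x)"
      using mem_children_iff[of w c x] by (blast, blast, simp add: children_def)
    then have "dist' c y = dist' c w + dist' y w" using Suc w by (intro Suc(1)) auto
    then show ?case using wc w by simp
  qed
qed

lemma on_geodesic_parent_iff:
  assumes y: "y \<noteq> c"
  shows "dist' c (parent c y) = dist' c x + dist' (parent c y) x \<longleftrightarrow> x \<noteq> y \<and> dist' c y = dist' c x + dist' y x"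
    (is "?l \<longleftrightarrow> ?r")
proof
  assume l: ?l
  have "dist' y x \<le> Suc (dist' (parent c y) x)"
    using dist_adj_le[OF adj_sym[OF parent(1)[OF y]], of x] dist_sym by metis
  moreover have "dist' c y \<le> dist' c x + dist' y x" using dist_triangle[of c y x] dist_sym by metis
  ultimately show ?r using l parent(2)[OF y] by auto
next
  assume r: ?r
  define w where "w = parent x y"
  have w: "adj y w" "Suc (dist' x w) = dist' x y" using parent[of y x] r by (auto simp: w_def)
  have "dist' c w \<le> dist' c x + dist' x w" by (rule dist_triangle)
  then have "dist' c y = Suc (dist' c w)"
    using r w dist_nbr_cases[OF w(1), of c] dist_sym[of x y] by auto
  then have "parent c y = w" using w(1) by (intro parent_eqI)
  then show ?l using r w parent(2)[OF y] dist_sym[of x] by auto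
qed

text \<open>
  The Dirichlet form \<open>u(c) w(c)* + \<Sum> (u(x) - r u(p(x))) (w(x) - r w(p(x)))* / (1 - r\<^sup>2)\<close>, where \<open>p(x)\<close> is the
  neighbour of \<open>x\<close> in the direction of \<open>c\<close> and the sum is over \<open>x \<noteq> c\<close>. It does not depend on \<open>c\<close>: moving \<open>c\<close> to a
  neighbour only reverses the direction of one edge.
\<close>

definition dform :: "real \<Rightarrow> 'a \<Rightarrow> ('a \<Rightarrow> complex) \<Rightarrow> ('a \<Rightarrow> complex) \<Rightarrow> 'a \<Rightarrow> complex" where
  "dform r c u w x = (if x = c then u c * cnj (w c)
     else (u x - of_real r * u (parent c x)) * cnj (w x - of_real r * w (parent c x)) / of_real (1 - r\<^sup>2))"

lemma dform_change_base:
  assumes r: "r\<^sup>2 \<noteq> 1" and s: "(dform r c u w has_sum S) UNIV"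
  shows "(dform r c' u w has_sum S) UNIV"
  using connected[of c c']
proof (induction rule: rtranclp_induct)
  case (step y z)
  have yz: "y \<noteq> z" using step adj_irrefl by auto
  have r': "complex_of_real (1 - r\<^sup>2) \<noteq> 0" using r by (simp only: of_real_eq_0_iff)
  show ?case
  proof (rule has_sum_exchange[OF step.IH])
    show "dform r y u w x = dform r z u w x" if "x \<noteq> y" "x \<noteq> z" for x
      using that parent_change_base[OF step(2)] by (simp add: dform_def)
    have e: "dform r y u w z = (u z - of_real r * u y) * cnj (w z - of_real r * w y) / of_real (1 - r\<^sup>2)"
      "dform r z u w y = (u y - of_real r * u z) * cnj (w y - of_real r * w z) / of_real (1 - r\<^sup>2)"
      using yz parent_nbr[OF step(2)] parent_nbr[OF adj_sym[OF step(2)]] by (auto simp: dform_def)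
    note m = e[THEN nonzero_eq_divide_eq[OF r', THEN iffD1]]
    have b: "dform r y u w y = u y * cnj (w y)" "dform r z u w z = u z * cnj (w z)"
      by (simp_all add: dform_def)
    have "(dform r y u w y + dform r y u w z) * of_real (1 - r\<^sup>2) =
        (dform r z u w y + dform r z u w z) * of_real (1 - r\<^sup>2)"
      unfolding distrib_right m b by (simp add: power2_eq_square algebra_simps)
    then show "dform r y u w y + dform r y u w z = dform r z u w y + dform r z u w z"
      using r' by simp
  qed (rule yz)
qed (rule s)

text \<open>
  An automorphism carries the form based at \<open>c\<close> to the form based at the image of \<open>c\<close>, which has the same value.
\<close>

lemma dform_aut:
  assumes r: "r\<^sup>2 \<noteq> 1" and h: "h \<in> tree_auts adj" and s: "(dform r c u w has_sum S) UNIV"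
  shows "(dform r c (u \<circ> h) (w \<circ> h) has_sum S) UNIV"
proof -
  have b: "bij h" by (rule tree_auts_bij[OF h])
  have "dform r (h c) u w (h x) = dform r c (u \<circ> h) (w \<circ> h) x" for x
    using b parent_aut[OF h, of x c] by (auto simp: dform_def bij_def inj_eq)
  moreover have "(dform r (h c) u w has_sum S) UNIV" by (rule dform_change_base[OF r s])
  ultimately show ?thesis
    using has_sum_reindex_bij_betw[OF b, of "dform r (h c) u w" S] by simp
qed

end

locale dirichlet = honest_action d adj H T \<mu>
  for d :: nat and adj :: "'a \<Rightarrow> 'a \<Rightarrow> bool" and H :: "('a \<Rightarrow> 'a) set"
    and T :: "('a \<Rightarrow> 'a) set topology" and \<mu> :: "('a \<Rightarrow> 'a) set measure" +
  fixes v\<^sub>0 :: 'a and r :: real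
  assumes r: "0 < r" "r < 1"
begin

lemma r2: "r\<^sup>2 < 1"
  using r by (simp add: power_less_one_iff)

text \<open>
  The representation spaces in the theorem below consist of functions of maps of the vertex set. Accordingly a function
  \<open>u\<close> of the vertices is represented by the function \<open>g \<mapsto> u(g(v\<^sub>0))\<close>; it is recovered from the values on constant maps.
\<close>

definition lift :: "('a \<Rightarrow> complex) \<Rightarrow> ('a \<Rightarrow> 'a) \<Rightarrow> complex" where
  "lift u = (\<lambda>g. u (g v\<^sub>0))"

definition drop :: "(('a \<Rightarrow> 'a) \<Rightarrow> complex) \<Rightarrow> 'a \<Rightarrow> complex" where
  "drop F = (\<lambda>x. F (\<lambda>_. x))"

lemma drop_lift [simp]: "drop (lift u) = u"
  by (simp add: drop_def lift_def)

text \<open>The coordinates in which the Dirichlet form is the sum of squares.\<close>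

definition grad :: "'a \<Rightarrow> (('a \<Rightarrow> 'a) \<Rightarrow> complex) \<Rightarrow> complex" where
  "grad x F = (if x = v\<^sub>0 then drop F v\<^sub>0
     else (drop F x - of_real r * drop F (parent v\<^sub>0 x)) / of_real (sqrt (1 - r\<^sup>2)))"

lemma sqrt_pos: "sqrt (1 - r\<^sup>2) > 0"
  using r2 by simp

lemma grad_inner: "grad x F * cnj (grad x F') = dform r v\<^sub>0 (drop F) (drop F') x"
proof -
  have "complex_of_real (sqrt (1 - r\<^sup>2)) * complex_of_real (sqrt (1 - r\<^sup>2)) = complex_of_real (1 - r\<^sup>2)"
    using r2 by (simp add: of_real_mult[symmetric] del: of_real_mult)
  then show ?thesis by (simp add: grad_def dform_def)
qed

sublocale D: coordinates cplx UNIV "range lift" grad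
proof (intro coordinates.intro coordinates_axioms.intro hilbert_cplx)
  have add: "lift (\<lambda>x. u x + w x) = lift u + lift w" and scale: "lift (\<lambda>x. a * u x) = a *\<^sub>C lift u"
    and zero: "lift (\<lambda>x. 0) = 0" for u w a
    by (auto simp: lift_def scaleC_fun_def scaleC_complex_def)
  show "csubspace (range lift)"
    unfolding csubspace_def using add[symmetric] scale[symmetric] zero[symmetric] by auto
next
  fix F F' and x :: 'a
  show "grad x (F + F') = grad x F + grad x F'"
    by (simp add: grad_def drop_def add_divide_distrib[symmetric] algebra_simps)
next
  fix F a and x :: 'a
  show "grad x (a *\<^sub>C F) = a *\<^sub>C grad x F"
    by (simp add: grad_def drop_def scaleC_fun_def scaleC_complex_def algebra_simps)
next
  fix F assume F: "F \<in> range lift" and z: "\<And>x. x \<in> UNIV \<Longrightarrow> grad x F = 0"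
  obtain u where u: "F = lift u" using F by blast
  have "u x = 0" for x
  proof (induction "dist' v\<^sub>0 x" arbitrary: x)
    case 0
    have "u v\<^sub>0 = 0" using z[of "v\<^sub>0"] by (simp add: grad_def u)
    then show ?case using 0 by simp
  next
    case (Suc n)
    then have "x \<noteq> v\<^sub>0" by auto
    then have "u (parent v\<^sub>0 x) = 0" using Suc parent(2)[of x "v\<^sub>0"] by simp
    then show ?case using z[of x] \<open>x \<noteq> v\<^sub>0\<close> sqrt_pos by (simp add: grad_def u)
  qed
  then show "F = 0" by (simp add: u lift_def fun_eq_iff)
next
  fix w :: "'a \<Rightarrow> complex"
  define val where "val = rec_nat (\<lambda>x. w v\<^sub>0)
    (\<lambda>n p x. of_real r * p (parent v\<^sub>0 x) + of_real (sqrt (1 - r\<^sup>2)) * w x)"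
  define u where "u x = val (dist' v\<^sub>0 x) x" for x
  have "u v\<^sub>0 = w v\<^sub>0" by (simp add: u_def val_def)
  moreover have "u x = of_real r * u (parent v\<^sub>0 x) + of_real (sqrt (1 - r\<^sup>2)) * w x" if "x \<noteq> v\<^sub>0" for x
    using parent(2)[OF that] by (simp add: u_def val_def flip: parent(2)[OF that])
  ultimately have "grad x (lift u) = w x" for x using sqrt_pos by (simp add: grad_def)
  then show "\<exists>F\<in>range lift. \<forall>x\<in>UNIV. grad x F = w x" by blast
qed auto

abbreviation D where "D \<equiv> D.E"

lemma mem_D: "F \<in> hcarrier D \<longleftrightarrow> F \<in> range lift \<and> (\<exists>S. (dform r v\<^sub>0 (drop F) (drop F) has_sum S) UNIV)"
proof -
  have eq: "dform r v\<^sub>0 (drop F) (drop F) x = complex_of_real ((hnorm cplx (grad x F))\<^sup>2)" for x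
    using grad_inner[of x F F] complex_norm_square[of "grad x F"] by simp
  have "(\<lambda>x. (hnorm cplx (grad x F))\<^sup>2) summable_on UNIV \<longleftrightarrow>
      (\<lambda>x. complex_of_real ((hnorm cplx (grad x F))\<^sup>2)) summable_on UNIV"
    using summable_on_Re[of "\<lambda>x. complex_of_real ((hnorm cplx (grad x F))\<^sup>2)" UNIV]
      summable_on_of_real[of "\<lambda>x. (hnorm cplx (grad x F))\<^sup>2" UNIV]
    by (auto simp del: of_real_power)
  then show ?thesis unfolding D.mem_E by (simp only: eq[symmetric] summable_on_def)
qed

lemma inner_D: "(dform r v\<^sub>0 (drop F) (drop F') has_sum S) UNIV \<Longrightarrow> hinner D F F' = S"
  by (simp add: D.inner_E grad_inner infsumI)

lemma has_sum_inner_D: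
  assumes "F \<in> hcarrier D" "F' \<in> hcarrier D"
  shows "(dform r v\<^sub>0 (drop F) (drop F') has_sum hinner D F F') UNIV"
  using has_sum_infsum[OF D.inner_summable[OF assms]] unfolding D.inner_E by (simp add: grad_inner)

definition trans :: "('a \<Rightarrow> 'a) \<Rightarrow> (('a \<Rightarrow> 'a) \<Rightarrow> complex) \<Rightarrow> ('a \<Rightarrow> 'a) \<Rightarrow> complex" where
  "trans h F = (\<lambda>g. F (finv h \<circ> g))"

lemma drop_trans: "drop (trans h F) = drop F \<circ> finv h"
  by (simp add: drop_def trans_def comp_def)

lemma trans_lift: "trans h (lift u) = lift (u \<circ> finv h)"
  by (simp add: lift_def trans_def)

lemma trans_mem_inner:
  assumes h: "h \<in> H" and F: "F \<in> hcarrier D"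
  shows "trans h F \<in> hcarrier D"
    and "F' \<in> hcarrier D \<Longrightarrow> hinner D (trans h F) (trans h F') = hinner D F F'"
proof -
  have r1: "r\<^sup>2 \<noteq> 1" and ih: "finv h \<in> tree_auts adj" using r2 H_aut inv_mem h by auto
  obtain u S where u: "F = lift u" "(dform r v\<^sub>0 u u has_sum S) UNIV" using F by (auto simp: mem_D)
  show "trans h F \<in> hcarrier D"
    unfolding mem_D drop_trans using dform_aut[OF r1 ih u(2)] u(1) by (auto simp: trans_lift)
  show "hinner D (trans h F) (trans h F') = hinner D F F'" if "F' \<in> hcarrier D"
    by (rule inner_D) (unfold drop_trans, rule dform_aut[OF r1 ih has_sum_inner_D[OF F that]])
qed

lemma trans_comp: "g \<in> H \<Longrightarrow> h \<in> H \<Longrightarrow> trans (g \<circ> h) F = trans g (trans h F)"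
  using o_inv_distrib[OF tree_auts_bij[OF H_aut] tree_auts_bij[OF H_aut], of g h]
  by (simp add: trans_def comp_assoc)

lemma trans_finv:
  assumes "h \<in> H" shows "trans (finv h) (trans h F) = F" "trans h (trans (finv h) F) = F"
  using trans_comp[of "finv h" h F] trans_comp[of h "finv h" F] assms inv_mem inv_aut[OF H_aut]
  by (auto simp: trans_def)

lemma unitary_trans: "h \<in> H \<Longrightarrow> unitary_map D D (trans h)"
proof -
  assume h: "h \<in> H"
  then have "bij_betw (trans h) (hcarrier D) (hcarrier D)"
    using trans_mem_inner(1) inv_mem trans_finv
    by (intro bij_betwI[where g = "trans (finv h)"]) auto
  moreover have "trans h (F + F') = trans h F + trans h F'" "trans h (a *\<^sub>C F) = a *\<^sub>C trans h F" for F F' a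
    by (auto simp: trans_def scaleC_fun_def)
  ultimately show ?thesis unfolding unitary_map_def using trans_mem_inner(2)[OF h] by blast
qed

text \<open>The reproducing kernel of the Dirichlet space is \<open>r\<close> to the power of the distance.\<close>

definition kern :: "'a \<Rightarrow> ('a \<Rightarrow> 'a) \<Rightarrow> complex" where
  "kern x = lift (\<lambda>y. of_real (r ^ dist' x y))"

lemma trans_kern: "h \<in> H \<Longrightarrow> trans h (kern x) = kern (h x)"
proof -
  assume h: "h \<in> H"
  have "dist' x (finv h y) = dist' (h x) y" for y
    using dist_aut[OF H_aut[OF h], of x "finv h y"] inv_apply(2)[OF h] by simp
  then show ?thesis by (simp add: kern_def trans_lift comp_def)
qed

text \<open>
  The gradient of the kernel at \<open>y\<close> is supported on the geodesic from the base vertex to \<open>y\<close>: off the geodesic the step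
  towards the base vertex is a step towards \<open>y\<close>, where the values differ by the factor \<open>r\<close>.
\<close>

lemma grad_kern:
  "grad x (kern y) = (if x = v\<^sub>0 then of_real (r ^ dist' y v\<^sub>0)
    else if dist' v\<^sub>0 y = dist' v\<^sub>0 x + dist' y x then of_real (sqrt (1 - r\<^sup>2) * r ^ dist' y x) else 0)"
proof (cases "x = v\<^sub>0")
  case False
  have sq: "(1 - r\<^sup>2) / sqrt (1 - r\<^sup>2) = sqrt (1 - r\<^sup>2)" using r2 by (simp add: real_div_sqrt)
  have g: "grad x (kern y) = of_real ((r ^ dist' y x - r * r ^ dist' y (parent v\<^sub>0 x)) / sqrt (1 - r\<^sup>2))"
    using False by (simp add: grad_def kern_def)
  show ?thesis
  proof (cases "dist' v\<^sub>0 y = dist' v\<^sub>0 x + dist' y x")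
    case True
    then have "dist' y (parent v\<^sub>0 x) = Suc (dist' y x)" using dist_parent_iff[OF False] by simp
    then have "r ^ dist' y x - r * r ^ dist' y (parent v\<^sub>0 x) = (1 - r\<^sup>2) * r ^ dist' y x"
      by (simp add: algebra_simps power2_eq_square)
    then have "(r ^ dist' y x - r * r ^ dist' y (parent v\<^sub>0 x)) / sqrt (1 - r\<^sup>2) = sqrt (1 - r\<^sup>2) * r ^ dist' y x"
      using sq by (metis times_divide_eq_left)
    then show ?thesis using False True g by simp
  next
    case nt: False
    then have "dist' y (parent v\<^sub>0 x) \<noteq> Suc (dist' y x)" using dist_parent_iff[OF False] by simp
    then have "dist' y x = Suc (dist' y (parent v\<^sub>0 x))"
      using dist_nbr_cases[OF parent(1)[OF False], of y] by auto
    then show ?thesis using False nt g by simp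
  qed
qed (simp add: grad_def kern_def)

lemma kern_base_mem: "kern v\<^sub>0 \<in> hcarrier D"
proof (rule D.mem_E_if_bounded(1))
  fix I :: "'a set" assume I: "finite I"
  have "(\<Sum>i\<in>I. (hnorm cplx (grad i (kern v\<^sub>0)))\<^sup>2) = (\<Sum>i\<in>I. if i = v\<^sub>0 then 1 else 0)"
    by (intro sum.cong) (auto simp: grad_kern)
  also have "\<dots> \<le> 1\<^sup>2" using I by (simp add: sum.delta)
  finally show "(\<Sum>i\<in>I. (hnorm cplx (grad i (kern v\<^sub>0)))\<^sup>2) \<le> 1\<^sup>2" .
qed (auto simp: kern_def)

text \<open>
  For the base vertex there is a single non-zero coordinate; the other kernel functions are translates of this one.
\<close>

lemma kern_mem: "kern x \<in> hcarrier D"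
proof -
  obtain h where "h \<in> H" "h v\<^sub>0 = x" using transitive by (auto simp: vertex_transitive_def)
  then show ?thesis using trans_mem_inner(1)[OF _ kern_base_mem, of h] trans_kern by simp
qed

lemma inner_kern_base: "hinner D (kern x) (kern v\<^sub>0) = of_real (r ^ dist' v\<^sub>0 x)"
proof -
  have "hinner D (kern x) (kern v\<^sub>0) = (\<Sum>\<^sub>\<infinity>i\<in>{v\<^sub>0}. grad i (kern x) * cnj (grad i (kern v\<^sub>0)))"
    unfolding D.inner_E cplx_simps by (rule infsum_cong_neutral) (auto simp: grad_kern)
  then show ?thesis by (simp add: grad_kern dist_sym)
qed

text \<open>Such a vector is a multiple of a combination of the kernel functions at the two ends of an edge.\<close>

lemma single_coordinate_span:
  assumes F: "F \<in> hcarrier D" and z: "\<And>x. x \<noteq> j \<Longrightarrow> grad x F = 0"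
  shows "F \<in> cspan (range kern)"
proof -
  define G where "G = (if j = v\<^sub>0 then kern v\<^sub>0 else kern j - of_real r *\<^sub>C kern (parent v\<^sub>0 j))"
  note cs = csubspace_cspan[of "range kern"]
  have kc: "kern x \<in> cspan (range kern)" for x by (rule subsetD[OF cspan_superset rangeI])
  have sc: "a *\<^sub>C y \<in> cspan (range kern)" if "y \<in> cspan (range kern)" for a y
    using cs that by (simp add: csubspace_def)
  have G: "G \<in> cspan (range kern)"
    using kc csubspace_diff[OF cs kc sc[OF kc]] by (simp add: G_def)
  have W: "kern x \<in> range lift" "F \<in> range lift" for x
    using kern_mem[of x] F unfolding D.mem_E by blast+
  have GW: "G \<in> range lift" using D.W_diff[OF W(1) D.W_scale[OF W(1)]] W(1) by (simp add: G_def)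
  have gG: "grad x G = (if x = j then (if j = v\<^sub>0 then 1 else of_real (sqrt (1 - r\<^sup>2))) else 0)" for x
  proof (cases "j = v\<^sub>0")
    case True
    then show ?thesis by (auto simp: G_def grad_kern)
  next
    case False
    define p where "p = parent v\<^sub>0 j"
    have diff: "grad x G = grad x (kern j) - of_real r * grad x (kern p)"
      using False D.coord_diff[OF W(1) D.W_scale[OF W(1)], of x] D.coord_scale[OF W(1), of x]
      by (simp add: G_def scaleC_complex_def p_def)
    have p: "dist' v\<^sub>0 j = Suc (dist' v\<^sub>0 p)" using parent(2)[OF False] by (simp add: p_def)
    have on: "dist' v\<^sub>0 p = dist' v\<^sub>0 x + dist' p x \<longleftrightarrow> x \<noteq> j \<and> dist' v\<^sub>0 j = dist' v\<^sub>0 x + dist' j x"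
      using on_geodesic_parent_iff[OF False, of x] by (simp add: p_def)
    consider "x = v\<^sub>0" | "x \<noteq> v\<^sub>0" "x = j" | "x \<noteq> v\<^sub>0" "x \<noteq> j" by blast
    then show ?thesis
    proof cases
      case 1
      have "dist' j v\<^sub>0 = Suc (dist' p v\<^sub>0)" using p dist_sym[of _ "v\<^sub>0"] by simp
      then show ?thesis unfolding diff using 1 False by (simp add: grad_kern)
    next
      case 2
      then show ?thesis unfolding diff grad_kern using on False by simp
    next
      case 3
      show ?thesis
      proof (cases "dist' v\<^sub>0 j = dist' v\<^sub>0 x + dist' j x")
        case True
        then have op: "dist' v\<^sub>0 p = dist' v\<^sub>0 x + dist' p x" using on 3 by blast
        then have "dist' j x = Suc (dist' p x)" using True p by linarith
        then show ?thesis unfolding diff grad_kern if_P[OF True] if_P[OF op] using 3 by simp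
      next
        case nt: False
        then have "dist' v\<^sub>0 p \<noteq> dist' v\<^sub>0 x + dist' p x" using on by blast
        then show ?thesis unfolding diff grad_kern using 3 nt by simp
      qed
    qed
  qed
  define a where "a = grad j F / grad j G"
  have nz: "grad j G \<noteq> 0" using gG sqrt_pos by simp
  have "F - a *\<^sub>C G = 0"
  proof (rule D.coord_separate)
    show "F - a *\<^sub>C G \<in> range lift" by (rule D.W_diff[OF W(2) D.W_scale[OF GW]])
    have "grad x (F - a *\<^sub>C G) = grad x F - a * grad x G" for x
      using D.coord_diff[OF W(2) D.W_scale[OF GW], of x] D.coord_scale[OF GW, of x]
      by (simp add: scaleC_complex_def)
    then show "grad x (F - a *\<^sub>C G) = 0" for x
      using z[of x] nz gG[of x] by (cases "x = j") (simp_all add: a_def)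
  qed
  then have "F = a *\<^sub>C G" by simp
  then show ?thesis using sc[OF G] by simp
qed

lemma kern_span_subset: "cspan (range kern) \<subseteq> hcarrier D"
  using kern_mem by (intro cspan_minimal D.csubspace_E) auto

lemma kern_dense: "htopology D closure_of (cspan (range kern)) = hcarrier D"
proof (rule D.total_single_coordinates[OF csubspace_cspan kern_span_subset])
  fix F j assume "F \<in> hcarrier D" "\<And>i. i \<in> UNIV \<Longrightarrow> i \<noteq> j \<Longrightarrow> grad i F = 0"
  then have "F \<in> cspan (range kern)" using single_coordinate_span by blast
  then show "F \<in> htopology D closure_of (cspan (range kern))"
    using closure_of_subset[of "cspan (range kern)" "htopology D"] kern_span_subset
    unfolding D.E.topspace_htopology by blast
qed

end

section \<open>Spherical functions and exponential functions of the distance\<close>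

lemma spherical_seq_unique:
  assumes "0 < q" "\<Phi> 0 = 1" "\<Phi> 1 = \<gamma>"
    and rec: "\<And>n. of_nat q * \<Phi> (n + 2) = (of_nat q + 1) * \<gamma> * \<Phi> (n + 1) - \<Phi> n"
  shows "spherical_seq q \<gamma> n = (\<Phi> n :: complex)"
proof -
  have q: "(of_nat q :: complex) \<noteq> 0" "of_nat q + 1 \<noteq> (0::complex)"
    using assms(1) by (simp, metis add.commute of_nat_Suc of_nat_neq_0)
  have "spherical_seq q \<gamma> n = \<Phi> n \<and> spherical_seq q \<gamma> (Suc n) = \<Phi> (Suc n)"
  proof (induction n)
    case (Suc n)
    have cancel: "a * (e / a * (g * x - y / e)) = e * g * x - y" if "a \<noteq> 0" "e \<noteq> 0" for a e g x y :: complex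
      using that by (simp add: right_diff_distrib)
    have "of_nat q * spherical_seq q \<gamma> (Suc (Suc n)) = (of_nat q + 1) * \<gamma> * \<Phi> (n + 1) - \<Phi> n"
      using Suc cancel[OF q, of \<gamma>] by simp
    also have "\<dots> = of_nat q * \<Phi> (Suc (Suc n))" using rec[of n] by simp
    finally show ?case using Suc q by simp
  qed (use assms in simp)
  then show ?thesis by blast
qed

context reg_tree
begin

abbreviation q :: real where "q \<equiv> real (d - 1)"

lemma q_gt_1: "1 < q" using degree by simp
lemma d_eq: "real d = q + 1" using degree by simp

lemma growth_powr: "growth (q powr (- x)) = (q powr x + q powr (1 - x)) / (q + 1)"
proof -
  have "q * q powr (- x) = q powr (1 - x)" using q_gt_1 by (simp add: powr_mult_base)
  moreover have "inverse (q powr (- x)) = q powr x" using q_gt_1 by (simp add: powr_minus)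
  ultimately show ?thesis by (simp only: growth_def d_eq)
qed

text \<open>
  The difference of the two values is a positive multiple of \<open>(q\<^sup>y - q\<^sup>x) (q\<^sup>1\<^sup>-\<^sup>x\<^sup>-\<^sup>y - 1)\<close>. Hence the norm of the Hecke operator
  determines the exponent as long as the exponent is at most \<open>1 / 2\<close>.
\<close>

lemma growth_strict_antimono:
  assumes "0 \<le> x" "x < y" "y \<le> 1 / 2"
  shows "growth (q powr (- y)) < growth (q powr (- x))"
proof -
  have "q powr x < q powr y" using assms q_gt_1 by simp
  moreover have "q powr (1 - x - y) > 1" using assms q_gt_1 by (intro gr_one_powr) auto
  ultimately have "0 < (q powr y - q powr x) * (q powr (1 - x - y) - 1)" by simp
  also have "\<dots> = (q powr x + q powr (1 - x)) - (q powr y + q powr (1 - y))"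
    by (simp add: algebra_simps powr_add[symmetric])
  finally show ?thesis unfolding growth_powr using q_gt_1 by (simp add: divide_strict_right_mono)
qed

lemma growth_antimono_iff:
  assumes "0 \<le> x" "x \<le> 1 / 2" "0 \<le> y" "y \<le> 1 / 2"
  shows "growth (q powr (- x)) \<le> growth (q powr (- y)) \<longleftrightarrow> y \<le> x"
proof (cases "x < y")
  case True
  then show ?thesis using growth_strict_antimono[of x y] assms by linarith
next
  case False
  then have "x = y \<or> growth (q powr (- x)) < growth (q powr (- y))"
    using growth_strict_antimono[of y x] assms by linarith
  then show ?thesis using False by auto
qed

text \<open>
  The spherical function of parameter \<open>x \<in> [0, 1/2)\<close>. The ratios \<open>q\<^sup>-\<^sup>x\<close> and \<open>q\<^sup>x\<^sup>-\<^sup>1\<close> are the two roots of the characteristic equation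
  \<open>q t\<^sup>2 - (q + 1) g t + 1 = 0\<close> of its recursion, and the coefficients are determined by the values \<open>1\<close> and \<open>g\<close> at distances
  \<open>0\<close> and \<open>1\<close>.
\<close>

definition sph :: "real \<Rightarrow> nat \<Rightarrow> real" where
  "sph x n = (let a = q powr (- x); b = q powr (x - 1); g = growth a in
    (g - b) / (a - b) * a ^ n - (g - a) / (a - b) * b ^ n)"

lemma sph_params:
  assumes "0 \<le> x" "x < 1 / 2"
  defines "a \<equiv> q powr (- x)" and "b \<equiv> q powr (x - 1)"
  shows "0 < b" "b < a" "a \<le> growth a" "q * a * b = 1" "growth a * (q + 1) = inverse a + q * a"
    "inverse a = q * b"
proof -
  show b: "0 < b" using q_gt_1 by (simp add: b_def)
  show "b < a" using assms q_gt_1 by (simp add: a_def b_def)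
  show ab: "q * a * b = 1" using q_gt_1 by (simp add: a_def b_def powr_add[symmetric] powr_mult_base)
  have a: "0 < a" using q_gt_1 by (simp add: a_def)
  show g: "growth a * (q + 1) = inverse a + q * a" unfolding growth_def d_eq using q_gt_1 by simp
  have "inverse a * (q * a * b) = q * b" using a by simp
  then show "inverse a = q * b" unfolding ab by simp
  have "a \<le> 1" using assms q_gt_1 by (simp add: a_def powr_le_one_le ge_one_powr_ge_zero powr_minus_divide)
  then have "a \<le> inverse a" using a one_le_inverse[of a] by linarith
  then have "a * (q + 1) \<le> growth a * (q + 1)" unfolding g by (simp add: algebra_simps)
  then show "a \<le> growth a" by (rule mult_right_le_imp_le) (use q_gt_1 in linarith)
qed

lemma sph_rec:
  assumes x: "0 \<le> x" "x < 1 / 2"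
  shows "sph x 0 = 1" "sph x 1 = growth (q powr (- x))"
    "q * sph x (n + 2) = (q + 1) * growth (q powr (- x)) * sph x (n + 1) - sph x n"
proof -
  define a b where "a = q powr (- x)" and "b = q powr (x - 1)"
  note p = sph_params[OF x, folded a_def b_def]
  define c c' where "c = (growth a - b) / (a - b)" and "c' = (growth a - a) / (a - b)"
  have s: "sph x n = c * a ^ n - c' * b ^ n" for n by (simp add: sph_def a_def b_def c_def c'_def Let_def)
  have nz: "a - b \<noteq> 0" using p(2) by simp
  have "c - c' = ((growth a - b) - (growth a - a)) / (a - b)"
    unfolding c_def c'_def by (simp only: diff_divide_distrib)
  then show "sph x 0 = 1" unfolding s using nz by simp
  have "c * a - c' * b = ((growth a - b) * a - (growth a - a) * b) / (a - b)"
    unfolding c_def c'_def by (simp only: diff_divide_distrib[symmetric] times_divide_eq_left)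
  also have "\<dots> = growth a * (a - b) / (a - b)" by (simp add: algebra_simps)
  also have "\<dots> = growth a" using nz by simp
  finally show "sph x 1 = growth (q powr (- x))" unfolding s by (simp add: a_def)
  have alg: "Q * (t * t) = (Q * b + Q * a) * t - 1" if "Q * a * b = 1" "t = a \<or> t = b" for Q t
    using that by (auto simp: algebra_simps)
  have "(q + 1) * growth a = q * b + q * a" using p(5) unfolding p(6) by (simp only: mult.commute)
  then have root: "q * (t * t) = (q + 1) * growth a * t - 1" if "t = a \<or> t = b" for t
    using alg[OF p(4) that] by (simp only:)
  have step: "q * t ^ (n + 2) = (q + 1) * growth a * t ^ (n + 1) - t ^ n" if "t = a \<or> t = b" for t
  proof -
    have "q * t ^ (n + 2) = (q * (t * t)) * t ^ n" by simp
    then show ?thesis unfolding root[OF that] by (simp add: algebra_simps)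
  qed
  have sa: "q * a ^ (n + 2) = (q + 1) * growth a * a ^ (n + 1) - a ^ n"
    and sb: "q * b ^ (n + 2) = (q + 1) * growth a * b ^ (n + 1) - b ^ n" by (rule step; simp)+
  have "q * sph x (n + 2) = c * (q * a ^ (n + 2)) - c' * (q * b ^ (n + 2))"
    unfolding s by (simp only: right_diff_distrib mult.left_commute)
  also have "\<dots> = (q + 1) * growth a * sph x (n + 1) - sph x n"
    unfolding sa sb s by (simp only: algebra_simps)
  finally show "q * sph x (n + 2) = (q + 1) * growth (q powr (- x)) * sph x (n + 1) - sph x n"
    by (simp add: a_def)
qed

lemma sph_bound:
  assumes x: "0 \<le> x" "x < 1 / 2"
  shows "\<exists>C>0. \<forall>n. \<bar>sph x n\<bar> \<le> C * (q powr (- x)) ^ n"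
proof -
  define a b where "a = q powr (- x)" and "b = q powr (x - 1)"
  note p = sph_params[OF x, folded a_def b_def]
  define c c' where "c = (growth a - b) / (a - b)" and "c' = (growth a - a) / (a - b)"
  have s: "sph x n = c * a ^ n - c' * b ^ n" for n by (simp add: sph_def a_def b_def c_def c'_def Let_def)
  have "\<bar>sph x n\<bar> \<le> (\<bar>c\<bar> + \<bar>c'\<bar> + 1) * a ^ n" for n
  proof -
    have "b ^ n \<le> a ^ n" using p(1,2) by (intro power_mono) auto
    then have "\<bar>c'\<bar> * b ^ n \<le> \<bar>c'\<bar> * a ^ n" by (intro mult_left_mono) auto
    moreover have "\<bar>sph x n\<bar> \<le> \<bar>c\<bar> * a ^ n + \<bar>c'\<bar> * b ^ n"
      unfolding s using p(1,2) abs_triangle_ineq4[of "c * a ^ n" "c' * b ^ n"] by (simp add: abs_mult)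
    moreover have "0 \<le> a ^ n" using p(1,2) by simp
    ultimately show ?thesis by (simp add: algebra_simps)
  qed
  moreover have "\<bar>c\<bar> + \<bar>c'\<bar> + 1 > 0" by (simp add: add_nonneg_pos)
  ultimately show ?thesis unfolding a_def by blast
qed

lemma sph_le_exponential:
  assumes x: "0 \<le> x" "x < 1 / 2"
  shows "\<exists>C>0. \<forall>n. sph x n \<le> C * (q powr (- x)) ^ n"
  using sph_bound[OF x] by (meson abs_le_D1)

lemma avg_sph:
  assumes x: "0 \<le> x" "x < 1 / 2"
  shows "avg (\<lambda>y. of_real (sph x (dist' c y))) =
    (\<lambda>y. of_real (growth (q powr (- x)) * sph x (dist' c y)))"
proof
  fix y
  let ?g = "growth (q powr (- x))"
  show "avg (\<lambda>y. of_real (sph x (dist' c y))) y = of_real (?g * sph x (dist' c y))"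
  proof (cases "dist' c y")
    case 0
    then have "y = c" by simp
    then show ?thesis
      using avg_radial[of "\<lambda>n. complex_of_real (sph x n)" c c] sph_rec(1,2)[OF x] by simp
  next
    case (Suc n)
    then have "y \<noteq> c" by auto
    then have "avg (\<lambda>y. of_real (sph x (dist' c y))) y =
        (of_real (sph x n) + of_nat (d - 1) * of_real (sph x (n + 2))) / of_nat d"
      using avg_radial[of "\<lambda>n. complex_of_real (sph x n)" c y] Suc by simp
    also have "\<dots> = of_real ((sph x n + q * sph x (n + 2)) / real d)" by simp
    also have "sph x n + q * sph x (n + 2) = real d * (?g * sph x (n + 1))"
      using sph_rec(3)[OF x, of n] unfolding d_eq by simp
    finally show ?thesis using Suc degree by simp
  qed
qed

lemma avg_power_sph:
  assumes x: "0 \<le> x" "x < 1 / 2"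
  shows "(avg ^^ k) (\<lambda>y. of_real (sph x (dist' c y))) =
    (\<lambda>y. of_real (growth (q powr (- x)) ^ k * sph x (dist' c y)))"
proof (induction k)
  case (Suc k)
  let ?g = "growth (q powr (- x))" and ?F = "\<lambda>y. complex_of_real (sph x (dist' c y))"
  have lin: "avg (\<lambda>y. a * F y) = (\<lambda>y. a * avg F y)" for a F
    by (simp add: avg_def sum_distrib_left fun_eq_iff)
  have "(avg ^^ Suc k) ?F = avg (\<lambda>y. of_real (?g ^ k) * ?F y)"
    by (simp only: funpow.simps o_apply Suc.IH of_real_mult)
  also have "\<dots> = (\<lambda>y. of_real (?g ^ k) * of_real (?g * sph x (dist' c y)))"
    unfolding lin avg_sph[OF x] ..
  finally show ?case by (simp add: mult_ac)
qed simp

lemma Re_avg_power_mono: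
  assumes "\<And>x. Re (F x) \<le> Re (G x)"
  shows "Re ((avg ^^ k) F x) \<le> Re ((avg ^^ k) G x)"
proof (induction k arbitrary: x)
  case (Suc k)
  have "Re (avg F' x) = (\<Sum>y\<in>nbrs x. Re (F' y)) / d" for F' :: "'a \<Rightarrow> complex"
    by (simp add: avg_def Re_divide_of_nat)
  then show ?case using Suc by (simp add: divide_right_mono sum_mono)
qed (use assms in simp)

lemma avg_power_scale: "(avg ^^ k) (\<lambda>x. a * F x) = (\<lambda>x. a * (avg ^^ k) F x)"
proof (induction k)
  case (Suc k)
  then show ?case by (simp add: avg_def sum_distrib_left fun_eq_iff)
qed simp

text \<open>
  The exponential \<open>q\<^sup>-\<^sup>x\<^sup>n\<close> of the distance is not an eigenfunction of the averaging operator in general, but up to a constant it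
  dominates one, the spherical function; averaging preserves inequalities, so its averages grow at least as fast.
\<close>

lemma avg_power_exponential_lower:
  assumes x: "0 \<le> x" "x < 1 / 2"
  shows "\<exists>C>0. \<forall>k. growth (q powr (- x)) ^ k \<le>
    C * cmod ((avg ^^ k) (\<lambda>y. of_real ((q powr (- x)) ^ dist' c y)) c)"
proof -
  obtain C where C: "C > 0" "\<And>n. sph x n \<le> C * (q powr (- x)) ^ n" using sph_le_exponential[OF x] by blast
  have "growth (q powr (- x)) ^ k \<le> C * cmod ((avg ^^ k) (\<lambda>y. of_real ((q powr (- x)) ^ dist' c y)) c)" for k
  proof -
    have "growth (q powr (- x)) ^ k = Re ((avg ^^ k) (\<lambda>y. of_real (sph x (dist' c y))) c)"
      using sph_rec(1)[OF x] by (simp add: avg_power_sph[OF x])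
    also have "\<dots> \<le> Re ((avg ^^ k) (\<lambda>y. of_real C * of_real ((q powr (- x)) ^ dist' c y)) c)"
      using C(2) by (intro Re_avg_power_mono) simp
    also have "\<dots> = C * Re ((avg ^^ k) (\<lambda>y. of_real ((q powr (- x)) ^ dist' c y)) c)"
      by (simp add: avg_power_scale)
    also have "\<dots> \<le> C * cmod ((avg ^^ k) (\<lambda>y. of_real ((q powr (- x)) ^ dist' c y)) c)"
      using C(1) complex_Re_le_cmod by (intro mult_left_mono) auto
    finally show ?thesis .
  qed
  then show ?thesis using C(1) by blast
qed

text \<open>
  The sphere of radius \<open>n\<close> has about \<open>q\<^sup>n\<close> vertices, so the series is dominated by a geometric series of ratio \<open>q\<^sup>1\<^sup>-\<^sup>x\<^sup>s\<close>.
\<close>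

lemma summable_spheres:
  assumes x: "0 \<le> x" and s: "0 < s" "1 < x * s"
    and \<Phi>: "\<And>n. cmod (\<Phi> n) \<le> C * (q powr (- x)) ^ n"
  shows "summable (\<lambda>n. real (card (sphere c n)) * cmod (\<Phi> n) powr s)"
proof (rule summable_comparison_test')
  define t where "t = q powr (1 - x * s)"
  have t: "0 < t" "t < 1" using q_gt_1 s(2) by (auto simp: t_def intro: powr_less_one)
  show "summable (\<lambda>n. (real d * C powr s) * t ^ n)"
    using t by (intro summable_mult summable_geometric) simp
  have "0 \<le> cmod (\<Phi> 0)" by simp
  also have "\<dots> \<le> C" using \<Phi>[of 0] by simp
  finally have "0 \<le> C" .
  fix n :: nat
  have "real (card (sphere c n)) \<le> real d * q ^ n"
  proof (cases n)
    case 0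
    then show ?thesis using degree by (simp add: sphere_0)
  next
    case (Suc m)
    have "q ^ m \<le> q ^ Suc m" using q_gt_1 by (intro power_increasing) auto
    then have "real d * q ^ m \<le> real d * q ^ Suc m" by (intro mult_left_mono) auto
    then show ?thesis unfolding Suc card_sphere by simp
  qed
  moreover have "cmod (\<Phi> n) powr s \<le> (C * (q powr (- x)) ^ n) powr s"
    using \<Phi> s by (intro powr_mono2) auto
  moreover have "(C * (q powr (- x)) ^ n) powr s = C powr s * (q powr (- x * s)) ^ n"
    using \<open>0 \<le> C\<close> q_gt_1 by (simp add: powr_mult powr_power powr_powr mult_ac)
  ultimately have "real (card (sphere c n)) * cmod (\<Phi> n) powr s \<le>
      (real d * q ^ n) * (C powr s * (q powr (- x * s)) ^ n)"
    using degree q_gt_1 by (intro mult_mono) auto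
  also have "\<dots> = (real d * C powr s) * (q * q powr (- x * s)) ^ n"
    by (simp add: power_mult_distrib mult_ac)
  also have "q * q powr (- x * s) = t" using q_gt_1 by (simp add: t_def powr_mult_base)
  finally show "norm (real (card (sphere c n)) * cmod (\<Phi> n) powr s) \<le> (real d * C powr s) * t ^ n" by simp
qed

text \<open>
  As \<open>Im z\<close> is \<open>0\<close> or \<open>\<pi> / ln q\<close>, both powers in \<open>\<gamma>\<close> are real powers of \<open>q\<close> up to the same sign \<open>\<sigma>\<close>. Replacing \<open>\<gamma>\<close> by
  \<open>- \<gamma>\<close> multiplies the value of the spherical function at distance \<open>n\<close> by \<open>(- 1)\<^sup>n\<close>, which does not change its absolute value.
\<close>

lemma spherical_seq_params:
  assumes z: "z \<in> spherical_params d"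
  defines "\<gamma> \<equiv> spherical_gamma (d - 1) z"
  shows "cmod \<gamma> = growth (q powr (- Re z))" "cmod (spherical_seq (d - 1) \<gamma> n) = \<bar>sph (Re z) n\<bar>"
proof -
  define x where "x = Re z"
  have x: "0 \<le> x" "x < 1 / 2" using z by (auto simp: spherical_params_def x_def)
  have lq: "ln q > 0" using q_gt_1 by simp
  have qn: "(of_nat (d - 1) :: complex) \<noteq> 0" using degree by simp
  have "\<exists>\<sigma> :: real. (\<sigma> = 1 \<or> \<sigma> = - 1) \<and> exp (\<i> * of_real (Im z * ln q)) = complex_of_real \<sigma> \<and>
      exp (- \<i> * of_real (Im z * ln q)) = complex_of_real \<sigma>"
  proof (cases "Im z = 0")
    case False
    then have "Im z * ln q = pi" using z lq by (simp add: spherical_params_def)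
    then show ?thesis by (intro exI[of _ "- 1"]) (simp add: exp_minus)
  qed (auto intro!: exI[of _ 1])
  then obtain \<sigma> :: real where \<sigma>: "\<sigma> = 1 \<or> \<sigma> = - 1" "exp (\<i> * of_real (Im z * ln q)) = complex_of_real \<sigma>"
    "exp (- \<i> * of_real (Im z * ln q)) = complex_of_real \<sigma>" by blast
  have Ln: "Ln (of_nat (d - 1)) = of_real (ln q)" using q_gt_1 by (metis Ln_of_nat_over_of_nat Ln_of_real of_real_of_nat_eq order_less_trans zero_less_one)
  have pw: "(of_nat (d - 1) :: complex) powr w = exp (w * of_real (ln q))" for w
    by (simp only: powr_def qn if_False Ln)
  have q0: "q \<noteq> 0" using q_gt_1 by linarith
  have ex: "exp (complex_of_real (y * ln q)) = of_real (q powr y)" for y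
    by (simp only: powr_def q0 if_False exp_of_real)
  have zl: "z * of_real l = of_real (x * l) + \<i> * of_real (Im z * l)" for l
    by (simp add: complex_eq_iff x_def)
  have e1: "(of_nat (d - 1) :: complex) powr z = of_real (\<sigma> * q powr x)"
    unfolding pw zl exp_add \<sigma>(2) ex by (simp only: of_real_mult mult.commute)
  have zl': "(1 - z) * of_real l = of_real ((1 - x) * l) + (- \<i> * of_real (Im z * l))" for l
    by (simp add: complex_eq_iff x_def algebra_simps)
  have e2: "(of_nat (d - 1) :: complex) powr (1 - z) = of_real (\<sigma> * q powr (1 - x))"
    unfolding pw zl' exp_add \<sigma>(3) ex by (simp only: of_real_mult mult.commute)
  have \<gamma>: "\<gamma> = of_real (\<sigma> * growth (q powr (- x)))"
    unfolding \<gamma>_def spherical_gamma_def e1 e2 growth_powr by (simp add: algebra_simps)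
  have \<sigma>2: "\<sigma> * \<sigma> = 1" "\<bar>\<sigma>\<bar> = 1" using \<sigma>(1) by auto
  have "0 < growth (q powr (- x))" using q_gt_1 by (intro growth_pos) simp
  then show "cmod \<gamma> = growth (q powr (- Re z))"
    unfolding \<gamma> norm_of_real abs_mult \<sigma>2 by (simp add: x_def)
  have "spherical_seq (d - 1) \<gamma> n = complex_of_real (\<sigma> ^ n * sph x n)"
  proof (rule spherical_seq_unique)
    show "0 < d - 1" using degree by simp
    show "complex_of_real (\<sigma> ^ 0 * sph x 0) = 1" "complex_of_real (\<sigma> ^ 1 * sph x 1) = \<gamma>"
      using sph_rec(1,2)[OF x] by (simp_all add: \<gamma>)
    fix n
    have "q * (\<sigma> ^ (n + 2) * sph x (n + 2)) = \<sigma> ^ n * (q * sph x (n + 2))" using \<sigma>2 by simp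
    also have "\<dots> = (q + 1) * (\<sigma> * growth (q powr (- x))) * (\<sigma> ^ (n + 1) * sph x (n + 1)) - \<sigma> ^ n * sph x n"
      unfolding sph_rec(3)[OF x] using \<sigma>2 by (simp add: algebra_simps) (simp add: mult.assoc[symmetric])
    finally have "complex_of_real (q * (\<sigma> ^ (n + 2) * sph x (n + 2))) =
      complex_of_real ((q + 1) * (\<sigma> * growth (q powr (- x))) * (\<sigma> ^ (n + 1) * sph x (n + 1)) - \<sigma> ^ n * sph x n)"
      by (simp only:)
    then show "of_nat (d - 1) * complex_of_real (\<sigma> ^ (n + 2) * sph x (n + 2)) =
      (of_nat (d - 1) + 1) * \<gamma> * complex_of_real (\<sigma> ^ (n + 1) * sph x (n + 1)) - complex_of_real (\<sigma> ^ n * sph x n)"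
      unfolding \<gamma> by (simp only: of_real_mult of_real_add of_real_diff of_real_of_nat_eq of_real_1)
  qed
  then show "cmod (spherical_seq (d - 1) \<gamma> n) = \<bar>sph (Re z) n\<bar>"
    by (simp only: norm_of_real abs_mult power_abs \<sigma>2) (simp add: x_def)
qed

end

section \<open>Equivalent and irreducible representations\<close>

lemma equivalent_repsE:
  assumes "equivalent_reps G V \<rho> W \<sigma>"
  obtains U where "bij_betw U (hcarrier V) (hcarrier W)"
    and "\<And>u v. u \<in> hcarrier V \<Longrightarrow> v \<in> hcarrier V \<Longrightarrow> U (u + v) = U u + U v"
    and "\<And>a v. v \<in> hcarrier V \<Longrightarrow> U (a *\<^sub>C v) = a *\<^sub>C U v"
    and "\<And>u v. u \<in> hcarrier V \<Longrightarrow> v \<in> hcarrier V \<Longrightarrow> hinner W (U u) (U v) = hinner V u v"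
    and "\<And>g v. g \<in> carrier G \<Longrightarrow> v \<in> hcarrier V \<Longrightarrow> U (\<rho> g v) = \<sigma> g (U v)"
  using assms unfolding equivalent_reps_def unitary_map_def by blast

lemma equivalent_reps_sym:
  assumes V: "unitary_rep G T V \<rho>" and W: "unitary_rep G T' W \<sigma>"
    and eq: "equivalent_reps G V \<rho> W \<sigma>"
  shows "equivalent_reps G W \<sigma> V \<rho>"
proof -
  interpret V: hilbert V using V by (simp add: unitary_rep_def hilbert_space_iff)
  interpret W: hilbert W using W by (simp add: unitary_rep_def hilbert_space_iff)
  obtain U where bij: "bij_betw U (hcarrier V) (hcarrier W)"
    and add: "\<And>u v. u \<in> hcarrier V \<Longrightarrow> v \<in> hcarrier V \<Longrightarrow> U (u + v) = U u + U v"
    and scale: "\<And>a v. v \<in> hcarrier V \<Longrightarrow> U (a *\<^sub>C v) = a *\<^sub>C U v"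
    and inner: "\<And>u v. u \<in> hcarrier V \<Longrightarrow> v \<in> hcarrier V \<Longrightarrow> hinner W (U u) (U v) = hinner V u v"
    and intertwines: "\<And>g v. g \<in> carrier G \<Longrightarrow> v \<in> hcarrier V \<Longrightarrow> U (\<rho> g v) = \<sigma> g (U v)"
    by (rule equivalent_repsE[OF eq]) (rule that)
  define U' where "U' = inv_into (hcarrier V) U"
  have U'1: "U' w \<in> hcarrier V" "U (U' w) = w" if "w \<in> hcarrier W" for w
    using bij that by (auto simp: U'_def bij_betw_def inv_into_into f_inv_into_f)
  have U'2: "U' (U v) = v" if "v \<in> hcarrier V" for v
    using bij that by (auto simp: U'_def bij_betw_def)
  have "unitary_map W V U'"
    unfolding unitary_map_def
  proof (intro conjI ballI allI)
    show "bij_betw U' (hcarrier W) (hcarrier V)" unfolding U'_def by (rule bij_betw_inv_into[OF bij])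
    show "U' (u + v) = U' u + U' v" if "u \<in> hcarrier W" "v \<in> hcarrier W" for u v
      using U'2[of "U' u + U' v"] add[of "U' u" "U' v"] U'1 that by simp
    show "U' (a *\<^sub>C v) = a *\<^sub>C U' v" if "v \<in> hcarrier W" for a v
      using U'2[of "a *\<^sub>C U' v"] scale[of "U' v" a] U'1 that by simp
    show "hinner V (U' u) (U' v) = hinner W u v" if "u \<in> hcarrier W" "v \<in> hcarrier W" for u v
      using inner[of "U' u" "U' v"] U'1 that by simp
  qed
  moreover have "U' (\<sigma> g w) = \<rho> g (U' w)" if g: "g \<in> carrier G" and w: "w \<in> hcarrier W" for g w
  proof -
    have "\<rho> g (U' w) \<in> hcarrier V"
      using V g U'1[OF w] unfolding unitary_rep_def unitary_map_def by (meson bij_betwE)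
    then show ?thesis using intertwines[OF g U'1(1)[OF w]] U'1(2)[OF w] U'2[of "\<rho> g (U' w)"] by simp
  qed
  ultimately show ?thesis unfolding equivalent_reps_def by blast
qed

text \<open>
  The dense subspace is carried over by the unitary operator, which preserves all matrix coefficients.
\<close>

lemma equivalent_reps_Lp_rep:
  assumes V: "unitary_rep G T V \<rho>" and W: "unitary_rep G T' W \<sigma>" and \<mu>: "space \<mu> = carrier G"
    and eq: "equivalent_reps G V \<rho> W \<sigma>" and Lp: "Lp_rep \<mu> s V \<rho>"
  shows "Lp_rep \<mu> s W \<sigma>"
proof -
  interpret V: hilbert V using V by (simp add: unitary_rep_def hilbert_space_iff)
  interpret W: hilbert W using W by (simp add: unitary_rep_def hilbert_space_iff)
  obtain U where bij: "bij_betw U (hcarrier V) (hcarrier W)"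
    and add: "\<And>u v. u \<in> hcarrier V \<Longrightarrow> v \<in> hcarrier V \<Longrightarrow> U (u + v) = U u + U v"
    and scale: "\<And>a v. v \<in> hcarrier V \<Longrightarrow> U (a *\<^sub>C v) = a *\<^sub>C U v"
    and inner: "\<And>u v. u \<in> hcarrier V \<Longrightarrow> v \<in> hcarrier V \<Longrightarrow> hinner W (U u) (U v) = hinner V u v"
    and intertwines: "\<And>g v. g \<in> carrier G \<Longrightarrow> v \<in> hcarrier V \<Longrightarrow> U (\<rho> g v) = \<sigma> g (U v)"
    by (rule equivalent_repsE[OF eq]) (rule that)
  obtain V0 where V0: "csubspace V0" "V0 \<subseteq> hcarrier V" "htopology V closure_of V0 = hcarrier V"
    "\<And>v w. v \<in> V0 \<Longrightarrow> w \<in> V0 \<Longrightarrow> Lp_function \<mu> s (\<lambda>g. hinner V (\<rho> g v) w)"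
    using Lp by (auto simp: Lp_rep_def)
  have sub: "U ` V0 \<subseteq> hcarrier W" using V0(2) bij by (auto simp: bij_betw_def)
  have U0: "U 0 = 0" using scale[of 0 0] by simp
  have csub: "csubspace (U ` V0)"
    unfolding csubspace_def
  proof (intro conjI ballI allI)
    show "0 \<in> U ` V0" using V0(1) by (intro image_eqI[of _ _ 0]) (auto simp: U0 csubspace_def)
    show "x + y \<in> U ` V0" if xy: "x \<in> U ` V0" "y \<in> U ` V0" for x y
    proof -
      obtain u v where uv: "u \<in> V0" "v \<in> V0" "x = U u" "y = U v" using xy by blast
      then have "u + v \<in> V0" "x + y = U (u + v)"
        using V0(1) add[OF subsetD[OF V0(2) uv(1)] subsetD[OF V0(2) uv(2)]] by (auto simp: csubspace_def)
      then show ?thesis by blast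
    qed
    show "a *\<^sub>C x \<in> U ` V0" if x: "x \<in> U ` V0" for a x
    proof -
      obtain u where u: "u \<in> V0" "x = U u" using x by blast
      then have "a *\<^sub>C u \<in> V0" "a *\<^sub>C x = U (a *\<^sub>C u)"
        using V0(1) scale[OF subsetD[OF V0(2) u(1)]] by (auto simp: csubspace_def)
      then show ?thesis by blast
    qed
  qed
  have "\<exists>y\<in>U ` V0. hnorm W (w - y) < \<epsilon>" if w: "w \<in> hcarrier W" and e: "\<epsilon> > 0" for w \<epsilon>
  proof -
    obtain v where v: "v \<in> hcarrier V" "w = U v" using w bij by (auto simp: bij_betw_def)
    then obtain v' where v': "v' \<in> V0" "hnorm V (v - v') < \<epsilon>"
      using V.closure_of_approx[OF V0(2) _ e, of v] V0(3) by blast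
    have m: "v' \<in> hcarrier V" "v - v' \<in> hcarrier V" using v v' V0(2) by auto
    have "w - U v' = U (v - v')" using add[OF m(2,1)] v(2) by simp
    then have "hnorm W (w - U v') = hnorm V (v - v')" using inner[OF m(2,2)] by (simp add: hnorm_def)
    then show ?thesis using v' by (intro bexI[of _ "U v'"]) auto
  qed
  then have "htopology W closure_of (U ` V0) = hcarrier W"
    unfolding W.closure_of_eq_carrier_iff[OF sub] by blast
  moreover have "Lp_function \<mu> s (\<lambda>g. hinner W (\<sigma> g x) y)" if xy: "x \<in> U ` V0" "y \<in> U ` V0" for x y
  proof -
    obtain u v where uv: "u \<in> V0" "v \<in> V0" "x = U u" "y = U v" using xy by blast
    have c: "u \<in> hcarrier V" "v \<in> hcarrier V" using uv V0(2) by auto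
    have "hinner V (\<rho> g u) v = hinner W (\<sigma> g x) y" if g: "g \<in> carrier G" for g
    proof -
      have "\<rho> g u \<in> hcarrier V"
        using V g c unfolding unitary_rep_def unitary_map_def by (meson bij_betwE)
      then show ?thesis using inner[of "\<rho> g u" v] intertwines[OF g c(1)] c uv by simp
    qed
    then show ?thesis using Lp_function_cong[OF V0(4)[OF uv(1,2)]] \<mu> by simp
  qed
  ultimately show ?thesis unfolding Lp_rep_def using csub sub by blast
qed

context unitary_representation
begin

text \<open>The closed span of an orbit is invariant, so that every non-zero vector of an irreducible representation is cyclic.\<close>

lemma irreducible_cyclic:
  assumes irr: "irreducible_rep G E \<rho>" and \<xi>: "\<xi> \<in> hcarrier E" "\<xi> \<noteq> 0"
  shows "htopology E closure_of (cspan {\<rho> g \<xi> | g. g \<in> carrier G}) = hcarrier E"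
proof -
  define S where "S = {\<rho> g \<xi> | g. g \<in> carrier G}"
  have SE: "S \<subseteq> hcarrier E" using \<xi> by (auto simp: S_def)
  have sub: "cspan S \<subseteq> hcarrier E" by (rule cspan_minimal[OF csubspace_carrier SE])
  define C where "C = htopology E closure_of (cspan S)"
  have CE: "C \<subseteq> hcarrier E" unfolding C_def closure_of_iff[OF sub] by blast
  have inv_span: "\<rho> g ` cspan S \<subseteq> cspan S" if g: "g \<in> carrier G" for g
  proof -
    have cs: "csubspace (cspan S)" by (rule csubspace_cspan)
    have "csubspace {v \<in> hcarrier E. \<rho> g v \<in> cspan S}"
      using cs g unfolding csubspace_def by (simp add: rep_zero rep_add rep_scale)
    moreover have "S \<subseteq> {v \<in> hcarrier E. \<rho> g v \<in> cspan S}"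
    proof
      fix v assume "v \<in> S"
      then obtain h where h: "h \<in> carrier G" "v = \<rho> h \<xi>" by (auto simp: S_def)
      have "\<rho> g v = \<rho> (g \<otimes> h) \<xi>" using g h \<xi> by (simp add: rep_mult)
      then have "\<rho> g v \<in> S" using g h by (auto simp: S_def)
      then show "v \<in> {v \<in> hcarrier E. \<rho> g v \<in> cspan S}" using h \<xi> cspan_superset by auto
    qed
    ultimately show ?thesis using cspan_minimal by blast
  qed
  have "\<rho> g ` C \<subseteq> C" if g: "g \<in> carrier G" for g
  proof
    fix y assume "y \<in> \<rho> g ` C"
    then obtain x where x: "x \<in> C" "y = \<rho> g x" by blast
    have xE: "x \<in> hcarrier E" using x CE by blast
    show "y \<in> C"
      unfolding C_def closure_of_iff[OF sub]
    proof (intro CollectI conjI allI impI)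
      show "y \<in> hcarrier E" using x xE g by simp
      fix \<epsilon> :: real assume "\<epsilon> > 0"
      then obtain z where z: "z \<in> cspan S" "hnorm E (x - z) < \<epsilon>"
        using closure_of_approx[OF sub] x(1) unfolding C_def by blast
      have zE: "z \<in> hcarrier E" using z sub by blast
      have "hnorm E (y - \<rho> g z) = hnorm E (x - z)"
        using rep_norm[OF g, of "x - z"] xE zE g x(2) by (simp add: rep_diff)
      then show "\<exists>y'\<in>cspan S. hnorm E (y - y') < \<epsilon>"
        using z inv_span[OF g] by (intro bexI[of _ "\<rho> g z"]) auto
    qed
  qed
  moreover have "csubspace C" unfolding C_def by (rule closure_of_csubspace[OF csubspace_cspan sub])
  moreover have "closedin (htopology E) C" unfolding C_def by simp
  ultimately have "C = {0} \<or> C = hcarrier E" using irr unfolding irreducible_rep_def by blast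
  moreover have "\<xi> \<in> C"
  proof -
    have "\<xi> = \<rho> \<one> \<xi>" using \<xi> by (simp add: rep_one)
    then have "\<xi> \<in> S" unfolding S_def using one_closed by blast
    then have "\<xi> \<in> cspan S" using cspan_superset by blast
    then show ?thesis
      unfolding C_def using closure_of_subset[of "cspan S" "htopology E"] sub topspace_htopology by blast
  qed
  ultimately show ?thesis using \<xi>(2) by (auto simp: C_def S_def)
qed

end

lemma (in group) exists_left_transversal:
  assumes L: "subgroup L G" shows "\<exists>R. left_transversal G L R"
proof -
  define f where "f g = (SOME x. x \<in> g <# L)" for g
  have ne: "f g \<in> g <# L" if g: "g \<in> carrier G" for g
  proof -
    have "g \<otimes> \<one> \<in> g <# L" unfolding l_coset_def using subgroup.one_closed[OF L] by blast
    then show ?thesis unfolding f_def by (rule someI)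
  qed
  have fc: "f g \<in> carrier G" if g: "g \<in> carrier G" for g
    using ne[OF g] g subgroup.mem_carrier[OF L] by (auto simp: l_coset_def)
  have same: "g <# L = x <# L" if "x \<in> g <# L" "g \<in> carrier G" for g x
    using l_repr_independence[OF that L] .
  have self: "g \<in> g <# L" if "g \<in> carrier G" for g
    unfolding l_coset_def using subgroup.one_closed[OF L] that by force
  have "\<exists>!t. t \<in> f ` carrier G \<and> g \<in> t <# L" if g: "g \<in> carrier G" for g
  proof (intro ex1I conjI)
    show "f g \<in> f ` carrier G" using g by blast
    show "g \<in> f g <# L" using same[OF ne[OF g] g] self[OF g] by simp
    fix t assume t: "t \<in> f ` carrier G \<and> g \<in> t <# L"
    then obtain g' where g': "g' \<in> carrier G" "t = f g'" by blast
    have "g' <# L = t <# L" using same[OF ne[OF g'(1)] g'(1)] g' by simp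
    also have "\<dots> = g <# L" using same[of g t] t g' fc by simp
    finally show "t = f g" using g' by (simp add: f_def)
  qed
  then show ?thesis unfolding left_transversal_def using fc by (intro exI[of _ "f ` carrier G"]) auto
qed

section \<open>Inducing from the automorphism group to the group of almost automorphisms\<close>

context honest_action
begin

abbreviation LG where "LG \<equiv> HG\<lparr>carrier := L\<rparr>"

lemma group_LG: "Group.group LG"
  by (rule subgroup.subgroup_is_group[OF L_subgroup group_axioms])

lemma topspace_LG: "topspace (subtopology T L) = carrier LG"
  using openin_subset[OF L_open] by auto

lemma continuous_act: "continuous_map (subtopology T L) (subgroup_topology adj H) act"
proof -
  obtain g where g: "homeomorphic_maps (subgroup_topology adj H) (subtopology T L) emb g"
    using emb_homeomorphic homeomorphic_map_maps by blast
  have c: "continuous_map (subtopology T L) (subgroup_topology adj H) g"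
    and inv: "\<And>h. h \<in> H \<Longrightarrow> g (emb h) = h"
    using g unfolding homeomorphic_maps_def topspace_subgroup by auto
  show ?thesis
  proof (rule continuous_map_eq[OF c])
    fix x assume "x \<in> topspace (subtopology T L)"
    then obtain h where "h \<in> H" "x = emb h" unfolding topspace_LG by auto
    then show "g x = act x" using inv by simp
  qed
qed

lemma unitary_rep_transported:
  assumes "unitary_rep (subgroup_group adj H) (subgroup_topology adj H) V \<pi>"
  shows "unitary_rep LG (subtopology T L) V (transported_rep adj H \<pi>)"
proof -
  have u: "hilbert_space V" "\<And>h. h \<in> H \<Longrightarrow> unitary_map V V (\<pi> h)"
    "\<And>g h v. g \<in> H \<Longrightarrow> h \<in> H \<Longrightarrow> v \<in> hcarrier V \<Longrightarrow> \<pi> (g \<circ> h) v = \<pi> g (\<pi> h v)"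
    "\<And>v. v \<in> hcarrier V \<Longrightarrow> continuous_map (subgroup_topology adj H) (htopology V) (\<lambda>h. \<pi> h v)"
    using assms by (auto simp: unitary_rep_def aut_group_def)
  have "continuous_map (subtopology T L) (htopology V) (\<lambda>x. transported_rep adj H \<pi> x v)"
    if "v \<in> hcarrier V" for v
    using continuous_map_compose[OF continuous_act u(4)[OF that]] by (simp add: o_def transported_rep_def)
  moreover have "transported_rep adj H \<pi> (x \<otimes>\<^bsub>HG\<^esub> y) v = transported_rep adj H \<pi> x (transported_rep adj H \<pi> y v)"
    if "x \<in> L" "y \<in> L" "v \<in> hcarrier V" for x y v
    using that u(3) by (auto simp: transported_rep_def act_mult)
  moreover have "unitary_map V V (transported_rep adj H \<pi> x)" if "x \<in> L" for x
    using that u(2) by (auto simp: transported_rep_def)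
  ultimately show ?thesis using u(1) by (simp add: unitary_rep_def)
qed

lemma act_aut: "x \<in> L \<Longrightarrow> act x \<in> tree_auts adj"
  using H_aut by auto

lemma act_transitive: "\<exists>x\<in>L. act x v = w"
proof -
  obtain h where "h \<in> H" "h v = w" using transitive by (auto simp: vertex_transitive_def)
  then show ?thesis by (intro bexI[of _ "emb h"]) auto
qed

lemma act_nbr_transitive: "adj v x \<Longrightarrow> adj v y \<Longrightarrow> \<exists>k\<in>K v. act k x = y"
proof -
  assume "adj v x" "adj v y"
  then obtain k where "k \<in> H" "k v = v" "k x = y" using stabiliser_transitive_on_nbrs[OF boundary] by blast
  then show ?thesis by (intro bexI[of _ "emb k"]) (auto simp: fixator_def)
qed

text \<open>
  The properties of the representation induced from a representation with a vector \<open>\<xi>\<close> whose coefficient is a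
  function \<open>\<Phi>\<close> of the distance: it is integrable with exponent \<open>s\<close> if \<open>\<xi>\<close> is cyclic and \<open>\<Phi>\<close> decays fast enough, and conversely
  integrability bounds the iterated averages of \<open>\<Phi>\<close> if \<open>\<xi>\<close> is an invariant unit vector.
\<close>

lemma induced_Lp_rep:
  assumes V: "unitary_rep LG (subtopology T L) V \<pi>" and R: "left_transversal HG L R"
    and \<xi>: "\<xi> \<in> hcarrier V"
    and coeff: "\<And>x. x \<in> L \<Longrightarrow> hinner V (\<pi> x \<xi>) \<xi> = \<Phi> (dist' v\<^sub>0 (act x v\<^sub>0))"
  shows "unitary_rep HG T (induced_space HG L R V \<pi>) (induced_rep HG)"
    and "0 < s \<Longrightarrow> htopology V closure_of (cspan {\<pi> x \<xi> | x. x \<in> L}) = hcarrier V \<Longrightarrow>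
      summable (\<lambda>n. real (card (sphere v\<^sub>0 n)) * cmod (\<Phi> n) powr s) \<Longrightarrow>
      Lp_rep \<mu> s (induced_space HG L R V \<pi>) (induced_rep HG)"
    and "Lp_rep \<mu> s (induced_space HG L R V \<pi>) (induced_rep HG) \<Longrightarrow> 1 \<le> s \<Longrightarrow> hnorm V \<xi> = 1 \<Longrightarrow>
      (\<And>k. k \<in> K v\<^sub>0 \<Longrightarrow> \<pi> k \<xi> = \<xi>) \<Longrightarrow>
      cmod ((avg ^^ n) (\<lambda>x. \<Phi> (dist' v\<^sub>0 x)) v\<^sub>0) \<le> growth (q powr (- 1 / s)) ^ n"
proof -
  interpret I: induction HG T L V \<pi> R
  proof (intro induction.intro induction_axioms.intro unitary_representation.intro)
    show "top_group HG T" by (rule top_group_axioms)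
  qed (use V R L_open L_subgroup group_LG topspace_LG in auto)
  show un: "unitary_rep HG T (induced_space HG L R V \<pi>) (induced_rep HG)"
    by (rule I.unitary_rep_induced)
  interpret TR: tree_representation HG T \<mu> I.E "induced_rep HG" "K v\<^sub>0" d adj L act v\<^sub>0
  proof (intro tree_representation.intro tree_representation_axioms.intro haar_representation.intro
      haar_representation_axioms.intro unitary_representation.intro)
    show "haar_group HG T \<mu>" by (rule haar_group_axioms)
    show "unitary_rep HG T I.E (induced_rep HG)" using un unfolding I.induced_space_eq .
    show "reg_tree d adj" by (rule reg_tree_axioms)
    show "act (g \<otimes>\<^bsub>HG\<^esub> h) x = act g (act h x)" if "g \<in> L" "h \<in> L" for g h x
      using act_mult[OF that] by simp
  qed (use group_axioms topspace_T K_subgroup K_open K_compact L_subgroup act_aut act_transitive K_eq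
      act_nbr_transitive in auto)
  define u where "u = I.extend \<xi>"
  have u: "u \<in> hcarrier I.E" using I.extend_mem[OF \<xi>] by (simp add: u_def)
  have c1: "hinner I.E (induced_rep HG g u) u = \<Phi> (dist' v\<^sub>0 (act g v\<^sub>0))" if "g \<in> L" for g
    using I.coefficient_extend[OF _ \<xi> \<xi>, of g] coeff[OF that] that emb_carrier by (auto simp: u_def)
  have c2: "hinner I.E (induced_rep HG g u) u = 0" if "g \<in> carrier HG" "g \<notin> L" for g
    using I.coefficient_extend[OF that(1) \<xi> \<xi>] that(2) by (simp add: u_def)
  show "Lp_rep \<mu> s (induced_space HG L R V \<pi>) (induced_rep HG)"
    if s: "0 < s" and cyc: "htopology V closure_of (cspan {\<pi> x \<xi> | x. x \<in> L}) = hcarrier V"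
      and sm: "summable (\<lambda>n. real (card (sphere v\<^sub>0 n)) * cmod (\<Phi> n) powr s)"
    unfolding I.induced_space_eq
    by (rule TR.cyclic_Lp_rep[OF s u _ c1 c2 sm]) (use I.cyclic_induced[OF \<xi> cyc] in \<open>simp add: u_def\<close>)
  show "cmod ((avg ^^ n) (\<lambda>x. \<Phi> (dist' v\<^sub>0 x)) v\<^sub>0) \<le> growth (q powr (- 1 / s)) ^ n"
    if Lp: "Lp_rep \<mu> s (induced_space HG L R V \<pi>) (induced_rep HG)" and s: "1 \<le> s"
      and n1: "hnorm V \<xi> = 1" and inv: "\<And>k. k \<in> K v\<^sub>0 \<Longrightarrow> \<pi> k \<xi> = \<xi>"
  proof (rule TR.Lp_rep_avg_power_bound[OF _ s _ _ refl c1])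
    show "Lp_rep \<mu> s I.E (induced_rep HG)" using Lp unfolding I.induced_space_eq .
    show "hnorm I.E u = 1" using I.norm_extend[OF \<xi>] n1 by (simp add: u_def)
    have "induced_rep HG k u = u" if k: "k \<in> K v\<^sub>0" for k
      using I.ind_extend[OF _ \<xi>, of k] inv[OF k] k by (auto simp: u_def fixator_def)
    then show "u \<in> TR.invariants" using u by (simp add: TR.invariants_def)
  qed
qed

text \<open>
  For the direction from left to right a single average suffices: at the base vertex the average of the spherical
  function is its eigenvalue, whose absolute value is \<open>growth (q\<^sup>-\<^sup>x)\<close> with \<open>x = Re z\<close>, and \<open>growth (q\<^sup>-\<^sup>x)\<close> decreases with \<open>x\<close>.
\<close>

theorem induced_spherical:
  assumes p: "2 < p" and z: "z \<in> spherical_params d"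
    and sph: "spherical_rep_with adj H v\<^sub>0 (spherical_function d adj v\<^sub>0 (spherical_gamma (d - 1) z)) V \<pi>"
    and R: "left_transversal HG L R"
  shows "Lp_plus_rep \<mu> p (induced_space HG L R V (transported_rep adj H \<pi>)) (induced_rep HG) \<longleftrightarrow> 1 / p \<le> Re z"
proof -
  let ?\<pi> = "transported_rep adj H \<pi>"
  define \<Phi> where "\<Phi> = spherical_seq (d - 1) (spherical_gamma (d - 1) z)"
  define x where "x = Re z"
  have x: "0 \<le> x" "x < 1 / 2" using z by (auto simp: spherical_params_def x_def)
  have uV: "unitary_rep LG (subtopology T L) V ?\<pi>"
    using sph unitary_rep_transported unfolding spherical_rep_with_def by blast
  obtain \<xi> where \<xi>: "\<xi> \<in> hcarrier V" "hnorm V \<xi> = 1" "\<And>k. k \<in> fixator H {v\<^sub>0} \<Longrightarrow> \<pi> k \<xi> = \<xi>"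
    "\<And>h. h \<in> H \<Longrightarrow> hinner V (\<pi> h \<xi>) \<xi> = \<Phi> (dist' v\<^sub>0 (h v\<^sub>0))"
    using sph by (auto simp: spherical_rep_with_def spherical_function_def \<Phi>_def)
  have coeff: "hinner V (?\<pi> y \<xi>) \<xi> = \<Phi> (dist' v\<^sub>0 (act y v\<^sub>0))" if "y \<in> L" for y
    using that \<xi>(4) by (auto simp: transported_rep_def)
  have inv: "?\<pi> k \<xi> = \<xi>" if "k \<in> K v\<^sub>0" for k
    using that \<xi>(3) by (auto simp: transported_rep_def fixator_def)
  interpret U: unitary_representation LG "subtopology T L" V ?\<pi>
    using group_LG topspace_LG uV by (intro unitary_representation.intro)
  have irr: "irreducible_rep LG V ?\<pi>"
  proof -
    have "(\<forall>g\<in>carrier LG. ?\<pi> g ` W \<subseteq> W) \<longleftrightarrow> (\<forall>h\<in>carrier (subgroup_group adj H). \<pi> h ` W \<subseteq> W)" for W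
      by (auto simp: transported_rep_def)
    then show ?thesis using sph unfolding spherical_rep_with_def irreducible_rep_def by simp
  qed
  have "\<xi> \<noteq> 0" using \<xi>(2) by auto
  then have cyc: "htopology V closure_of (cspan {?\<pi> y \<xi> | y. y \<in> L}) = hcarrier V"
    using U.irreducible_cyclic[OF irr \<xi>(1)] by simp
  show ?thesis
  proof
    assume Lp: "Lp_plus_rep \<mu> p (induced_space HG L R V ?\<pi>) (induced_rep HG)"
    have le: "1 / (p + e) \<le> x" if e: "e > 0" for e
    proof -
      have "Lp_rep \<mu> (p + e) (induced_space HG L R V ?\<pi>) (induced_rep HG)"
        using Lp e by (simp add: Lp_plus_rep_def)
      then have "cmod ((avg ^^ 1) (\<lambda>x. \<Phi> (dist' v\<^sub>0 x)) v\<^sub>0) \<le> growth (q powr (- 1 / (p + e))) ^ 1"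
        using p e by (intro induced_Lp_rep(3)[OF uV R \<xi>(1) coeff _ _ \<xi>(2) inv]) auto
      moreover have "avg (\<lambda>x. \<Phi> (dist' v\<^sub>0 x)) v\<^sub>0 = spherical_gamma (d - 1) z"
        using avg_radial[of \<Phi> "v\<^sub>0" "v\<^sub>0"] by (simp add: \<Phi>_def)
      ultimately have "growth (q powr (- x)) \<le> growth (q powr (- (1 / (p + e))))"
        using spherical_seq_params(1)[OF z] by (simp add: x_def)
      moreover have "0 \<le> 1 / (p + e)" "1 / (p + e) \<le> 1 / 2" using p e by (auto simp: field_simps)
      ultimately show ?thesis using growth_antimono_iff[of x "1 / (p + e)"] x by simp
    qed
    have x0: "0 < x" using le[of 1] p by (auto intro: less_le_trans[rotated])
    have "1 / x \<le> p + e" if e: "e > 0" for e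
      using le[OF e] x0 p e by (simp add: field_simps)
    then have "1 / x \<le> p" by (rule field_le_epsilon)
    then show "1 / p \<le> Re z" using x0 p by (simp add: x_def field_simps)
  next
    assume "1 / p \<le> Re z"
    then have px: "1 \<le> x * p" using p by (simp add: x_def field_simps)
    obtain C where C: "\<And>n. \<bar>sph x n\<bar> \<le> C * (q powr (- x)) ^ n" using sph_bound[OF x] by blast
    have "Lp_rep \<mu> (p + e) (induced_space HG L R V ?\<pi>) (induced_rep HG)" if e: "e > 0" for e
    proof (rule induced_Lp_rep(2)[OF uV R \<xi>(1) coeff _ cyc])
      have "0 < x" using px p by (metis mult_not_zero not_one_le_zero order_le_less x(1))
      then have "0 < x * e" using e by simp
      then have "1 < x * (p + e)" using px by (simp add: distrib_left)
      then show "summable (\<lambda>n. real (card (sphere v\<^sub>0 n)) * cmod (\<Phi> n) powr (p + e))"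
        using C spherical_seq_params(2)[OF z] p e x
        by (intro summable_spheres[of x _ _ C]) (auto simp: \<Phi>_def x_def)
    qed (use p e in auto)
    then show "Lp_plus_rep \<mu> p (induced_space HG L R V ?\<pi>) (induced_rep HG)"
      by (simp add: Lp_plus_rep_def)
  qed
qed

end

section \<open>Inducing the Dirichlet space\<close>

context dirichlet
begin

text \<open>The kernel function of a vertex is fixed by the stabiliser of the vertex, which is open.\<close>

lemma unitary_rep_dirichlet: "unitary_rep LG (subtopology T L) D (\<lambda>x. trans (act x))"
proof -
  interpret LG: group LG by (rule group_LG)
  interpret A: unitary_action LG D "\<lambda>x. trans (act x)" "subtopology T L"
  proof (intro unitary_action.intro unitary_operators.intro unitary_operators_axioms.intro unitary_action_axioms.intro)
    show "hilbert D" by (rule D.hilbert_E)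
    show "openin (subtopology T L) ((\<lambda>x. g \<otimes>\<^bsub>LG\<^esub> x) ` N)"
      if g: "g \<in> carrier LG" and N: "openin (subtopology T L) N" for g N
    proof -
      have N': "openin T N" "N \<subseteq> L" using N openin_open_subtopology[OF L_open] by auto
      have gG: "g \<in> carrier HG" using g emb_carrier by auto
      have "(\<lambda>x. g \<otimes>\<^bsub>HG\<^esub> x) ` N \<subseteq> L" using g N'(2) subgroup.m_closed[OF L_subgroup] by auto
      then show ?thesis using openin_translate[OF gG N'(1)] openin_open_subtopology[OF L_open] by simp
    qed
    show "trans (act (g \<otimes>\<^bsub>LG\<^esub> h)) v = trans (act g) (trans (act h) v)"
      if "g \<in> carrier LG" "h \<in> carrier LG" for g h v
      using that trans_comp by (auto simp: act_mult)
  qed (use LG.group_axioms topspace_LG unitary_trans in auto)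
  have "kern x \<in> A.smooth" for x
  proof (rule A.smoothI[OF kern_mem])
    fix \<epsilon> :: real assume e: "\<epsilon> > 0"
    have "openin (subtopology T L) (K x)"
      using K_open[of x] openin_open_subtopology[OF L_open] by (auto simp: fixator_def)
    moreover have "\<one>\<^bsub>LG\<^esub> \<in> K x" using subgroup.one_closed[OF K_subgroup[of x]] by simp
    moreover have "hnorm D (trans (act k) (kern x) - kern x) < \<epsilon>" if "k \<in> K x" for k
      using that e trans_kern by (auto simp: fixator_def)
    ultimately show "\<exists>N. openin (subtopology T L) N \<and> \<one>\<^bsub>LG\<^esub> \<in> N \<and>
        (\<forall>g\<in>N. hnorm D (trans (act g) (kern x) - kern x) < \<epsilon>)" by blast
  qed
  then have "cspan (range kern) \<subseteq> A.smooth" by (intro cspan_minimal A.csubspace_smooth) auto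
  then have "htopology D closure_of (cspan (range kern)) \<subseteq> htopology D closure_of A.smooth"
    by (rule closure_of_mono)
  moreover have "htopology D closure_of A.smooth \<subseteq> hcarrier D"
    using closure_of_subset_topspace[of "htopology D"] unfolding D.E.topspace_htopology .
  ultimately have "htopology D closure_of A.smooth = hcarrier D" unfolding kern_dense by blast
  then show ?thesis by (rule A.unitary_rep_if_smooth_dense)
qed

lemma kern_cyclic: "htopology D closure_of (cspan {trans (act x) (kern v\<^sub>0) | x. x \<in> L}) = hcarrier D"
proof -
  have "{trans (act x) (kern v\<^sub>0) | x. x \<in> L} = range kern"
  proof (intro equalityI subsetI)
    fix F assume "F \<in> {trans (act x) (kern v\<^sub>0) | x. x \<in> L}"
    then show "F \<in> range kern" using trans_kern by auto
  next
    fix F assume "F \<in> range kern"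
    then obtain y where y: "F = kern y" by blast
    obtain x where x: "x \<in> L" "act x v\<^sub>0 = y" using act_transitive by blast
    then have "F = trans (act x) (kern v\<^sub>0)" using trans_kern[of "act x" "v\<^sub>0"] y by auto
    then show "F \<in> {trans (act x) (kern v\<^sub>0) | x. x \<in> L}" using x by blast
  qed
  then show ?thesis using kern_dense by simp
qed

end

context honest_action
begin

text \<open>
  The kernel with \<open>r = q\<^sup>-\<^sup>x\<close>, \<open>x = 1 / p\<close>, decays exactly like the spherical function of parameter \<open>1 / p\<close>, and its iterated
  averages grow at the same rate. Integrability with an exponent \<open>s < p\<close> would force the smaller growth rate that belongs to
  \<open>1 / s > 1 / p\<close>.
\<close>

theorem exists_exact_Lp_plus_rep:
  assumes p: "2 < p"
  shows "\<exists>(V :: (('a \<Rightarrow> 'a) set \<Rightarrow> ('a \<Rightarrow> 'a) \<Rightarrow> complex) hspace) \<rho>.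
    unitary_rep HG T V \<rho> \<and> Lp_plus_rep \<mu> p V \<rho> \<and> (\<forall>q'. 1 \<le> q' \<and> q' < p \<longrightarrow> \<not> Lp_plus_rep \<mu> q' V \<rho>)"
proof -
  obtain v\<^sub>0 :: 'a where True by blast
  define x where "x = 1 / p"
  have x: "0 < x" "x < 1 / 2" using p by (auto simp: x_def field_simps)
  define r where "r = q powr (- x)"
  have r: "0 < r" "r < 1" using q_gt_1 x by (auto simp: r_def powr_less_one)
  interpret D: dirichlet d adj H T \<mu> "v\<^sub>0" r by unfold_locales (use r in auto)
  obtain R where R: "left_transversal HG L R" using exists_left_transversal[OF L_subgroup] by blast
  let ?V = "induced_space HG L R D.D (\<lambda>y. D.trans (act y))"
  define \<Phi> where "\<Phi> n = complex_of_real (r ^ n)" for n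
  have coeff: "hinner D.D (D.trans (act y) (D.kern v\<^sub>0)) (D.kern v\<^sub>0) = \<Phi> (dist' v\<^sub>0 (act y v\<^sub>0))" if "y \<in> L" for y
    using that D.trans_kern[of "act y" "v\<^sub>0"] D.inner_kern_base by (auto simp: \<Phi>_def)
  note ind = induced_Lp_rep[OF D.unitary_rep_dirichlet R D.kern_mem coeff]
  have "Lp_rep \<mu> (p + e) ?V (induced_rep HG)" if e: "e > 0" for e
  proof (rule ind(2)[OF _ _ D.kern_cyclic])
    have "1 < x * (p + e)" using e p by (simp add: x_def field_simps)
    then show "summable (\<lambda>n. real (card (sphere v\<^sub>0 n)) * cmod (\<Phi> n) powr (p + e))"
      using e p x r by (intro summable_spheres[of x _ _ 1]) (auto simp: \<Phi>_def r_def norm_power)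
  qed (use e p in auto)
  then have plus: "Lp_plus_rep \<mu> p ?V (induced_rep HG)" by (simp add: Lp_plus_rep_def)
  have "\<not> Lp_plus_rep \<mu> q' ?V (induced_rep HG)" if q': "1 \<le> q'" "q' < p" for q'
  proof
    assume Lp: "Lp_plus_rep \<mu> q' ?V (induced_rep HG)"
    \<comment> \<open>An exponent between \<open>q'\<close> and \<open>p\<close>; it exceeds \<open>2\<close>, since growth rates are compared on \<open>[0, 1/2]\<close>.\<close>
    define s where "s = (max q' 2 + p) / 2"
    have s: "q' < s" "2 < s" "s < p" using q' p by (auto simp: s_def)
    have "Lp_rep \<mu> s ?V (induced_rep HG)"
      using Lp[unfolded Lp_plus_rep_def, rule_format, of "s - q'"] s by simp
    moreover have "hnorm D.D (D.kern v\<^sub>0) = 1" using D.inner_kern_base[of "v\<^sub>0"] by (simp add: hnorm_def)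
    moreover have "D.trans (act k) (D.kern v\<^sub>0) = D.kern v\<^sub>0" if "k \<in> K v\<^sub>0" for k
      using that D.trans_kern by (auto simp: fixator_def)
    ultimately have up: "cmod ((avg ^^ n) (\<lambda>y. \<Phi> (dist' v\<^sub>0 y)) v\<^sub>0) \<le> growth (q powr (- 1 / s)) ^ n" for n
      using s by (intro ind(3)) auto
    obtain C where C: "C > 0" "\<And>k. growth (q powr (- x)) ^ k \<le>
        C * cmod ((avg ^^ k) (\<lambda>y. of_real ((q powr (- x)) ^ dist' v\<^sub>0 y)) v\<^sub>0)"
      using avg_power_exponential_lower[of x "v\<^sub>0"] x by auto
    have "growth (q powr (- x)) ^ k \<le> C * growth (q powr (- 1 / s)) ^ k" for k
      using order_trans[OF C(2) mult_left_mono[OF up less_imp_le[OF C(1)], of k, unfolded \<Phi>_def r_def]] .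
    moreover have gp: "0 < growth (q powr y)" for y using q_gt_1 by (intro growth_pos) simp
    ultimately have "growth (q powr (- x)) \<le> growth (q powr (- 1 / s))"
      using le_if_powers_bounded[OF less_imp_le[OF gp] gp, of "- x" C "- 1 / s"] by blast
    then have "growth (q powr (- x)) \<le> growth (q powr (- (1 / s)))" by (simp only: minus_divide_left)
    moreover have "growth (q powr (- (1 / s))) < growth (q powr (- x))"
    proof (rule growth_strict_antimono)
      show "0 \<le> x" using x by simp
      show "x < 1 / s" using s p by (simp add: x_def frac_less2)
      show "1 / s \<le> 1 / 2" using s by (simp add: field_simps)
    qed
    ultimately show False by simp
  qed
  with plus ind(1) show ?thesis by blast
qed

end

theorem theorem2p1:
  fixes d :: nat
    and adj :: "'a \<Rightarrow> 'a \<Rightarrow> bool"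
    and H :: "('a \<Rightarrow> 'a) set"
    and v\<^sub>0 :: 'a
    and T :: "('a \<Rightarrow> 'a) set topology"
    and \<mu> :: "('a \<Rightarrow> 'a) set measure"
  assumes "d \<ge> 3"
    and "regular_tree d adj"
    and "subgroup H (aut_group adj)"
    and "closedin (aut_topology adj) H"
    and "\<not> compactin (aut_topology adj) H"
    and "vertex_transitive H"
    and "boundary_transitive adj H"
    and "tits_independence adj H"
    and "honest_topology adj H T"
    and "left_haar_measure (honest_group adj H) T \<mu>"
  shows
    "(\<forall>(p::real) (p'::real) z (V :: 'v::complex_vector hspace) \<pi> R.
        2 < p \<and> 1 < p' \<and> p' < 2 \<and> 1 / p + 1 / p' = 1 \<and> z \<in> spherical_params d \<and>
        spherical_rep_with adj H v\<^sub>0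
          (spherical_function d adj v\<^sub>0 (spherical_gamma (d - 1) z)) V \<pi> \<and>
        left_transversal (honest_group adj H) (honest_embed adj H ` H) R
        \<longrightarrow> (Lp_plus_rep \<mu> p
               (induced_space (honest_group adj H) (honest_embed adj H ` H) R V
                  (transported_rep adj H \<pi>))
               (induced_rep (honest_group adj H))
             \<longleftrightarrow> Re z \<in> {1 / p .. 1 / p'}))
     \<and>
     (\<exists>(V :: real \<Rightarrow> (('a \<Rightarrow> 'a) set \<Rightarrow> ('a \<Rightarrow> 'a) \<Rightarrow> complex) hspace) \<rho>.
        (\<forall>p>2. unitary_rep (honest_group adj H) T (V p) (\<rho> p) \<and>
               Lp_plus_rep \<mu> p (V p) (\<rho> p) \<and>
               (\<forall>q. 1 \<le> q \<and> q < p \<longrightarrow> \<not> Lp_plus_rep \<mu> q (V p) (\<rho> p)) \<and>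
               \<not> tempered_rep \<mu> (V p) (\<rho> p)) \<and>
        (\<forall>p>2. \<forall>q>2. p \<noteq> q \<longrightarrow>
           \<not> equivalent_reps (honest_group adj H) (V p) (\<rho> p) (V q) (\<rho> q)))"
proof -
  interpret honest_action d adj H T \<mu>
    by (intro honest_action.intro tree_action.intro reg_tree.intro tree_action_axioms.intro
        honest_action_axioms.intro) (fact assms)+
  have i: "Lp_plus_rep \<mu> p (induced_space HG L R V (transported_rep adj H \<pi>)) (induced_rep HG)
      \<longleftrightarrow> Re z \<in> {1 / p .. 1 / p'}"
    if "2 < p" "1 < p'" "p' < 2" "z \<in> spherical_params d"
      "spherical_rep_with adj H v\<^sub>0 (spherical_function d adj v\<^sub>0 (spherical_gamma (d - 1) z)) V \<pi>"
      "left_transversal HG L R"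
    for p p' :: real and z and V :: "'v hspace" and \<pi> R
  proof -
    have "1 / 2 < 1 / p'" using that(2,3) by (simp add: field_simps)
    moreover have "Re z < 1 / 2" using that(4) by (simp add: spherical_params_def)
    ultimately have "Re z \<le> 1 / p'" by linarith
    then show ?thesis using induced_spherical[OF that(1,4,5,6)] by simp
  qed
  obtain V :: "real \<Rightarrow> (('a \<Rightarrow> 'a) set \<Rightarrow> ('a \<Rightarrow> 'a) \<Rightarrow> complex) hspace" and \<rho> where
    f: "\<And>p. 2 < p \<Longrightarrow> unitary_rep HG T (V p) (\<rho> p) \<and> Lp_plus_rep \<mu> p (V p) (\<rho> p) \<and>
      (\<forall>q. 1 \<le> q \<and> q < p \<longrightarrow> \<not> Lp_plus_rep \<mu> q (V p) (\<rho> p))"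
    using exists_exact_Lp_plus_rep by metis
  have lt: "\<not> equivalent_reps HG (V p) (\<rho> p) (V q) (\<rho> q)"
    if "2 < p" "p < q" for p q
  proof
    assume eq: "equivalent_reps HG (V p) (\<rho> p) (V q) (\<rho> q)"
    have "2 < q" using that by simp
    have "Lp_plus_rep \<mu> p (V q) (\<rho> q)"
      using equivalent_reps_Lp_rep[OF _ _ space_haar eq] f[OF \<open>2 < p\<close>] f[OF \<open>2 < q\<close>]
      unfolding Lp_plus_rep_def by blast
    then show False using f[OF \<open>2 < q\<close>] that by force
  qed
  have neq: "\<not> equivalent_reps HG (V p) (\<rho> p) (V q) (\<rho> q)"
    if "2 < p" "2 < q" "p \<noteq> q" for p q
  proof (cases "p < q")
    case False
    then have "\<not> equivalent_reps HG (V q) (\<rho> q) (V p) (\<rho> p)" using lt that by simp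
    then show ?thesis using equivalent_reps_sym f[OF that(1)] f[OF that(2)] by blast
  qed (use lt that in blast)
  have "\<not> tempered_rep \<mu> (V p) (\<rho> p)" if "2 < p" for p
    unfolding tempered_rep_def using f[OF that] that by simp
  then have ii: "(\<forall>p>2. unitary_rep HG T (V p) (\<rho> p) \<and>
      Lp_plus_rep \<mu> p (V p) (\<rho> p) \<and>
      (\<forall>q. 1 \<le> q \<and> q < p \<longrightarrow> \<not> Lp_plus_rep \<mu> q (V p) (\<rho> p)) \<and>
      \<not> tempered_rep \<mu> (V p) (\<rho> p)) \<and>
    (\<forall>p>2. \<forall>q>2. p \<noteq> q \<longrightarrow>
      \<not> equivalent_reps HG (V p) (\<rho> p) (V q) (\<rho> q))"
    using f neq by blast
  show ?thesis
  proof (intro conjI allI impI; (elim conjE)?)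
    show "Lp_plus_rep \<mu> p (induced_space HG L R V (transported_rep adj H \<pi>)) (induced_rep HG)
        \<longleftrightarrow> Re z \<in> {1 / p .. 1 / p'}"
      if "2 < p" "1 < p'" "p' < 2" "z \<in> spherical_params d"
        "spherical_rep_with adj H v\<^sub>0 (spherical_function d adj v\<^sub>0 (spherical_gamma (d - 1) z)) V \<pi>"
        "left_transversal HG L R"
      for p p' :: real and z and V :: "'v hspace" and \<pi> R
      by (rule i[OF that])
  qed (rule exI[of _ V], rule exI[of _ \<rho>], rule ii)
qed

end
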